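(* Let $V=V^0\oplus V^1$ be an SVOA such that $V^1$ has top weight $3/2$, satisfying assumptions (1)--(6) of the context, and let $c$ be its central charge. Suppose that the top level $X=V^1_{3/2}$ forms a conformal $6$-design based on $V^0$, and put $d=\dim X$. Suppose further that $V$ has an extendable simple $c=7/10$ Virasoro vector $e$, so that $e$ and its square root generate a sub SVOA $W$ isomorphic to $L(\tfrac7{10},0)\oplus L(\tfrac7{10},\tfrac32)$. Then $(c,d)=(\tfrac{7}{10},1)$ or $(c,d)=(\tfrac{47}{2},4371)$. If moreover $W$ is a proper subalgebra of $V$, then $(c,d)=(\tfrac{47}{2},4371)$.
   Context: All vector spaces are over $\mathbb{C}$. For a vertex operator superalgebra (SVOA) $V=V^0\oplus V^1$ ($V^0$ even, $V^1$ odd) write $Y(a,z)=\sum_{n\in\mathbb Z}a_{(n)}z^{-n-1}$; $\omega$ is the conformal vector, $L(n)=\omega_{(n+1)}$, and $\mathrm{o}(a)=a_{(\mathrm{wt}(a)-1)}$ for $L(0)$-homogeneous $a$, extended linearly. $V$ is of CFT-type if its $L(0)$-weights are non-negative and its weight $0$ subspace is $\mathbb{C}\mathbf 1$. $\langle\omega\rangle$ is the subalgebra generated by $\omega$. Assumptions: (1) $V$ is of CFT-type and self-dual. (2) $V^0$ has weights in $\mathbb{Z}_{\ge0}$ with zero weight $1$ subspace, and $V^1=\bigoplus_{n\ge0}V_{3/2+n}$ with $V^1_{3/2}\neq0$. (3) The invariant bilinear form on $V$ is non-degenerate. (The form satisfies $(Y(a,z)u|v)=(u|Y(e^{zL(1)}z^{-2L(0)}\zeta^{L(0)+2L(0)^2}a,z^{-1})v)$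 with $\zeta^r=e^{r\pi\sqrt{-1}}$.) (4) Its restriction to $\langle\omega\rangle$ is non-degenerate. (5) $V$ is a direct sum of highest weight modules over the Virasoro algebra generated by $\omega$. (6) If $V^1_{3/2}$ forms a conformal $2t$-design (defined below) with $t\le5$ then $c$ is not a zero of $D_{2t}(c)$, where $D_2(c)=c$, $D_4(c)=c(5c+22)$, $D_6(c)=(2c-1)(7c+68)D_4(c)$, $D_8(c)=(3c+46)(5c+3)D_6(c)$, $D_{10}(c)=(11c+232)D_8(c)$. Conformal design: let $V[n]$ be the sum of the highest weight Virasoro submodules of $V$ of highest weight $n$; $V=\bigoplus_{n\ge0}V[n]$ and $\pi:V\to V[0]=\langle\omega\rangle$ is the projection. $X$ forms a conformal $t$-design based on $V^0$ if $\mathrm{tr}_X\mathrm{o}(a)=\mathrm{tr}_X\mathrm{o}(\pi(a))$ for all $a\in\bigoplus_{0\le n\le t}V^0_n$. $L(c',h')$ is the irreducible highest weight Virasoro module of central charge $c'$ and highest weight $h'$; $L(\tfrac7{10},0)\oplus L(\tfrac7{10},\tfrac32)$ is the simple $N=1$ $c=7/10$ Virasoro SVOA. A Virasoro vector $e\in V^0_2$ of central charge $7/10$ is simple if it generates a subalgebra isomorphic to $L(\tfrac7{10},0)$; it is extendable if there is a square root $v\in V^1_{3/2}$ of $e$, i.e. $v_{(0)}v=e$ (the product on $V^1_{3/2}$ in the $\mathbb{Z}_2$-extended Griess algebra $V^0_2\oplus V^1_{3/2}$ being $uv=u_{(0)}v$), such that the subalgebra $\langle v\rangle$ generated by $v$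 is isomorphic to $L(\tfrac7{10},0)\oplus L(\tfrac7{10},\tfrac32)$. *)

theory Defs
  imports Complex_Main "HOL-Library.Groups_Big_Fun"
begin

section \<open>Vertex operator superalgebras\<close>

text \<open>
  The data of a vertex operator superalgebra. The underlying space is the subspace
  \<open>even_part + odd_part\<close> of the ambient complex vector space on the type \<open>'v\<close>, so that a
  subalgebra, possibly with another conformal vector, is a structure over the same type.
  \<open>mode V a n b\<close> is \<open>a\<^sub>(\<^sub>n\<^sub>) b\<close>; \<open>charge\<close> is the central charge.
\<close>

record 'v svoa_data =
  scl :: "complex \<Rightarrow> 'v \<Rightarrow> 'v"
  even_part :: "'v set"
  odd_part :: "'v set"
  mode :: "'v \<Rightarrow> int \<Rightarrow> 'v \<Rightarrow> 'v"
  vac :: 'v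
  conf :: 'v
  charge :: complex

abbreviation vspan :: "('v::ab_group_add) svoa_data \<Rightarrow> 'v set \<Rightarrow> 'v set" where
  "vspan V \<equiv> module.span (scl V)"

abbreviation vsubspace :: "('v::ab_group_add) svoa_data \<Rightarrow> 'v set \<Rightarrow> bool" where
  "vsubspace V \<equiv> module.subspace (scl V)"

abbreviation vdim :: "('v::ab_group_add) svoa_data \<Rightarrow> 'v set \<Rightarrow> nat" where
  "vdim V \<equiv> vector_space.dim (scl V)"

definition vcarrier :: "('v::ab_group_add) svoa_data \<Rightarrow> 'v set" where
  "vcarrier V = {u + w |u w. u \<in> even_part V \<and> w \<in> odd_part V}"

definition parity_part :: "('v::ab_group_add) svoa_data \<Rightarrow> bool \<Rightarrow> 'v set" where
  "parity_part V p = (if p then odd_part V else even_part V)"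

definition L :: "('v::ab_group_add) svoa_data \<Rightarrow> int \<Rightarrow> 'v \<Rightarrow> 'v" where
  "L V n u = mode V (conf V) (n + 1) u"

definition weight_space :: "('v::ab_group_add) svoa_data \<Rightarrow> complex \<Rightarrow> 'v set" where
  "weight_space V h = {u \<in> vcarrier V. L V 0 u = scl V h u}"

definition virasoro_relations :: "('v::ab_group_add) svoa_data \<Rightarrow> 'v \<Rightarrow> complex \<Rightarrow> bool" where
  "virasoro_relations V e c' \<longleftrightarrow>
    (\<forall>m n. \<forall>u \<in> vcarrier V.
      mode V e (m + 1) (mode V e (n + 1) u) - mode V e (n + 1) (mode V e (m + 1) u)
      = scl V (of_int (m - n)) (mode V e (m + n + 1) u)
        + (if m + n = 0 then scl V (of_int (m ^ 3 - m) / 12 * c') u else 0))"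

text \<open>
  \<open>Sum_any\<close> is the sum of a finitely supported family. The sums in the Borcherds identity
  are finite by the truncation axiom. The parity argument \<open>True\<close> means odd.
\<close>

locale svoa = vector_space "scl V" for V :: "('v::ab_group_add) svoa_data" +
  assumes subspace_even: "vsubspace V (even_part V)"
    and subspace_odd: "vsubspace V (odd_part V)"
    and even_Int_odd: "even_part V \<inter> odd_part V = {0}"
    and vac_even: "vac V \<in> even_part V"
    and conf_even: "conf V \<in> even_part V"
    and mode_parity: "\<lbrakk>a \<in> parity_part V p; b \<in> parity_part V q\<rbrakk>
          \<Longrightarrow> mode V a n b \<in> parity_part V (p \<noteq> q)"
    and mode_add_left: "\<lbrakk>a \<in> vcarrier V; a' \<in> vcarrier V; b \<in> vcarrier V\<rbrakk>
          \<Longrightarrow> mode V (a + a') n b = mode V a n b + mode V a' n b"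
    and mode_add_right: "\<lbrakk>a \<in> vcarrier V; b \<in> vcarrier V; b' \<in> vcarrier V\<rbrakk>
          \<Longrightarrow> mode V a n (b + b') = mode V a n b + mode V a n b'"
    and mode_scl_left: "\<lbrakk>a \<in> vcarrier V; b \<in> vcarrier V\<rbrakk>
          \<Longrightarrow> mode V (scl V r a) n b = scl V r (mode V a n b)"
    and mode_scl_right: "\<lbrakk>a \<in> vcarrier V; b \<in> vcarrier V\<rbrakk>
          \<Longrightarrow> mode V a n (scl V r b) = scl V r (mode V a n b)"
    and truncation: "\<lbrakk>a \<in> vcarrier V; b \<in> vcarrier V\<rbrakk> \<Longrightarrow> \<exists>N. \<forall>n\<ge>N. mode V a n b = 0"
    and vacuum: "b \<in> vcarrier V \<Longrightarrow> mode V (vac V) n b = (if n = -1 then b else 0)"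
    and creation: "a \<in> vcarrier V \<Longrightarrow> mode V a (-1) (vac V) = a"
    and creation_0: "\<lbrakk>a \<in> vcarrier V; n \<ge> 0\<rbrakk> \<Longrightarrow> mode V a n (vac V) = 0"
    and borcherds: "\<lbrakk>a \<in> parity_part V p; b \<in> parity_part V q; u \<in> vcarrier V\<rbrakk> \<Longrightarrow>
          Sum_any (\<lambda>i::nat. scl V (of_int k gchoose i)
            (mode V (mode V a (m + int i) b) (k + n - int i) u))
          = Sum_any (\<lambda>i::nat. scl V ((-1) ^ i * (of_int m gchoose i))
              (mode V a (k + m - int i) (mode V b (n + int i) u)
               - scl V ((-1) powi m * (if p \<and> q then -1 else 1))
                   (mode V b (n + m - int i) (mode V a (k + int i) u))))"
    and virasoro: "virasoro_relations V (conf V) (charge V)"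
    and translation: "\<lbrakk>a \<in> vcarrier V; b \<in> vcarrier V\<rbrakk>
          \<Longrightarrow> mode V (L V (-1) a) n b = - scl V (of_int n) (mode V a (n - 1) b)"
    and graded: "vcarrier V = vspan V (\<Union>k::int. weight_space V (of_int k / 2))"
    and finite_dim: "\<exists>B. finite B \<and> vspan V B = weight_space V (of_int k / 2)"
    and lower_bounded: "\<exists>N::int. \<forall>k<N. weight_space V (of_int k / 2) = {0}"

definition subalgebra :: "('v::ab_group_add) svoa_data \<Rightarrow> 'v set \<Rightarrow> bool" where
  "subalgebra V U \<longleftrightarrow> vsubspace V U \<and> U \<subseteq> vcarrier V \<and> vac V \<in> U
     \<and> (\<forall>a\<in>U. \<forall>b\<in>U. \<forall>n. mode V a n b \<in> U)"

definition generated_subalgebra :: "('v::ab_group_add) svoa_data \<Rightarrow> 'v set \<Rightarrow> 'v set" where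
  "generated_subalgebra V S = \<Inter>{U. subalgebra V U \<and> S \<subseteq> U}"

definition sub_structure ::
    "('v::ab_group_add) svoa_data \<Rightarrow> 'v set \<Rightarrow> 'v \<Rightarrow> complex \<Rightarrow> 'v svoa_data" where
  "sub_structure V U e c' =
     V\<lparr>even_part := even_part V \<inter> U, odd_part := odd_part V \<inter> U, conf := e, charge := c'\<rparr>"

text \<open>
  Ideals are taken to be submodules of the adjoint module; by skew-symmetry and closure
  under \<open>L(-1)\<close> they are two-sided.
\<close>

definition simple_svoa :: "('v::ab_group_add) svoa_data \<Rightarrow> bool" where
  "simple_svoa V \<longleftrightarrow> svoa V \<and> vcarrier V \<noteq> {0} \<and>
     (\<forall>I. vsubspace V I \<and> I \<subseteq> vcarrier V \<and> (\<forall>a\<in>vcarrier V. \<forall>n. \<forall>u\<in>I. mode V a n u \<in> I)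
        \<longrightarrow> I = {0} \<or> I = vcarrier V)"

section \<open>Highest weight modules of the Virasoro algebra generated by the conformal vector\<close>

definition vir_submodule :: "('v::ab_group_add) svoa_data \<Rightarrow> 'v set \<Rightarrow> bool" where
  "vir_submodule V M \<longleftrightarrow> vsubspace V M \<and> M \<subseteq> vcarrier V \<and> (\<forall>n. \<forall>u\<in>M. L V n u \<in> M)"

definition highest_weight_vector ::
    "('v::ab_group_add) svoa_data \<Rightarrow> complex \<Rightarrow> 'v \<Rightarrow> bool" where
  "highest_weight_vector V h u \<longleftrightarrow> u \<in> weight_space V h \<and> u \<noteq> 0 \<and> (\<forall>n>0. L V n u = 0)"

definition highest_weight_module ::
    "('v::ab_group_add) svoa_data \<Rightarrow> complex \<Rightarrow> 'v set \<Rightarrow> bool" where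
  "highest_weight_module V h M \<longleftrightarrow>
     (\<exists>u. highest_weight_vector V h u \<and> M = \<Inter>{N. vir_submodule V N \<and> u \<in> N})"

text \<open>
  \<open>L(c',h)\<close> is, up to isomorphism, the irreducible highest weight module of central charge
  \<open>c'\<close> and highest weight \<open>h\<close>; the following says that \<open>M\<close> is a copy of it.
\<close>

definition is_irreducible_L ::
    "('v::ab_group_add) svoa_data \<Rightarrow> complex \<Rightarrow> complex \<Rightarrow> 'v set \<Rightarrow> bool" where
  "is_irreducible_L V c' h M \<longleftrightarrow> charge V = c' \<and> highest_weight_module V h M
     \<and> (\<forall>N. vir_submodule V N \<and> N \<subseteq> M \<longrightarrow> N = {0} \<or> N = M)"

definition direct_sum_of_highest_weight_modules :: "('v::ab_group_add) svoa_data \<Rightarrow> bool" where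
  "direct_sum_of_highest_weight_modules V \<longleftrightarrow>
     (\<exists>F. (\<forall>M\<in>F. \<exists>h. highest_weight_module V h M) \<and> vcarrier V = vspan V (\<Union>F)
        \<and> (\<forall>M\<in>F. M \<inter> vspan V (\<Union>(F - {M})) = {0}))"

section \<open>Invariant bilinear forms and self-duality\<close>

text \<open>
  For \<open>a\<close> of weight \<open>w = k/2\<close>, the coefficient of \<open>z^(-n-1)\<close> in
  \<open>Y(e^(z L(1)) z^(-2 L(0)) \<zeta>^(L(0) + 2 L(0)^2) a, z^(-1)) u\<close>.
\<close>

definition adjoint_mode ::
    "('v::ab_group_add) svoa_data \<Rightarrow> int \<Rightarrow> 'v \<Rightarrow> int \<Rightarrow> 'v \<Rightarrow> 'v" where
  "adjoint_mode V k a n u =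
     (let w = of_int k / 2 :: complex; \<zeta> = exp (of_real pi * \<i> * (w + 2 * w\<^sup>2)) in
      Sum_any (\<lambda>i::nat. scl V (\<zeta> / fact i)
        (mode V ((L V 1 ^^ i) a) (k - n - 2 - int i) u)))"

definition bilinear_form ::
    "('v::ab_group_add) svoa_data \<Rightarrow> ('v \<Rightarrow> 'v \<Rightarrow> complex) \<Rightarrow> bool" where
  "bilinear_form V B \<longleftrightarrow>
     (\<forall>u\<in>vcarrier V. \<forall>u'\<in>vcarrier V. \<forall>w\<in>vcarrier V. \<forall>r.
        B (u + u') w = B u w + B u' w \<and> B (scl V r u) w = r * B u w
        \<and> B w (u + u') = B w u + B w u' \<and> B w (scl V r u) = r * B w u)"

definition invariant_form ::
    "('v::ab_group_add) svoa_data \<Rightarrow> ('v \<Rightarrow> 'v \<Rightarrow> complex) \<Rightarrow> bool" where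
  "invariant_form V B \<longleftrightarrow> bilinear_form V B \<and>
     (\<forall>k::int. \<forall>a\<in>weight_space V (of_int k / 2). \<forall>n. \<forall>u\<in>vcarrier V. \<forall>w\<in>vcarrier V.
        B (mode V a n u) w = B u (adjoint_mode V k a n w))"

definition nondegenerate_on :: "('v::zero \<Rightarrow> 'v \<Rightarrow> complex) \<Rightarrow> 'v set \<Rightarrow> bool" where
  "nondegenerate_on B U \<longleftrightarrow>
     (\<forall>u\<in>U. (\<forall>w\<in>U. B u w = 0) \<longrightarrow> u = 0) \<and> (\<forall>w\<in>U. (\<forall>u\<in>U. B u w = 0) \<longrightarrow> w = 0)"

text \<open>
  The restricted dual, the direct sum of the duals of the weight spaces: functionals
  (extended by \<open>0\<close> outside the carrier) that vanish on almost all weight spaces.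
\<close>

definition restricted_dual :: "('v::ab_group_add) svoa_data \<Rightarrow> ('v \<Rightarrow> complex) set" where
  "restricted_dual V = {\<nu>.
     (\<forall>u\<in>vcarrier V. \<forall>w\<in>vcarrier V. \<nu> (u + w) = \<nu> u + \<nu> w)
     \<and> (\<forall>r. \<forall>u\<in>vcarrier V. \<nu> (scl V r u) = r * \<nu> u)
     \<and> (\<forall>u. u \<notin> vcarrier V \<longrightarrow> \<nu> u = 0)
     \<and> finite {k::int. \<exists>u\<in>weight_space V (of_int k / 2). \<nu> u \<noteq> 0}}"

definition dual_mode ::
    "('v::ab_group_add) svoa_data \<Rightarrow> int \<Rightarrow> 'v \<Rightarrow> int \<Rightarrow> ('v \<Rightarrow> complex) \<Rightarrow> 'v \<Rightarrow> complex" where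
  "dual_mode V k a n \<nu> u = (if u \<in> vcarrier V then \<nu> (adjoint_mode V k a n u) else 0)"

definition self_dual :: "('v::ab_group_add) svoa_data \<Rightarrow> bool" where
  "self_dual V \<longleftrightarrow> (\<exists>\<phi>. bij_betw \<phi> (vcarrier V) (restricted_dual V)
     \<and> (\<forall>u\<in>vcarrier V. \<forall>w\<in>vcarrier V. \<phi> (u + w) = (\<lambda>x. \<phi> u x + \<phi> w x))
     \<and> (\<forall>r. \<forall>u\<in>vcarrier V. \<phi> (scl V r u) = (\<lambda>x. r * \<phi> u x))
     \<and> (\<forall>k::int. \<forall>a\<in>weight_space V (of_int k / 2). \<forall>n. \<forall>u\<in>vcarrier V.
          \<phi> (mode V a n u) = dual_mode V k a n (\<phi> u)))"

definition CFT_type :: "('v::ab_group_add) svoa_data \<Rightarrow> bool" where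
  "CFT_type V \<longleftrightarrow> (\<forall>k::int. k < 0 \<longrightarrow> weight_space V (of_int k / 2) = {0})
     \<and> weight_space V 0 = vspan V {vac V}"

section \<open>Conformal designs\<close>

definition isotypic :: "('v::ab_group_add) svoa_data \<Rightarrow> complex \<Rightarrow> 'v set" where
  "isotypic V h = vspan V (\<Union>{M. highest_weight_module V h M})"

definition proj0 :: "('v::ab_group_add) svoa_data \<Rightarrow> 'v \<Rightarrow> 'v" where
  "proj0 V a = (THE b. b \<in> isotypic V 0 \<and>
     a - b \<in> vspan V (\<Union>k\<in>{1::nat..}. isotypic V (of_nat k / 2)))"

definition weight_component :: "('v::ab_group_add) svoa_data \<Rightarrow> 'v \<Rightarrow> int \<Rightarrow> 'v" where
  "weight_component V a = (THE f. (\<forall>k. f k \<in> weight_space V (of_int k / 2))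
     \<and> finite {k. f k \<noteq> 0} \<and> a = Sum_any f)"

text \<open>
  \<open>o(a)\<close>, extended linearly from homogeneous vectors of integral weight
  (\<open>weight_component V a (2 * n)\<close> is the component of weight \<open>n\<close>).
\<close>

definition zero_mode :: "('v::ab_group_add) svoa_data \<Rightarrow> 'v \<Rightarrow> 'v \<Rightarrow> 'v" where
  "zero_mode V a u = Sum_any (\<lambda>n::int. mode V (weight_component V a (2 * n)) (n - 1) u)"

definition trace_on :: "('v::ab_group_add) svoa_data \<Rightarrow> 'v set \<Rightarrow> ('v \<Rightarrow> 'v) \<Rightarrow> complex" where
  "trace_on V X f =
     (let B = (SOME B. \<not> module.dependent (scl V) B \<and> vspan V B = X)
      in \<Sum>b\<in>B. module.representation (scl V) B (f b) b)"

definition conformal_design :: "('v::ab_group_add) svoa_data \<Rightarrow> nat \<Rightarrow> 'v set \<Rightarrow> bool" where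
  "conformal_design V t X \<longleftrightarrow>
     (\<forall>a \<in> vspan V (\<Union>n\<in>{0..t}. even_part V \<inter> weight_space V (of_nat n)).
        trace_on V X (zero_mode V a) = trace_on V X (zero_mode V (proj0 V a)))"

definition D2 :: "complex \<Rightarrow> complex" where "D2 c = c"
definition D4 :: "complex \<Rightarrow> complex" where "D4 c = c * (5 * c + 22)"
definition D6 :: "complex \<Rightarrow> complex" where "D6 c = (2 * c - 1) * (7 * c + 68) * D4 c"
definition D8 :: "complex \<Rightarrow> complex" where "D8 c = (3 * c + 46) * (5 * c + 3) * D6 c"
definition D10 :: "complex \<Rightarrow> complex" where "D10 c = (11 * c + 232) * D8 c"

definition top_level :: "('v::ab_group_add) svoa_data \<Rightarrow> 'v set" where
  "top_level V = odd_part V \<inter> weight_space V (3 / 2)"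

definition graded_with_top_weight_3_2 :: "('v::ab_group_add) svoa_data \<Rightarrow> bool" where
  "graded_with_top_weight_3_2 V \<longleftrightarrow>
     even_part V = vspan V (\<Union>n::nat. even_part V \<inter> weight_space V (of_nat n))
     \<and> even_part V \<inter> weight_space V 1 = {0}
     \<and> odd_part V = vspan V (\<Union>n::nat. weight_space V (3 / 2 + of_nat n))
     \<and> top_level V \<noteq> {0}"

definition design_nondegeneracy :: "('v::ab_group_add) svoa_data \<Rightarrow> bool" where
  "design_nondegeneracy V \<longleftrightarrow>
     (conformal_design V 2 (top_level V) \<longrightarrow> D2 (charge V) \<noteq> 0)
     \<and> (conformal_design V 4 (top_level V) \<longrightarrow> D4 (charge V) \<noteq> 0)
     \<and> (conformal_design V 6 (top_level V) \<longrightarrow> D6 (charge V) \<noteq> 0)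
     \<and> (conformal_design V 8 (top_level V) \<longrightarrow> D8 (charge V) \<noteq> 0)
     \<and> (conformal_design V 10 (top_level V) \<longrightarrow> D10 (charge V) \<noteq> 0)"

section \<open>Extendable simple Virasoro vectors\<close>

definition virasoro_vector :: "('v::ab_group_add) svoa_data \<Rightarrow> complex \<Rightarrow> 'v \<Rightarrow> bool" where
  "virasoro_vector V c' e \<longleftrightarrow>
     e \<in> even_part V \<inter> weight_space V 2 \<and> virasoro_relations V e c'"

text \<open>
  A vertex operator (super)algebra isomorphic to \<open>L(c',0)\<close>, respectively to the simple SVOA
  \<open>L(7/10,0) \<oplus> L(7/10,3/2)\<close>. Simplicity is needed in the second case: it excludes the
  structure in which the odd part multiplies to zero.
\<close>

definition is_L_VOA :: "('v::ab_group_add) svoa_data \<Rightarrow> complex \<Rightarrow> bool" where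
  "is_L_VOA V c' \<longleftrightarrow> svoa V \<and> is_irreducible_L V c' 0 (even_part V) \<and> odd_part V = {0}"

definition is_N1_SVOA_7_10 :: "('v::ab_group_add) svoa_data \<Rightarrow> bool" where
  "is_N1_SVOA_7_10 V \<longleftrightarrow> simple_svoa V
     \<and> is_irreducible_L V (7 / 10) 0 (even_part V)
     \<and> is_irreducible_L V (7 / 10) (3 / 2) (odd_part V)"

definition simple_virasoro_vector ::
    "('v::ab_group_add) svoa_data \<Rightarrow> complex \<Rightarrow> 'v \<Rightarrow> bool" where
  "simple_virasoro_vector V c' e \<longleftrightarrow> virasoro_vector V c' e
     \<and> is_L_VOA (sub_structure V (generated_subalgebra V {e}) e c') c'"

text \<open>
  \<open>v\<close> is a square root of \<open>e\<close> witnessing that \<open>e\<close> is extendable; as \<open>e = v\<^sub>(\<^sub>0\<^sub>) v\<close>, the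
  subalgebra generated by \<open>v\<close> contains \<open>e\<close>, which is its conformal vector.
\<close>

definition extending_square_root :: "('v::ab_group_add) svoa_data \<Rightarrow> 'v \<Rightarrow> 'v \<Rightarrow> bool" where
  "extending_square_root V e v \<longleftrightarrow> v \<in> top_level V \<and> mode V v 0 v = e
     \<and> is_N1_SVOA_7_10 (sub_structure V (generated_subalgebra V {v}) e (7 / 10))"

end

theory Submission
  imports Defs
begin

text \<open>Let \<open>T = e\<^sub>(\<^sub>1\<^sub>)\<close> on the top level \<open>X\<close> and \<open>v\<close> the square root of \<open>e\<close>. No representation theory of
  the \<open>c = 7/10\<close> algebra is needed beyond one relation: \<open>v\<^sub>(\<^sub>-\<^sub>2\<^sub>)v - e\<^sub>(\<^sub>-\<^sub>1\<^sub>)e/3 - e\<^sub>(\<^sub>-\<^sub>3\<^sub>)\<one>/10\<close> is a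
  singular vector of weight 4 in the irreducible even part of \<open>\<langle>v\<rangle>\<close>, hence zero. Since \<open>V\<close> has nothing
  in weights \<open>1/2\<close> and 1, its zero mode on \<open>X\<close> reads \<open>T\<^sup>2 x = T x/10 + 9 \<kappa>(x) v\<close>, where
  \<open>v\<^sub>(\<^sub>2\<^sub>)x = \<kappa>(x)\<one>\<close>. Thus \<open>tr T\<^sup>2\<close> and \<open>tr T\<^sup>3\<close> are affine functions of \<open>tr T\<close>. The design property
  expresses \<open>tr T\<close>, \<open>tr T\<^sup>2\<close>, \<open>tr T\<^sup>3\<close> through \<open>c\<close> and \<open>d\<close>, by projecting \<open>e\<close>, \<open>e\<^sub>(\<^sub>-\<^sub>1\<^sub>)e\<close>, \<open>e\<^sub>(\<^sub>-\<^sub>1\<^sub>)e\<^sub>(\<^sub>-\<^sub>1\<^sub>)e\<close> to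
  the vacuum module of \<open>\<omega>\<close>. Eliminating \<open>d\<close> leaves \<open>c \<in> {7/10, 47/2, 37/82}\<close>, and \<open>37/82\<close> would make \<open>d\<close>
  fractional. If \<open>(c,d) = (7/10,1)\<close>, the 2-design property shows that \<open>\<omega> - e\<close> is orthogonal to everything, so
  \<open>\<omega> = e\<close>, and the same relation, read modulo \<open>W\<close> on a vector of minimal weight \<open>h\<close>, gives
  \<open>h (h - 1/10) = 0\<close>; hence \<open>V = W\<close>.\<close>

text \<open>The map \<open>T\<close> is never diagonalised. Its only possible eigenvalues are 3/2,
  attained at \<open>v\<close>, and 0 and 1/10, the Neveu-Schwarz highest weights of charge 7/10;
  but the quadratic relation with its rank one correction gives the traces whatever the
  multiplicities are. So no decomposition of V under the subalgebra generated by \<open>v\<close>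
  has to be established. The projection to the vacuum component is computed by duality. A vector of
  weight n of that component is determined by the scalars that words in L(2), L(3), ... of total
  degree n produce from it, and such words annihilate every other isotypic component, since these
  contain nothing of weight 0. Matching scalars is a Gram system, solvable because its determinant
  is, up to harmless factors, D4 or D6 at c. Non-degeneracy of the form on the vacuum component
  makes the projection well defined. What keeps all computations short is the absence of weights 1/2
  and 1: even vectors of weight 2 are quasi-primary, words in L(1) reduce to shorter ones, and most
  products vanish for weight reasons.\<close>

lemma Sum_any_lessThan:
  fixes f :: "nat \<Rightarrow> 'a::comm_monoid_add"
  assumes "\<And>i. i \<ge> N \<Longrightarrow> f i = 0"
  shows "Sum_any f = (\<Sum>i<N. f i)"
proof (rule Sum_any.expand_superset)
  show "{i. f i \<noteq> 0} \<subseteq> {..<N}"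
    using assms by (auto simp: not_less[symmetric])
qed simp

section \<open>Binomial coefficients and short sums for evaluating mode identities\<close>

lemma gbinomial_2: "(a :: complex) gchoose 2 = a * (a - 1) / 2"
  by (simp add: numeral_2_eq_2 gbinomial_prod_rev atLeast0_lessThan_Suc algebra_simps)

lemma gbinomial_3: "(a :: complex) gchoose 3 = a * (a - 1) * (a - 2) / 6"
  by (simp add: numeral_3_eq_3 gbinomial_prod_rev atLeast0_lessThan_Suc fact_numeral algebra_simps)

lemma gbinomial_minus_1: "(- 1 :: complex) gchoose i = (- 1) ^ i"
  by (simp add: gbinomial_minus binomial_gbinomial[symmetric])

lemma gbinomial_minus_2: "(- 2 :: complex) gchoose i = (- 1) ^ i * of_nat (Suc i)"
  by (simp add: gbinomial_minus binomial_gbinomial[symmetric, of "Suc i", simplified])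

lemma gbinomial_minus_3: "(- 3 :: complex) gchoose i = (- 1) ^ i * (of_nat ((i + 1) * (i + 2)) / 2)"
proof -
  have "(- 3 :: complex) gchoose i = (- 1) ^ i * of_nat ((i + 2) choose i)"
    using gbinomial_minus[of "3::complex" i] by (simp add: binomial_gbinomial add_ac)
  also have "2 * ((i + 2) choose i) = (i + 1) * (i + 2)"
    using binomial_symmetric[of i "i + 2"] by (simp add: choose_two)
  then have "(of_nat ((i + 2) choose i) :: complex) = of_nat ((i + 1) * (i + 2)) / 2"
    by (metis nonzero_mult_div_cancel_left of_nat_mult of_nat_numeral zero_neq_numeral)
  finally show ?thesis .
qed

lemma minus_1_power_twice: "(- 1) ^ i * (- 1) ^ i = (1 :: complex)" "(- 1) ^ i * ((- 1) ^ i * c) = (c :: complex)"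
  by (simp_all flip: power_add mult.assoc)

lemma sum_lessThan_numeral:
  fixes f :: "nat \<Rightarrow> 'a::comm_monoid_add"
  shows "(\<Sum>i<2. f i) = f 0 + f 1" "(\<Sum>i<3. f i) = f 0 + f 1 + f 2" "(\<Sum>i<4. f i) = f 0 + f 1 + f 2 + f 3"
    "(\<Sum>i<5. f i) = f 0 + f 1 + f 2 + f 3 + f 4" "(\<Sum>i<6. f i) = f 0 + f 1 + f 2 + f 3 + f 4 + f 5"
  by (simp_all add: eval_nat_numeral)

section \<open>Commutator, associativity and skew-symmetry from the Borcherds identity\<close>

context svoa
begin

lemma subspace_carrier: "vsubspace V (vcarrier V)"
  unfolding vcarrier_def by (rule subspace_sums[OF subspace_even subspace_odd])

lemma even_carrier: "a \<in> even_part V \<Longrightarrow> a \<in> vcarrier V"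
  unfolding vcarrier_def using subspace_0[OF subspace_odd] by force

lemma odd_carrier: "a \<in> odd_part V \<Longrightarrow> a \<in> vcarrier V"
  unfolding vcarrier_def using subspace_0[OF subspace_even] by force

lemma parity_carrier: "a \<in> parity_part V p \<Longrightarrow> a \<in> vcarrier V"
  by (auto simp: parity_part_def even_carrier odd_carrier split: if_splits)

lemma conf_carrier [simp]: "conf V \<in> vcarrier V" and vac_carrier [simp]: "vac V \<in> vcarrier V"
  by (simp_all add: even_carrier conf_even vac_even)

lemma zero_carrier [simp]: "0 \<in> vcarrier V"
  by (rule subspace_0[OF subspace_carrier])

lemma add_carrier [simp]: "a \<in> vcarrier V \<Longrightarrow> b \<in> vcarrier V \<Longrightarrow> a + b \<in> vcarrier V"
  by (rule subspace_add[OF subspace_carrier])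

lemma diff_carrier [simp]: "a \<in> vcarrier V \<Longrightarrow> b \<in> vcarrier V \<Longrightarrow> a - b \<in> vcarrier V"
  by (rule subspace_diff[OF subspace_carrier])

lemma neg_carrier [simp]: "a \<in> vcarrier V \<Longrightarrow> - a \<in> vcarrier V"
  by (rule subspace_neg[OF subspace_carrier])

lemma scl_carrier [simp]: "a \<in> vcarrier V \<Longrightarrow> scl V r a \<in> vcarrier V"
  by (rule subspace_scale[OF subspace_carrier])

lemma mode_carrier [simp]:
  assumes "a \<in> vcarrier V" "b \<in> vcarrier V" shows "mode V a n b \<in> vcarrier V"
proof -
  obtain a0 a1 b0 b1 where ab: "a = a0 + a1" "b = b0 + b1"
    and mem: "a0 \<in> parity_part V False" "a1 \<in> parity_part V True"
      "b0 \<in> parity_part V False" "b1 \<in> parity_part V True"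
    using assms unfolding vcarrier_def parity_part_def by auto
  have "a0 \<in> vcarrier V" "a1 \<in> vcarrier V" "b0 \<in> vcarrier V" "b1 \<in> vcarrier V"
    using mem parity_carrier by blast+
  moreover have "mode V a0 n b0 \<in> vcarrier V" "mode V a0 n b1 \<in> vcarrier V"
    "mode V a1 n b0 \<in> vcarrier V" "mode V a1 n b1 \<in> vcarrier V"
    using mem mode_parity parity_carrier by blast+
  ultimately show ?thesis
    unfolding ab by (simp add: mode_add_left mode_add_right)
qed

lemma mode_zero_left [simp]: "b \<in> vcarrier V \<Longrightarrow> mode V 0 n b = 0"
  using mode_scl_left[of 0 b 0 n] by simp

lemma mode_zero_right [simp]: "a \<in> vcarrier V \<Longrightarrow> mode V a n 0 = 0"
  using mode_scl_right[of a 0 n 0] by simp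

lemma mode_diff_left:
  assumes "a \<in> vcarrier V" "a' \<in> vcarrier V" "b \<in> vcarrier V"
  shows "mode V (a - a') n b = mode V a n b - mode V a' n b"
  using mode_add_left[of a "scl V (-1) a'" b n] mode_scl_left[of a' b "-1" n] assms by simp

lemma mode_diff_right:
  assumes "a \<in> vcarrier V" "b \<in> vcarrier V" "b' \<in> vcarrier V"
  shows "mode V a n (b - b') = mode V a n b - mode V a n b'"
  using mode_add_right[of a b "scl V (-1) b'" n] mode_scl_right[of a b' n "-1"] assms by simp

text \<open>The case \<open>m = 0\<close> of the Borcherds identity: \<open>0 gchoose i\<close>
  leaves only \<open>i = 0\<close> on the right. The explicit bound \<open>N\<close> lets each use
  unfold the sum into the few products that survive for weight reasons.\<close>

lemma commutator:
  assumes a: "a \<in> parity_part V p" and b: "b \<in> parity_part V q" and u: "u \<in> vcarrier V"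
    and N: "\<And>i. i \<ge> N \<Longrightarrow> mode V a (int i) b = 0"
  shows "mode V a k (mode V b n u)
    = scl V (if p \<and> q then - 1 else 1) (mode V b n (mode V a k u))
      + (\<Sum>i<N. scl V (of_int k gchoose i) (mode V (mode V a (int i) b) (k + n - int i) u))"
proof -
  have "Sum_any (\<lambda>i::nat. scl V (of_int k gchoose i)
            (mode V (mode V a (0 + int i) b) (k + n - int i) u))
      = (\<Sum>i<N. scl V (of_int k gchoose i) (mode V (mode V a (int i) b) (k + n - int i) u))"
    by (subst Sum_any_lessThan[of N]) (auto simp: N u)
  moreover have "Sum_any (\<lambda>i::nat. scl V ((-1) ^ i * (of_int 0 gchoose i))
              (mode V a (k + 0 - int i) (mode V b (n + int i) u)
               - scl V ((-1) powi 0 * (if p \<and> q then -1 else 1))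
                   (mode V b (n + 0 - int i) (mode V a (k + int i) u))))
     = mode V a k (mode V b n u) - scl V (if p \<and> q then - 1 else 1) (mode V b n (mode V a k u))"
    by (subst Sum_any_lessThan[of 1]) (auto simp: gbinomial_0_left)
  ultimately show ?thesis
    using borcherds[OF a b u, of k 0 n] by (simp add: algebra_simps)
qed

text \<open>The case \<open>k = 0\<close>, in which only \<open>i = 0\<close> survives on the left.
  It expresses modes of a composite vector through modes of its factors, and so gives zero modes of
  monomials.\<close>

lemma associativity:
  assumes a: "a \<in> parity_part V p" and b: "b \<in> parity_part V q" and u: "u \<in> vcarrier V"
    and N: "\<And>i. i \<ge> N \<Longrightarrow> mode V b (n + int i) u = 0" "\<And>i. i \<ge> N \<Longrightarrow> mode V a (int i) u = 0"
  shows "mode V (mode V a m b) n u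
    = (\<Sum>i<N. scl V ((-1) ^ i * (of_int m gchoose i))
              (mode V a (m - int i) (mode V b (n + int i) u)
               - scl V ((-1) powi m * (if p \<and> q then -1 else 1))
                   (mode V b (n + m - int i) (mode V a (int i) u))))"
proof -
  have "Sum_any (\<lambda>i::nat. scl V (of_int 0 gchoose i)
            (mode V (mode V a (m + int i) b) (0 + n - int i) u)) = mode V (mode V a m b) n u"
    by (subst Sum_any_lessThan[of 1]) (auto simp: gbinomial_0_left)
  then show ?thesis
    unfolding borcherds[OF a b u, of 0 m n]
    by (subst (asm) Sum_any_lessThan[of N])
       (auto simp: N parity_carrier[OF a] parity_carrier[OF b])
qed

text \<open>In full skew-symmetry the corrections are L(-1)-descendants of higher products, absent
  for the top product. Here it comes from the commutator of \<open>a_(-1)\<close> and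
  \<open>b_(n)\<close> on the vacuum: of the products \<open>a_(i) b\<close> only
  \<open>i = n\<close> meets the vacuum in a negative mode.\<close>

lemma skew_symmetry_top:
  assumes a: "a \<in> parity_part V p" and b: "b \<in> parity_part V q"
    and top: "\<And>i. i > n \<Longrightarrow> mode V a (int i) b = 0"
  shows "mode V b (int n) a = scl V ((- 1) ^ Suc n * (if p \<and> q then - 1 else 1)) (mode V a (int n) b)"
proof -
  note ac = parity_carrier[OF a] and bc = parity_carrier[OF b]
  have "mode V a (- 1) (mode V b (int n) (vac V))
    = scl V (if p \<and> q then - 1 else 1) (mode V b (int n) (mode V a (-1) (vac V)))
      + (\<Sum>i<Suc n. scl V (of_int (-1) gchoose i) (mode V (mode V a (int i) b) (-1 + int n - int i) (vac V)))"
    by (rule commutator[OF a b]) (auto simp: top)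
  also have "(\<Sum>i<Suc n. scl V (of_int (-1) gchoose i) (mode V (mode V a (int i) b) (-1 + int n - int i) (vac V)))
     = scl V ((-1) ^ n) (mode V a (int n) b)"
    by (simp add: creation creation_0 gbinomial_minus_1 ac bc)
  finally show ?thesis
    using ac bc by (auto simp: creation creation_0 add_eq_0_iff eq_commute[of "- _"])
qed

section \<open>Virasoro operators and weights\<close>

lemma L_carrier [simp]: "u \<in> vcarrier V \<Longrightarrow> L V n u \<in> vcarrier V"
  by (simp add: L_def)

lemma L_parity: "u \<in> parity_part V p \<Longrightarrow> L V n u \<in> parity_part V p"
  using mode_parity[of "conf V" False u p "n + 1"] conf_even by (simp add: L_def parity_part_def)

lemma L_zero [simp]: "L V n 0 = 0"
  by (simp add: L_def)

lemma L_add: "u \<in> vcarrier V \<Longrightarrow> w \<in> vcarrier V \<Longrightarrow> L V n (u + w) = L V n u + L V n w"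
  by (simp add: L_def mode_add_right)

lemma L_diff: "u \<in> vcarrier V \<Longrightarrow> w \<in> vcarrier V \<Longrightarrow> L V n (u - w) = L V n u - L V n w"
  by (simp add: L_def mode_diff_right)

lemma L_scl: "u \<in> vcarrier V \<Longrightarrow> L V n (scl V r u) = scl V r (L V n u)"
  by (simp add: L_def mode_scl_right)

lemma L_vac: "n \<ge> -1 \<Longrightarrow> L V n (vac V) = 0"
  by (simp add: L_def creation_0)

lemma L_commute:
  "u \<in> vcarrier V \<Longrightarrow> L V m (L V n u) = L V n (L V m u) + scl V (of_int (m - n)) (L V (m + n) u)
    + (if m + n = 0 then scl V (of_int (m ^ 3 - m) / 12 * charge V) u else 0)"
proof -
  assume "u \<in> vcarrier V"
  then have "L V m (L V n u) - L V n (L V m u) = scl V (of_int (m - n)) (L V (m + n) u)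
    + (if m + n = 0 then scl V (of_int (m ^ 3 - m) / 12 * charge V) u else 0)"
    using virasoro unfolding virasoro_relations_def L_def by blast
  then show ?thesis unfolding diff_eq_eq by (simp only: ac_simps)
qed

lemma weight_carrier: "u \<in> weight_space V h \<Longrightarrow> u \<in> vcarrier V"
  by (simp add: weight_space_def)

lemma subspace_weight: "vsubspace V (weight_space V h)"
  by (rule subspaceI) (auto simp: weight_space_def L_add L_scl scale_right_distrib mult.commute)

lemma weight_L: "u \<in> weight_space V h \<Longrightarrow> L V n u \<in> weight_space V (h - of_int n)"
  using L_commute[of u 0 n] by (auto simp: weight_space_def L_scl scale_left_diff_distrib)

text \<open>The right side does not mention the conformal vector. Read in a subalgebra with another
  conformal vector, the same formula therefore identifies the two translation operators.\<close>

lemma L_minus_1: "u \<in> vcarrier V \<Longrightarrow> L V (-1) u = mode V u (-2) (vac V)"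
  using translation[of u "vac V" "-1"] by (simp add: creation)

text \<open>The commutator with L(0) involves only \<open>i = 0\<close> and \<open>i = 1\<close>,
  because \<open>1 gchoose i\<close> vanishes beyond; the translation axiom turns the term
  \<open>i = 0\<close> into a multiple of \<open>mode V a n u\<close>. No homogeneity of
  \<open>a\<close> is required.\<close>

lemma L0_mode:
  assumes a: "a \<in> parity_part V p" and u: "u \<in> vcarrier V"
  shows "L V 0 (mode V a n u) = mode V a n (L V 0 u) + mode V (L V 0 a) n u - scl V (of_int n + 1) (mode V a n u)"
proof -
  have c: "conf V \<in> parity_part V False" by (simp add: parity_part_def conf_even)
  note ac = parity_carrier[OF a]
  obtain N0 where "\<forall>i\<ge>N0. mode V (conf V) i a = 0" using truncation[OF conf_carrier ac] by blast
  then have "\<forall>i\<ge>max 2 (nat N0). mode V (conf V) (int i) a = 0" by (auto simp: nat_le_iff)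
  then obtain N :: nat where N2: "N \<ge> 2" and N: "\<And>i. i \<ge> N \<Longrightarrow> mode V (conf V) (int i) a = 0"
    by (metis max.cobounded1)
  have "mode V (conf V) 1 (mode V a n u)
    = mode V a n (mode V (conf V) 1 u)
      + (\<Sum>i<N. scl V (1 gchoose i) (mode V (mode V (conf V) (int i) a) (1 + n - int i) u))"
    using commutator[OF c a u N, of N 1 n] by simp
  also have "(\<Sum>i<N. scl V (1 gchoose i) (mode V (mode V (conf V) (int i) a) (1 + n - int i) u))
     = (\<Sum>i<2. scl V (1 gchoose i) (mode V (mode V (conf V) (int i) a) (1 + n - int i) u))"
  proof (rule sum.mono_neutral_right)
    have "(1::complex) gchoose i = 0" if "i \<ge> 2" for i
      using that by (metis One_nat_def Suc_1 Suc_le_lessD binomial_eq_0 binomial_gbinomial of_nat_0 of_nat_1)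
    then show "\<forall>i\<in>{..<N} - {..<2}. scl V (1 gchoose i) (mode V (mode V (conf V) (int i) a) (1 + n - int i) u) = 0"
      by auto
  qed (use N2 in auto)
  also have "\<dots> = mode V (L V (-1) a) (n+1) u + mode V (L V 0 a) n u"
    by (simp add: numeral_2_eq_2 L_def algebra_simps)
  finally show ?thesis
    using translation[OF ac u, of "n+1"] by (simp add: L_def algebra_simps scale_left_distrib)
qed

lemma weight_mode:
  assumes a: "a \<in> parity_part V p" "a \<in> weight_space V h" and b: "b \<in> weight_space V h'"
    and h'': "h'' = h + h' - of_int n - 1"
  shows "mode V a n b \<in> weight_space V h''"
  using L0_mode[OF a(1) weight_carrier[OF b], of n] a b unfolding weight_space_def h''
  by (simp add: mode_scl_left mode_scl_right algebra_simps)

lemma vac_weight: "vac V \<in> weight_space V 0"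
  by (simp add: weight_space_def L_vac)

lemma conf_weight: "conf V \<in> weight_space V 2"
  and L_conf: "L V (- 2) (vac V) = conf V" "L V 1 (conf V) = 0"
    "L V 2 (conf V) = scl V (charge V / 2) (vac V)"
proof -
  show *: "L V (- 2) (vac V) = conf V" by (simp add: L_def creation)
  show "conf V \<in> weight_space V 2" using weight_L[OF vac_weight, of "-2"] * by simp
  show "L V 1 (conf V) = 0"
    unfolding *[symmetric] by (subst L_commute) (simp_all add: L_vac)
  show "L V 2 (conf V) = scl V (charge V / 2) (vac V)"
    unfolding *[symmetric] by (subst L_commute) (simp_all add: L_vac)
qed

text \<open>Induction on the number of weights: applying L(0) - \<nu> removes the component of
  weight \<nu> and rescales the others by nonzero factors.\<close>

lemma weight_independent:
  assumes "finite S" "\<And>\<mu>. \<mu> \<in> S \<Longrightarrow> f \<mu> \<in> weight_space V \<mu>" "sum f S = 0"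
  shows "\<forall>\<mu>\<in>S. f \<mu> = 0"
  using assms
proof (induction S arbitrary: f rule: finite_induct)
  case (insert \<nu> S)
  have L0: "L V 0 (sum g T) = (\<Sum>\<mu>\<in>T. scl V \<mu> (g \<mu>))"
    if "finite T" "\<And>\<mu>. \<mu> \<in> T \<Longrightarrow> g \<mu> \<in> weight_space V \<mu>" for g T
    using that
  proof (induction T rule: finite_induct)
    case (insert \<mu> T)
    then have "sum g T \<in> vcarrier V"
      by (intro subspace_sum[OF subspace_carrier]) (auto dest: weight_carrier)
    with insert show ?case
      using insert.prems[of \<mu>] by (simp add: L_add weight_space_def)
  qed simp
  have "(\<Sum>\<mu>\<in>insert \<nu> S. scl V \<mu> (f \<mu>)) - scl V \<nu> (sum f (insert \<nu> S)) = 0"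
    using L0[of "insert \<nu> S" f] insert.hyps insert.prems by simp
  then have "(\<Sum>\<mu>\<in>S. scl V (\<mu> - \<nu>) (f \<mu>)) = 0"
    using insert.hyps
    by (simp add: scale_left_diff_distrib sum_subtractf scale_right_distrib scale_sum_right)
  moreover have "scl V (\<mu> - \<nu>) (f \<mu>) \<in> weight_space V \<mu>" if "\<mu> \<in> S" for \<mu>
    using that insert.prems(1) subspace_scale[OF subspace_weight] by blast
  ultimately have "\<forall>\<mu>\<in>S. scl V (\<mu> - \<nu>) (f \<mu>) = 0"
    using insert.IH[of "\<lambda>\<mu>. scl V (\<mu> - \<nu>) (f \<mu>)"] by blast
  then have "\<forall>\<mu>\<in>S. f \<mu> = 0" using insert.hyps by auto
  then show ?case using insert by auto
qed simp

lemma span_weights: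
  assumes "u \<in> vspan V (\<Union>\<mu>\<in>S. weight_space V \<mu>)"
  obtains F f where "finite F" "F \<subseteq> S" "\<And>\<mu>. f \<mu> \<in> weight_space V \<mu>" "u = sum f F"
proof -
  have "\<exists>F f. finite F \<and> F \<subseteq> S \<and> (\<forall>\<mu>. f \<mu> \<in> weight_space V \<mu>) \<and> u = sum f F"
    using assms
  proof (induction rule: span_induct_alt)
    case base
    show ?case by (rule exI[of _ "{}"], rule exI[of _ "\<lambda>_. 0"]) (simp add: subspace_0[OF subspace_weight])
  next
    case (step r x y)
    then obtain \<mu> F f where mu: "\<mu> \<in> S" "x \<in> weight_space V \<mu>"
      and F: "finite F" "F \<subseteq> S" "\<forall>\<mu>. f \<mu> \<in> weight_space V \<mu>" "y = sum f F" by auto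
    define g where "g \<nu> = (if \<nu> \<in> F then f \<nu> else 0) + (if \<nu> = \<mu> then scl V r x else 0)" for \<nu>
    have "sum g (insert \<mu> F) = scl V r x + y"
      unfolding g_def using F
      by (simp add: sum.distrib sum.If_cases Int_insert_left insert_absorb add.commute)
    moreover have "g \<nu> \<in> weight_space V \<nu>" for \<nu>
      unfolding g_def using F mu
      by (auto intro!: subspace_add[OF subspace_weight] subspace_scale[OF subspace_weight] subspace_0[OF subspace_weight])
    ultimately show ?case using F mu by (intro exI[of _ "insert \<mu> F"] exI[of _ g]) auto
  qed
  then show thesis using that by blast
qed

lemma weight_in_span:
  assumes "u \<in> weight_space V h" "u \<in> vspan V (\<Union>\<mu>\<in>S. weight_space V \<mu>)" "h \<notin> S"
  shows "u = 0"
proof -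
  obtain F f where F: "finite F" "F \<subseteq> S" "\<And>\<mu>. f \<mu> \<in> weight_space V \<mu>" "u = sum f F"
    using span_weights[OF assms(2)] by blast
  define g where "g = f(h := - u)"
  have "h \<notin> F" using F assms by blast
  then have "sum g F = sum f F" unfolding g_def by (intro sum.cong) auto
  then have "sum g (insert h F) = 0"
    using F \<open>h \<notin> F\<close> by (simp add: g_def)
  moreover have "g \<mu> \<in> weight_space V \<mu>" for \<mu>
    using F assms subspace_neg[OF subspace_weight] by (simp add: g_def)
  ultimately have "\<forall>\<mu>\<in>insert h F. g \<mu> = 0"
    using weight_independent[of "insert h F" g] F by blast
  then show ?thesis by (simp add: g_def)
qed

end

context svoa
begin

section \<open>Highest weight modules\<close>

lemma image_span_subset:
  assumes S: "S \<subseteq> vcarrier V" and R: "vsubspace V R"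
    and add: "\<And>x y. x \<in> vcarrier V \<Longrightarrow> y \<in> vcarrier V \<Longrightarrow> f (x + y) = f x + f y"
    and scl: "\<And>r x. x \<in> vcarrier V \<Longrightarrow> f (scl V r x) = scl V r (f x)"
    and gen: "\<And>w. w \<in> S \<Longrightarrow> f w \<in> R"
    and w: "w \<in> vspan V S"
  shows "f w \<in> R"
proof -
  have "w \<in> vcarrier V \<and> f w \<in> R"
    using w
  proof (induction rule: span_induct_alt)
    case base
    show ?case using scl[of 0 0] subspace_0[OF R] by simp
  next
    case (step r x y)
    then have "x \<in> vcarrier V" "f x \<in> R" using S gen by auto
    with step show ?case
      by (simp add: add scl subspace_add[OF R] subspace_scale[OF R])
  qed
  then show ?thesis ..
qed

lemma L_span_subset:
  assumes "S \<subseteq> vcarrier V" "vsubspace V R" "\<And>w. w \<in> S \<Longrightarrow> L V n w \<in> R" "w \<in> vspan V S"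
  shows "L V n w \<in> R"
  by (rule image_span_subset[OF assms(1,2) _ _ assms(3,4)]) (simp_all add: L_add L_scl)

lemma vir_submodule_span_Union:
  assumes "\<And>M. M \<in> F \<Longrightarrow> vir_submodule V M"
  shows "vir_submodule V (vspan V (\<Union>F))"
  unfolding vir_submodule_def
proof (intro conjI allI ballI)
  have car: "\<Union>F \<subseteq> vcarrier V" using assms by (auto simp: vir_submodule_def)
  then show "vspan V (\<Union>F) \<subseteq> vcarrier V" by (rule span_minimal[OF _ subspace_carrier])
  fix n u assume u: "u \<in> vspan V (\<Union>F)"
  show "L V n u \<in> vspan V (\<Union>F)"
  proof (rule L_span_subset[OF car _ _ u])
    fix w assume "w \<in> \<Union>F"
    then obtain M where M: "M \<in> F" "w \<in> M" by blast
    then have "L V n w \<in> M" using assms[OF M(1)] by (simp add: vir_submodule_def)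
    then show "L V n w \<in> vspan V (\<Union>F)" using M by (intro span_base) blast
  qed simp
qed simp

lemma vir_submodule_Inter:
  assumes "F \<noteq> {}" "\<And>N. N \<in> F \<Longrightarrow> vir_submodule V N" shows "vir_submodule V (\<Inter>F)"
  using assms unfolding vir_submodule_def by (intro conjI subspace_Inter) blast+

lemma vir_submodule_carrier: "vir_submodule V (vcarrier V)"
  by (simp add: vir_submodule_def subspace_carrier)

lemma highest_weight_module_submodule:
  assumes "highest_weight_module V h M" shows "vir_submodule V M"
proof -
  obtain u where u: "highest_weight_vector V h u" "M = \<Inter>{N. vir_submodule V N \<and> u \<in> N}"
    using assms by (auto simp: highest_weight_module_def)
  then show ?thesis
    using vir_submodule_carrier by (auto simp: highest_weight_vector_def weight_carrier intro!: vir_submodule_Inter)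
qed

inductive_set lowering_closure :: "'v set \<Rightarrow> 'v set" for S where
  base: "s \<in> S \<Longrightarrow> s \<in> lowering_closure S"
| step: "w \<in> lowering_closure S \<Longrightarrow> n < 0 \<Longrightarrow> L V n w \<in> lowering_closure S"

text \<open>This replaces the Poincare-Birkhoff-Witt theorem: lowering operators already generate a
  submodule from a set that is stable under the other operators.\<close>

lemma vir_submodule_lowering_closure:
  assumes S: "S \<subseteq> vcarrier V" and pos: "\<And>m s. m \<ge> 0 \<Longrightarrow> s \<in> S \<Longrightarrow> L V m s \<in> S"
  shows "vir_submodule V (vspan V (lowering_closure S))"
proof -
  let ?W = "lowering_closure S"
  have W: "w \<in> vcarrier V" if "w \<in> ?W" for w
    using that by induction (use S in auto)
  then have car: "vspan V ?W \<subseteq> vcarrier V"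
    by (intro span_minimal[OF _ subspace_carrier]) auto
  have Wc: "?W \<subseteq> vcarrier V" using W by blast
  have lift: "L V n w \<in> vspan V ?W"
    if "\<And>w. w \<in> ?W \<Longrightarrow> L V n w \<in> vspan V ?W" "w \<in> vspan V ?W" for n w
    by (rule L_span_subset[OF Wc subspace_span that])
  have neg: "L V n w \<in> vspan V ?W" if "n < 0" "w \<in> vspan V ?W" for n w
    by (rule lift[OF _ that(2)]) (intro span_base lowering_closure.step that(1))
  \<comment> \<open>Induction on the word of lowering operators. In the commutator the operator of
    index \<open>m + n\<close> is covered by the induction hypothesis if \<open>m + n\<close> is
    nonnegative and is one more lowering step otherwise.\<close>
  have "\<forall>m\<ge>0. L V m w \<in> vspan V ?W" if "w \<in> ?W" for w
    using that
  proof induction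
    case (base s)
    show ?case using pos[OF _ base] by (auto intro!: span_base lowering_closure.base)
  next
    case (step w n)
    have "L V m (L V n w) \<in> vspan V ?W" if "m \<ge> 0" for m
    proof -
      have "L V (m + n) w \<in> vspan V ?W"
        using step.IH span_base[OF lowering_closure.step[OF step.hyps(1)]] by (cases "m + n \<ge> 0") auto
      moreover have "L V n (L V m w) \<in> vspan V ?W"
        using neg[OF step.hyps(2)] step.IH that by blast
      moreover have "w \<in> vspan V ?W" using step.hyps(1) by (rule span_base)
      ultimately show ?thesis
        unfolding L_commute[OF W[OF step.hyps(1)], of m n]
        by (intro span_add span_scale) (simp_all add: span_zero span_scale)
    qed
    then show ?case by blast
  qed
  then have "L V m w \<in> vspan V ?W" if "m \<ge> 0" "w \<in> vspan V ?W" for m w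
    using lift that by blast
  then have "L V m w \<in> vspan V ?W" if "w \<in> vspan V ?W" for m w
    using neg that by (cases "m \<ge> 0") auto
  then show ?thesis using car by (simp add: vir_submodule_def)
qed

text \<open>In the uses \<open>R\<close> is cut out by weight conditions: it is visibly stable under
  lowering but is no submodule. Stability of \<open>S\<close> under the remaining operators suffices
  to trap a submodule in \<open>R\<close>.\<close>

lemma vir_submodule_between:
  assumes S: "S \<subseteq> R" "\<And>m s. m \<ge> 0 \<Longrightarrow> s \<in> S \<Longrightarrow> L V m s \<in> S"
    and R: "vsubspace V R" "R \<subseteq> vcarrier V" "\<And>n w. n < 0 \<Longrightarrow> w \<in> R \<Longrightarrow> L V n w \<in> R"
  obtains N where "vir_submodule V N" "S \<subseteq> N" "N \<subseteq> R"
proof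
  show "vir_submodule V (vspan V (lowering_closure S))"
    using S R(2) by (intro vir_submodule_lowering_closure) auto
  show "S \<subseteq> vspan V (lowering_closure S)"
    using lowering_closure.base span_base by blast
  have "w \<in> R" if "w \<in> lowering_closure S" for w
    using that by induction (use S R in auto)
  then show "vspan V (lowering_closure S) \<subseteq> R"
    by (intro span_minimal[OF _ R(1)]) auto
qed

text \<open>The region where a highest weight module of highest weight h lives. It is stable under
  lowering operators and L(0), but not under raising operators.\<close>

definition upper_weights :: "complex \<Rightarrow> 'v set" where
  "upper_weights h = vspan V (\<Union>\<mu>\<in>{h + of_nat n |n. True}. weight_space V \<mu>)"

lemma subspace_upper_weights: "vsubspace V (upper_weights h)"
  by (simp add: upper_weights_def)

lemma upper_weights_carrier: "upper_weights h \<subseteq> vcarrier V"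
  unfolding upper_weights_def by (rule span_minimal[OF _ subspace_carrier]) (auto dest: weight_carrier)

lemma weight_upper_weights: "u \<in> weight_space V (h + of_nat n) \<Longrightarrow> u \<in> upper_weights h"
  unfolding upper_weights_def by (rule span_base) auto

lemma upper_weights_lower:
  assumes "n < 0" "w \<in> upper_weights h" shows "L V n w \<in> upper_weights h"
proof (rule L_span_subset)
  show "w \<in> vspan V (\<Union>\<mu>\<in>{h + of_nat n |n. True}. weight_space V \<mu>)"
    using assms by (simp add: upper_weights_def)
  fix x assume "x \<in> (\<Union>\<mu>\<in>{h + of_nat n |n. True}. weight_space V \<mu>)"
  then obtain k where k: "x \<in> weight_space V (h + of_nat k)" by auto
  have "L V n x \<in> weight_space V (h + of_nat (k + nat (- n)))"
    using weight_L[OF k, of n] assms(1) by (simp add: algebra_simps)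
  then show "L V n x \<in> upper_weights h" by (rule weight_upper_weights)
qed (auto simp: weight_carrier subspace_upper_weights)

lemma upper_weights_L0:
  assumes "w \<in> upper_weights h" shows "L V 0 w - scl V h w \<in> upper_weights (h + 1)"
proof (rule image_span_subset[where f = "\<lambda>w. L V 0 w - scl V h w" and w = w])
  show "w \<in> vspan V (\<Union>\<mu>\<in>{h + of_nat n |n. True}. weight_space V \<mu>)"
    using assms by (simp add: upper_weights_def)
  fix x assume "x \<in> (\<Union>\<mu>\<in>{h + of_nat n |n. True}. weight_space V \<mu>)"
  then obtain k where k: "x \<in> weight_space V (h + of_nat k)" by auto
  have "scl V (of_nat k) x \<in> upper_weights (h + 1)"
  proof (cases k)
    case (Suc j)
    then have "x \<in> weight_space V (h + 1 + of_nat j)" using k by (simp add: algebra_simps)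
    then show ?thesis by (intro subspace_scale[OF subspace_upper_weights] weight_upper_weights)
  qed (simp add: subspace_0[OF subspace_upper_weights])
  then show "L V 0 x - scl V h x \<in> upper_weights (h + 1)"
    using k by (simp add: weight_space_def algebra_simps)
qed (auto simp: weight_carrier subspace_upper_weights L_add L_scl algebra_simps)

lemma upper_weights_L0_closed: "w \<in> upper_weights h \<Longrightarrow> L V 0 w \<in> upper_weights h"
proof -
  assume w: "w \<in> upper_weights h"
  have "L V 0 w \<in> vspan V (\<Union>\<mu>\<in>{h + of_nat n |n. True}. weight_space V \<mu>)"
  proof (rule L_span_subset)
    fix x assume "x \<in> (\<Union>\<mu>\<in>{h + of_nat n |n. True}. weight_space V \<mu>)"
    then obtain \<mu> where \<mu>: "\<mu> \<in> {h + of_nat n |n. True}" "x \<in> weight_space V \<mu>" by blast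
    have "L V 0 x \<in> weight_space V \<mu>" using weight_L[OF \<mu>(2), of 0] by simp
    then show "L V 0 x \<in> vspan V (\<Union>\<mu>\<in>{h + of_nat n |n. True}. weight_space V \<mu>)"
      using \<mu>(1) by (intro span_base) blast
  qed (use w in \<open>auto simp: upper_weights_def weight_carrier\<close>)
  then show ?thesis by (simp add: upper_weights_def)
qed

lemma highest_weight_module_upper:
  assumes "highest_weight_module V h M" shows "M \<subseteq> upper_weights h"
proof -
  obtain u where u: "highest_weight_vector V h u" and M: "M = \<Inter>{N. vir_submodule V N \<and> u \<in> N}"
    using assms by (auto simp: highest_weight_module_def)
  have uw: "u \<in> weight_space V h" using u by (simp add: highest_weight_vector_def)
  then have "u \<in> upper_weights h" using weight_upper_weights[of u h 0] by simp
  moreover have "L V m s \<in> vspan V {u}" if "m \<ge> 0" "s \<in> vspan V {u}" for m s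
  proof -
    obtain r where s: "s = scl V r u" using \<open>s \<in> vspan V {u}\<close> unfolding span_singleton by blast
    have "L V m s = scl V (if m = 0 then r * h else 0) u"
      using u that(1) weight_carrier[OF uw]
      by (cases "m = 0") (auto simp: s L_scl highest_weight_vector_def weight_space_def)
    then show ?thesis unfolding span_singleton by (metis rangeI)
  qed
  moreover have "vspan V {u} \<subseteq> upper_weights h"
    using calculation(1) by (intro span_minimal subspace_upper_weights) simp
  ultimately obtain N where "vir_submodule V N" "vspan V {u} \<subseteq> N" "N \<subseteq> upper_weights h"
    using vir_submodule_between[of "vspan V {u}" "upper_weights h"]
      subspace_upper_weights upper_weights_carrier upper_weights_lower by blast
  then show ?thesis using M span_base[of u "{u}"] by blast
qed

text \<open>The submodule generated by \<open>S\<close> stays in weights h + 1, h + 2, ... and so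
  misses the highest weight vector; irreducibility makes it zero. A stable set replaces the usual
  singular vector, so that its elements need not be known to be L(0)-eigenvectors.\<close>

lemma irreducible_no_singular:
  assumes irr: "is_irreducible_L V c' h M"
    and S: "S \<subseteq> M" "\<And>m s. m \<ge> 0 \<Longrightarrow> s \<in> S \<Longrightarrow> L V m s \<in> S" "S \<subseteq> upper_weights (h + 1)"
  shows "S \<subseteq> {0}"
proof -
  obtain u where u: "highest_weight_vector V h u" and M: "M = \<Inter>{N. vir_submodule V N \<and> u \<in> N}"
    using irr by (auto simp: is_irreducible_L_def highest_weight_module_def)
  have sub: "vir_submodule V M"
    using irr highest_weight_module_submodule by (auto simp: is_irreducible_L_def)
  have M': "vsubspace V M" "M \<subseteq> vcarrier V" "\<And>n w. w \<in> M \<Longrightarrow> L V n w \<in> M"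
    using sub by (auto simp: vir_submodule_def)
  obtain N where N: "vir_submodule V N" "S \<subseteq> N" "N \<subseteq> M \<inter> upper_weights (h + 1)"
  proof (rule vir_submodule_between[of S "M \<inter> upper_weights (h + 1)"])
    show "S \<subseteq> M \<inter> upper_weights (h + 1)" using S by blast
    show "vsubspace V (M \<inter> upper_weights (h + 1))"
      by (rule subspace_inter[OF M'(1) subspace_upper_weights])
  qed (use S M' upper_weights_lower in auto)
  have "u \<notin> upper_weights (h + 1)"
  proof
    assume *: "u \<in> upper_weights (h + 1)"
    have "h \<noteq> h + 1 + of_nat n" for n :: nat
      using of_nat_eq_0_iff[of "Suc n", where ?'a = complex] by (simp add: add.assoc)
    then have "h \<notin> {h + 1 + of_nat n |n. True}" by blast
    then have "u = 0"
      using weight_in_span[OF _ *[unfolded upper_weights_def]] u by (simp only: highest_weight_vector_def) blast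
    then show False using u by (simp add: highest_weight_vector_def)
  qed
  moreover have "u \<in> M" using M by blast
  ultimately have "N = {0}" using irr N by (auto simp: is_irreducible_L_def)
  then show ?thesis using N by blast
qed

section \<open>The vacuum submodule\<close>

lemma subalgebra_generated: "S \<subseteq> vcarrier V \<Longrightarrow> subalgebra V (generated_subalgebra V S)"
proof -
  assume S: "S \<subseteq> vcarrier V"
  have "subalgebra V (vcarrier V)" by (simp add: subalgebra_def subspace_carrier)
  then show ?thesis
    using S unfolding generated_subalgebra_def subalgebra_def
    by (auto intro!: subspace_Inter)
qed

lemma generated_base: "S \<subseteq> generated_subalgebra V S"
  by (auto simp: generated_subalgebra_def)

lemma generated_minimal: "subalgebra V U \<Longrightarrow> S \<subseteq> U \<Longrightarrow> generated_subalgebra V S \<subseteq> U"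
  by (auto simp: generated_subalgebra_def)

text \<open>The even vectors all of whose modes preserve \<open>M\<close> form a Virasoro submodule,
  by associativity with the conformal vector, and contain the vacuum. Minimality of \<open>M\<close>
  then puts \<open>M\<close> inside this set.\<close>

lemma vacuum_module_subalgebra:
  assumes M: "vir_submodule V M" "vac V \<in> M" "M \<subseteq> even_part V"
    and min: "\<And>N. vir_submodule V N \<Longrightarrow> vac V \<in> N \<Longrightarrow> M \<subseteq> N"
  shows "subalgebra V M"
proof -
  have M': "vsubspace V M" "M \<subseteq> vcarrier V" "\<And>n w. w \<in> M \<Longrightarrow> L V n w \<in> M"
    using M(1) by (auto simp: vir_submodule_def)
  let ?S = "{a \<in> even_part V. \<forall>n. \<forall>b\<in>M. mode V a n b \<in> M}"
  have conf: "conf V \<in> parity_part V False" by (simp add: parity_part_def conf_even)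
  have "vir_submodule V ?S"
    unfolding vir_submodule_def
  proof (intro conjI allI ballI)
    show "vsubspace V ?S"
      by (rule subspaceI)
         (use M' subspace_even in \<open>auto simp: subspace_0 subspace_add subspace_scale even_carrier
            mode_add_left mode_scl_left subset_iff\<close>)
    show "?S \<subseteq> vcarrier V" by (auto simp: even_carrier)
    fix m a assume a: "a \<in> ?S"
    have a': "a \<in> parity_part V False" using a by (simp add: parity_part_def)
    note ac = parity_carrier[OF a']
    have "mode V (L V m a) n b \<in> M" if b: "b \<in> M" for n b
    proof -
      have bc: "b \<in> vcarrier V" using M' b by blast
      obtain N1 where N1: "\<forall>i\<ge>N1. mode V a i b = 0" using truncation[OF ac bc] by blast
      obtain N2 where N2: "\<forall>i\<ge>N2. mode V (conf V) i b = 0" using truncation[OF conf_carrier bc] by blast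
      define N where "N = nat (max (N1 - n) N2)"
      have "mode V (mode V (conf V) (m + 1) a) n b
        = (\<Sum>i<N. scl V ((-1) ^ i * (of_int (m + 1) gchoose i))
              (mode V (conf V) (m + 1 - int i) (mode V a (n + int i) b)
               - scl V ((-1) powi (m + 1) * (if False \<and> False then -1 else 1))
                   (mode V a (n + (m + 1) - int i) (mode V (conf V) (int i) b))))"
        by (rule associativity[OF conf a' bc]) (use N1 N2 in \<open>auto simp: N_def nat_le_iff\<close>)
      also have "\<dots> \<in> M"
      proof (rule subspace_sum[OF M'(1)])
        fix i
        have "mode V (conf V) (m + 1 - int i) w \<in> M" if "w \<in> M" for w
          using M'(3)[OF that, of "m - int i"] by (simp add: L_def algebra_simps)
        moreover have "mode V (conf V) (int i) b \<in> M"
          using M'(3)[OF b, of "int i - 1"] by (simp add: L_def)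
        ultimately show "scl V ((-1) ^ i * (of_int (m + 1) gchoose i))
              (mode V (conf V) (m + 1 - int i) (mode V a (n + int i) b)
               - scl V ((-1) powi (m + 1) * (if False \<and> False then -1 else 1))
                   (mode V a (n + (m + 1) - int i) (mode V (conf V) (int i) b))) \<in> M"
          using a b by (intro subspace_scale[OF M'(1)] subspace_diff[OF M'(1)]) auto
      qed
      finally show ?thesis by (simp add: L_def)
    qed
    then show "L V m a \<in> ?S" using L_parity[OF a'] by (simp add: parity_part_def)
  qed
  moreover have "vac V \<in> ?S" using M' by (auto simp: vac_even vacuum subspace_0)
  ultimately have "M \<subseteq> ?S" by (rule min)
  then show ?thesis using M M' by (auto simp: subalgebra_def)
qed

lemma subalgebra_L: "subalgebra V U \<Longrightarrow> conf V \<in> U \<Longrightarrow> vir_submodule V U"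
  by (simp add: subalgebra_def vir_submodule_def L_def)

end

section \<open>Consequences of the missing low weights; even vectors of weight 2\<close>

locale griess_svoa = svoa V for V :: "('v::ab_group_add) svoa_data" +
  assumes CFT: "CFT_type V" and graded_top: "graded_with_top_weight_3_2 V"
begin

lemma even_weight_eq_0:
  assumes "u \<in> even_part V" "u \<in> weight_space V h" "Re h < 0 \<or> h = 1"
  shows "u = 0"
proof (cases "h = 1")
  case True
  then show ?thesis using assms graded_top by (auto simp: graded_with_top_weight_3_2_def)
next
  case False
  have "u \<in> vspan V (\<Union>n::nat. even_part V \<inter> weight_space V (of_nat n))"
    using assms graded_top by (auto simp: graded_with_top_weight_3_2_def)
  also have "\<dots> \<subseteq> vspan V (\<Union>\<mu>\<in>range of_nat. weight_space V \<mu>)"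
    by (rule span_mono) auto
  finally show ?thesis
    by (rule weight_in_span[OF assms(2)]) (use False assms(3) in auto)
qed

lemma odd_weight_eq_0:
  assumes "u \<in> odd_part V" "u \<in> weight_space V h" "Re h < 3 / 2"
  shows "u = 0"
proof -
  have "u \<in> vspan V (\<Union>n::nat. weight_space V (3 / 2 + of_nat n))"
    using assms graded_top by (auto simp: graded_with_top_weight_3_2_def)
  also have "\<dots> \<subseteq> vspan V (\<Union>\<mu>\<in>range (\<lambda>n. 3 / 2 + of_nat n). weight_space V \<mu>)"
    by (rule span_mono) auto
  finally show ?thesis
    by (rule weight_in_span[OF assms(2)]) (use assms(3) in auto)
qed

text \<open>The product has weight \<open>h + h' - k - 1\<close>; the two alternatives say that this
  weight is negative or equal to 1.\<close>

lemma mode_even_eq_0: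
  assumes "a \<in> parity_part V p" "a \<in> weight_space V h" "b \<in> parity_part V p" "b \<in> weight_space V h'"
    and "Re (h + h') < of_int k + 1 \<or> h + h' = of_int k + 2"
  shows "mode V a k b = 0"
proof (rule even_weight_eq_0)
  show "mode V a k b \<in> even_part V"
    using mode_parity[OF assms(1,3)] by (simp add: parity_part_def)
  show "mode V a k b \<in> weight_space V (h + h' - of_int k - 1)"
    by (rule weight_mode[OF assms(1,2,4)]) simp
  show "Re (h + h' - of_int k - 1) < 0 \<or> h + h' - of_int k - 1 = 1"
    using assms(5) by (auto simp: algebra_simps)
qed

lemma mode_odd_eq_0:
  assumes "a \<in> parity_part V p" "a \<in> weight_space V h" "b \<in> parity_part V q" "b \<in> weight_space V h'"
    and "p \<noteq> q" "Re (h + h') < of_int k + 5 / 2"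
  shows "mode V a k b = 0"
proof (rule odd_weight_eq_0)
  show "mode V a k b \<in> odd_part V"
    using mode_parity[OF assms(1,3)] assms(5) by (simp add: parity_part_def)
  show "mode V a k b \<in> weight_space V (h + h' - of_int k - 1)"
    by (rule weight_mode[OF assms(1,2,4)]) simp
qed (use assms(6) in auto)

lemma weight_0_vac: "u \<in> weight_space V 0 \<Longrightarrow> \<exists>r. u = scl V r (vac V)"
  using CFT by (auto simp: CFT_type_def span_singleton)

lemma vac_nonzero [simp]: "vac V \<noteq> 0"
proof
  assume "vac V = 0"
  then have "a = 0" if "a \<in> vcarrier V" for a
    using creation[OF that] that by simp
  then have "top_level V = {0}"
    using subspace_0[OF subspace_odd] subspace_0[OF subspace_weight]
    by (auto simp: top_level_def dest: odd_carrier)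
  then show False using graded_top by (simp add: graded_with_top_weight_3_2_def)
qed

lemma top_levelD: "x \<in> top_level V \<Longrightarrow> x \<in> parity_part V True" "x \<in> top_level V \<Longrightarrow> x \<in> weight_space V (3/2)"
  "x \<in> top_level V \<Longrightarrow> x \<in> vcarrier V"
  by (auto simp: top_level_def parity_part_def weight_carrier)

lemma weight_2_top_level:
  assumes "a \<in> even_part V" "a \<in> weight_space V 2" "x \<in> top_level V"
  shows "mode V a 1 x \<in> top_level V" "k \<ge> 2 \<Longrightarrow> mode V a k x = 0"
proof -
  have a: "a \<in> parity_part V False" using assms by (simp add: parity_part_def)
  show "mode V a 1 x \<in> top_level V"
    using mode_parity[OF a top_levelD(1)[OF assms(3)]] weight_mode[OF a assms(2) top_levelD(2)[OF assms(3)], of _ 1]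
    by (simp add: top_level_def parity_part_def)
  show "mode V a k x = 0" if "k \<ge> 2"
    using that by (intro mode_odd_eq_0[OF a assms(2) top_levelD(1,2)[OF assms(3)]]) auto
qed

text \<open>Stated for a general \<open>a\<close> because both \<open>conf V\<close> and
  \<open>e\<close> act on \<open>v\<close> as on a primary vector of weight 3/2. The coefficient is
  -(k + n) from translation plus 3/2 times k.\<close>

lemma primary_commute:
  assumes a: "a \<in> even_part V" "a \<in> weight_space V 2" and x: "x \<in> top_level V"
    and prim: "mode V a 0 x = mode V x (- 2) (vac V)" "mode V a 1 x = scl V (3 / 2) x"
    and u: "u \<in> vcarrier V"
  shows "mode V a k (mode V x n u) = mode V x n (mode V a k u) + scl V (of_int k / 2 - of_int n) (mode V x (k + n - 1) u)"
proof -
  have a': "a \<in> parity_part V False" using a by (simp add: parity_part_def)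
  note xD = top_levelD[OF x]
  have "mode V a (int i) x = 0" if "i \<ge> 2" for i
    using that weight_2_top_level(2)[OF a x] by simp
  note commutator[OF a' xD(1) u this, of 2 k n]
  also have "(\<Sum>i<2. scl V (of_int k gchoose i) (mode V (mode V a (int i) x) (k + n - int i) u))
     = scl V (of_int k / 2 - of_int n) (mode V x (k + n - 1) u)"
  proof -
    let ?A = "mode V x (k + n - 1) u"
    have "mode V (mode V a 0 x) (k + n) u = scl V (- of_int (k + n)) ?A"
      unfolding scale_minus_left prim
      using translation[OF xD(3) u, of "k + n"] xD(3) by (simp add: L_minus_1)
    moreover have "- of_int (k + n) + of_int k * (3 / 2) = (of_int k / 2 - of_int n :: complex)"
      by (simp add: algebra_simps)
    ultimately show ?thesis
      using u xD(3) scale_left_distrib[of "- of_int (k + n)" "of_int k * (3 / 2)" ?A]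
      by (simp add: sum_lessThan_numeral prim mode_scl_left)
  qed
  finally show ?thesis by simp
qed

text \<open>\<open>L V 1 a\<close> would be an even vector of weight 1. Hence every even vector of
  weight 2 is quasi-primary, which simplifies both its commutators with L(m) and its adjoint
  modes.\<close>

lemma L1_weight_2: "a \<in> even_part V \<Longrightarrow> a \<in> weight_space V 2 \<Longrightarrow> L V 1 a = 0"
  using weight_L[of a 2 1] L_parity[of a False 1] even_weight_eq_0[of "L V 1 a" 1]
  by (simp add: parity_part_def)

text \<open>Only the products of \<open>conf V\<close> with \<open>a\<close> of index 0, 1 and 3 are
  nonzero, so \<open>a\<close> commutes like \<open>conf V\<close> itself, with \<kappa> in the
  place of c/2.\<close>

lemma L_mode_weight_2:
  assumes a: "a \<in> even_part V" "a \<in> weight_space V 2" and \<kappa>: "L V 2 a = scl V \<kappa> (vac V)"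
    and u: "u \<in> vcarrier V"
  shows "L V m (mode V a (n + 1) u) = mode V a (n + 1) (L V m u) + scl V (of_int (m - n)) (mode V a (m + n + 1) u)
    + (if m + n = 0 then scl V (\<kappa> * (of_int (m ^ 3 - m) / 6)) u else 0)"
proof -
  have c: "conf V \<in> parity_part V False" and a': "a \<in> parity_part V False"
    using a conf_even by (auto simp: parity_part_def)
  note ac = even_carrier[OF a(1)]
  have 0: "mode V (conf V) 0 a = L V (-1) a" "mode V (conf V) 1 a = scl V 2 a"
    "mode V (conf V) 2 a = 0" "mode V (conf V) 3 a = scl V \<kappa> (vac V)"
    using \<kappa> a L1_weight_2[OF a] by (auto simp: L_def weight_space_def)
  have 4: "mode V (conf V) (int i) a = 0" if "i \<ge> 4" for i
    using that by (intro mode_even_eq_0[OF c conf_weight a' a(2)]) auto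
  have "L V m (mode V a (n + 1) u) = mode V a (n + 1) (L V m u) +
     (\<Sum>i<4. scl V (of_int (m + 1) gchoose i) (mode V (mode V (conf V) (int i) a) (m + 1 + (n + 1) - int i) u))"
    unfolding L_def by (subst commutator[OF c a' u 4]) auto
  also have "(\<Sum>i<4. scl V (of_int (m + 1) gchoose i) (mode V (mode V (conf V) (int i) a) (m + 1 + (n + 1) - int i) u))
     = mode V (L V (-1) a) (m + n + 2) u + scl V (of_int (m + 1) * 2) (mode V a (m + n + 1) u)
       + scl V ((of_int (m + 1) gchoose 3) * \<kappa>) (mode V (vac V) (m + n - 1) u)"
    using u ac by (simp add: sum_lessThan_numeral 0 mode_scl_left algebra_simps)
  also have "\<dots> = scl V (of_int (m - n)) (mode V a (m + n + 1) u)
    + (if m + n = 0 then scl V (\<kappa> * (of_int (m ^ 3 - m) / 6)) u else 0)"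
  proof -
    let ?A = "mode V a (m + n + 1) u"
    have "mode V (L V (-1) a) (m + n + 2) u = scl V (- of_int (m + n + 2)) ?A"
      unfolding scale_minus_left using translation[OF ac u, of "m + n + 2"] by (simp add: add_diff_eq[symmetric])
    then have "mode V (L V (-1) a) (m + n + 2) u + scl V (of_int (m + 1) * 2) ?A
        = scl V (- of_int (m + n + 2) + of_int (m + 1) * 2) ?A"
      by (simp only: scale_left_distrib)
    also have "- of_int (m + n + 2) + of_int (m + 1) * 2 = (of_int (m - n) :: complex)"
      by (simp add: algebra_simps)
    finally have 1: "mode V (L V (-1) a) (m + n + 2) u + scl V (of_int (m + 1) * 2) ?A = scl V (of_int (m - n)) ?A" .
    have "(of_int (m + 1) gchoose 3) * \<kappa> = \<kappa> * (of_int (m ^ 3 - m) / 6)"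
      by (simp add: gbinomial_3 power3_eq_cube algebra_simps)
    then have "scl V ((of_int (m + 1) gchoose 3) * \<kappa>) (mode V (vac V) (m + n - 1) u)
      = (if m + n = 0 then scl V (\<kappa> * (of_int (m ^ 3 - m) / 6)) u else 0)"
      using u by (simp only: vacuum) auto
    then show ?thesis unfolding 1 by simp
  qed
  finally show ?thesis by (simp add: add.assoc)
qed

lemma virasoro_vectorD:
  assumes "virasoro_vector V c' a"
  shows "a \<in> even_part V" "a \<in> parity_part V False" "a \<in> weight_space V 2" "a \<in> vcarrier V"
  using assms by (auto simp: virasoro_vector_def parity_part_def even_carrier)

lemma virasoro_vector_conf: "virasoro_vector V (charge V) (conf V)"
  by (simp add: virasoro_vector_def conf_even conf_weight virasoro)

lemma virasoro_vector_commute: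
  assumes a: "virasoro_vector V c' a" and u: "u \<in> vcarrier V"
  shows "mode V a m (mode V a n u) = mode V a n (mode V a m u) + scl V (of_int (m - n)) (mode V a (m + n - 1) u)
    + (if m + n = 2 then scl V (of_int (m * (m - 1) * (m - 2)) / 12 * c') u else 0)"
proof -
  have "mode V a (m - 1 + 1) (mode V a (n - 1 + 1) u) - mode V a (n - 1 + 1) (mode V a (m - 1 + 1) u)
      = scl V (of_int (m - 1 - (n - 1))) (mode V a (m - 1 + (n - 1) + 1) u)
        + (if m - 1 + (n - 1) = 0 then scl V (of_int ((m - 1) ^ 3 - (m - 1)) / 12 * c') u else 0)"
    using a u unfolding virasoro_vector_def virasoro_relations_def by blast
  moreover have "(m - 1) ^ 3 - (m - 1) = m * (m - 1) * (m - 2)"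
    by (simp add: power3_eq_cube algebra_simps)
  moreover have "m - 1 - (n - 1) = m - n" "m - 1 + (n - 1) + 1 = m + n - 1"
    "m - 1 + (n - 1) = 0 \<longleftrightarrow> m + n = 2" by auto
  ultimately have "mode V a m (mode V a n u) - mode V a n (mode V a m u)
      = scl V (of_int (m - n)) (mode V a (m + n - 1) u)
        + (if m + n = 2 then scl V (of_int (m * (m - 1) * (m - 2)) / 12 * c') u else 0)"
    by (simp only: diff_add_cancel)
  then show ?thesis by (simp only: diff_eq_eq ac_simps)
qed

lemma virasoro_vector_products:
  assumes a: "virasoro_vector V c' a"
  shows "mode V a 0 a = mode V a (- 2) (vac V)" "mode V a 1 a = scl V 2 a" "mode V a 2 a = 0"
    "mode V a 3 a = scl V (c' / 2) (vac V)"
proof -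
  note ac = virasoro_vectorD(4)[OF a]
  note vac = creation[OF ac] creation_0[OF ac]
  note comm = virasoro_vector_commute[OF a vac_carrier, of _ "- 1"]
  show "mode V a 0 a = mode V a (- 2) (vac V)" using comm[of 0] ac by (simp add: vac)
  show "mode V a 1 a = scl V 2 a" using comm[of 1] ac by (simp add: vac)
  show "mode V a 2 a = 0" using comm[of 2] ac by (simp add: vac)
  show "mode V a 3 a = scl V (c' / 2) (vac V)" using comm[of 3] ac by (simp add: vac)
qed

end

section \<open>The subalgebra generated by the square root and its singular vector\<close>

locale extended_svoa = griess_svoa V for V :: "('v::ab_group_add) svoa_data" +
  fixes e v :: 'v
  assumes virasoro_e: "virasoro_vector V (7 / 10) e"
    and ext: "extending_square_root V e v"
begin

lemma e_parity: "e \<in> parity_part V False" and e_even: "e \<in> even_part V"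
  and e_weight: "e \<in> weight_space V 2" and e_carrier [simp]: "e \<in> vcarrier V"
  using virasoro_e by (auto simp: virasoro_vector_def parity_part_def even_carrier)

lemma v_top: "v \<in> top_level V" and v_parity: "v \<in> parity_part V True"
  and v_weight: "v \<in> weight_space V (3 / 2)" and v_carrier [simp]: "v \<in> vcarrier V"
  and v_0_v: "mode V v 0 v = e"
  using ext by (auto simp: extending_square_root_def top_level_def parity_part_def odd_carrier)

lemmas e_commute = virasoro_vector_commute[OF virasoro_e]

lemma e_vac: "n \<ge> 0 \<Longrightarrow> mode V e n (vac V) = 0" "mode V e (- 1) (vac V) = e"
  by (simp_all add: creation creation_0)

lemma e_e: "mode V e 0 e = mode V e (- 2) (vac V)" "mode V e 1 e = scl V 2 e" "mode V e 2 e = 0"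
    "mode V e 3 e = scl V (7 / 20) (vac V)"
  using virasoro_vector_products[OF virasoro_e] by simp_all

text \<open>Packaged with \<open>e\<close> as conformal vector, so that interpreting the locale
  \<open>svoa\<close> at it makes weights, \<open>upper_weights\<close> and irreducibility refer to
  \<open>e\<close>.\<close>

definition sub_v :: "'v svoa_data" where
  "sub_v = sub_structure V (generated_subalgebra V {v}) e (7 / 10)"

lemma sub_v_simps: "scl sub_v = scl V" "mode sub_v = mode V" "vac sub_v = vac V"
  "even_part sub_v = even_part V \<inter> generated_subalgebra V {v}"
  "odd_part sub_v = odd_part V \<inter> generated_subalgebra V {v}" "L sub_v n u = mode V e (n + 1) u"
  by (simp_all add: sub_v_def sub_structure_def L_def)

lemma sub_v_svoa: "svoa sub_v"
  and even_irreducible: "is_irreducible_L sub_v (7 / 10) 0 (even_part sub_v)"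
  and odd_irreducible: "is_irreducible_L sub_v (7 / 10) (3 / 2) (odd_part sub_v)"
  using ext by (auto simp: extending_square_root_def is_N1_SVOA_7_10_def simple_svoa_def sub_v_def)

lemma v_sub: "v \<in> odd_part sub_v"
  using v_parity generated_base[of "{v}"] by (auto simp: sub_v_simps parity_part_def)

text \<open>Both sides are L(-1) of \<open>v\<close>, the left one formed with the conformal vector
  \<open>e\<close> of \<open>sub_v\<close>.\<close>

lemma e_0_v: "mode V e 0 v = mode V v (- 2) (vac V)"
proof -
  interpret S: svoa sub_v by (rule sub_v_svoa)
  show ?thesis using S.L_minus_1[OF S.odd_carrier[OF v_sub]] by (simp add: sub_v_simps)
qed

text \<open>The hypothesis identifies the odd part of \<open>sub_v\<close> with L(7/10, 3/2) but
  does not say that \<open>v\<close> is a highest weight vector there. The difference of the two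
  sides has no component of \<open>e\<close>-weight 3/2, and irreducibility forces it to
  vanish.\<close>

lemma e_1_v: "mode V e 1 v = scl V (3 / 2) v"
proof -
  interpret S: svoa sub_v by (rule sub_v_svoa)
  have odd: "odd_part sub_v \<subseteq> S.upper_weights (3 / 2)"
    using odd_irreducible S.highest_weight_module_upper by (simp add: is_irreducible_L_def)
  \<comment> \<open>The first two conditions concern \<open>e\<close>, the third concerns the
    conformal vector of V: since V has no odd weight below 3/2, every positive Virasoro mode of
    \<open>e\<close> kills \<open>?X\<close>.\<close>
  let ?X = "odd_part sub_v \<inter> S.upper_weights (3 / 2 + 1) \<inter> top_level V"
  have "?X \<subseteq> {0}"
  proof (rule S.irreducible_no_singular[OF odd_irreducible])
    fix m :: int and s assume m: "m \<ge> 0" and s: "s \<in> ?X"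
    show "L sub_v m s \<in> ?X"
    proof (cases "m = 0")
      case True
      have "L sub_v 0 s \<in> odd_part sub_v"
        using s S.L_parity[of s True 0] by (auto simp: parity_part_def)
      moreover have "L sub_v 0 s \<in> S.upper_weights (3 / 2 + 1)"
        using s by (intro S.upper_weights_L0_closed) auto
      moreover have "L sub_v 0 s \<in> top_level V"
        using s weight_2_top_level(1)[OF e_even e_weight] by (auto simp: sub_v_simps)
      ultimately show ?thesis using True by blast
    next
      case False
      then have "L sub_v m s = 0"
        using s m weight_2_top_level(2)[OF e_even e_weight, of s "m + 1"] by (auto simp: sub_v_simps)
      then show ?thesis
        using S.subspace_0[OF S.subspace_odd] S.subspace_0[OF S.subspace_upper_weights]
          subspace_0[OF subspace_odd] subspace_0[OF subspace_weight]
        by (simp add: top_level_def)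
    qed
  qed auto
  moreover have "mode V e 1 v - scl V (3 / 2) v \<in> ?X"
  proof (intro IntI)
    have "mode V e 1 v \<in> odd_part sub_v"
      using v_sub S.L_parity[of v True 0] by (auto simp: parity_part_def sub_v_simps)
    then show "mode V e 1 v - scl V (3 / 2) v \<in> odd_part sub_v"
      using S.subspace_diff[OF S.subspace_odd] S.subspace_scale[OF S.subspace_odd] v_sub
      by (simp add: sub_v_simps)
    show "mode V e 1 v - scl V (3 / 2) v \<in> S.upper_weights (3 / 2 + 1)"
      using S.upper_weights_L0[of v "3 / 2"] odd v_sub by (auto simp: sub_v_simps)
    show "mode V e 1 v - scl V (3 / 2) v \<in> top_level V"
      using weight_2_top_level(1)[OF e_even e_weight v_top] v_top
      unfolding top_level_def
      by (intro subspace_diff[OF subspace_inter[OF subspace_odd subspace_weight]]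
          subspace_scale[OF subspace_inter[OF subspace_odd subspace_weight]])
  qed
  ultimately show ?thesis by auto
qed

lemmas e_v_commute = primary_commute[OF e_even e_weight v_top e_0_v e_1_v]

lemma v_1_v: "mode V v 1 v = 0"
  by (rule mode_even_eq_0[OF v_parity v_weight v_parity v_weight]) simp

lemma v_ge_3_v: "k \<ge> 3 \<Longrightarrow> mode V v k v = 0"
  by (rule mode_even_eq_0[OF v_parity v_weight v_parity v_weight]) simp

text \<open>Apply \<open>e_(3)\<close> to \<open>v_(0) v = e\<close>: one side is 7/20 times the
  vacuum, the other 3/2 times \<open>v_(2) v\<close>.\<close>

lemma v_2_v: "mode V v 2 v = scl V (7 / 30) (vac V)"
proof -
  have "mode V e 3 (mode V v 0 v) = scl V (3 / 2) (mode V v 2 v)"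
    using e_v_commute[of v 3 0] weight_2_top_level(2)[OF e_even e_weight v_top, of 3] by simp
  then have "scl V (2 / 3) (scl V (7 / 20) (vac V)) = scl V (2 / 3) (scl V (3 / 2) (mode V v 2 v))"
    by (simp add: v_0_v e_e)
  then show ?thesis by simp
qed

lemma v_minus_1_v: "mode V v (- 1) v = scl V (1 / 2) (mode V e (- 2) (vac V))"
proof -
  have "mode V v (int i) v = 0" if "i \<ge> 3" for i using that v_ge_3_v by simp
  note commutator[OF v_parity v_parity vac_carrier this, of 3 "-1" "-1"]
  then have "v' = - v' + mode V e (- 2) (vac V)" if "v' = mode V v (- 1) v" for v'
    using that by (simp add: sum_lessThan_numeral v_0_v v_1_v v_2_v vacuum creation mode_scl_left)
  then have "mode V v (- 1) v + mode V v (- 1) v = mode V e (- 2) (vac V)"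
    by (simp add: eq_neg_iff_add_eq_0 algebra_simps)
  then have "scl V 2 (mode V v (- 1) v) = mode V e (- 2) (vac V)"
    using scale_left_distrib[of 1 1 "mode V v (- 1) v"] by simp
  then have "scl V (1 / 2) (scl V 2 (mode V v (- 1) v)) = scl V (1 / 2) (mode V e (- 2) (vac V))" by simp
  then show ?thesis by simp
qed

text \<open>The coefficients p = 1/3 and q = 1/10 are the unique solution of 3p + 5q = 3/2 and 87/10
  p + 6q = 7/2, the conditions that \<open>e_(2)\<close> and \<open>e_(3)\<close> annihilate the
  difference \<open>b\<close>.\<close>

lemma v_minus_2_v:
  "mode V v (- 2) v = scl V (1 / 3) (mode V e (- 1) e) + scl V (1 / 10) (mode V e (- 3) (vac V))"
proof -
  interpret S: svoa sub_v by (rule sub_v_svoa)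
  define b where "b = mode V v (- 2) v - (scl V (1 / 3) (mode V e (- 1) e) + scl V (1 / 10) (mode V e (- 3) (vac V)))"
  have bc: "b \<in> vcarrier V" by (simp add: b_def)
  have ev: "mode V e k v = 0" if "k \<ge> 2" for k
    using weight_2_top_level(2)[OF e_even e_weight v_top that] .
  note simps = mode_add_right mode_diff_right mode_scl_right e_e e_vac
  have e1: "mode V e 1 b = scl V 4 b"
  proof -
    have "mode V e 1 (mode V v (- 2) v) = scl V 4 (mode V v (- 2) v)"
      using e_v_commute[of v 1 "-2"] by (simp add: e_1_v mode_scl_right scale_left_distrib[symmetric])
    moreover have "mode V e 1 (mode V e (- 1) e) = scl V 4 (mode V e (- 1) e)"
      using e_commute[of e 1 "-1"] by (simp add: simps scale_left_distrib[symmetric])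
    moreover have "mode V e 1 (mode V e (- 3) (vac V)) = scl V 4 (mode V e (- 3) (vac V))"
      using e_commute[of "vac V" 1 "-3"] by (simp add: simps)
    ultimately show ?thesis by (simp add: b_def simps scale_right_diff_distrib scale_right_distrib)
  qed
  have e2: "mode V e 2 b = 0"
  proof -
    have "mode V e 2 (mode V v (- 2) v) = scl V (3 / 2) (mode V e (- 2) (vac V))"
      using e_v_commute[of v 2 "-2"] by (simp add: ev v_minus_1_v)
    moreover have "mode V e 2 (mode V e (- 1) e) = scl V 3 (mode V e (- 2) (vac V))"
      using e_commute[of e 2 "-1"] by (simp add: simps)
    moreover have "mode V e 2 (mode V e (- 3) (vac V)) = scl V 5 (mode V e (- 2) (vac V))"
      using e_commute[of "vac V" 2 "-3"] by (simp add: simps)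
    moreover have "scl V (3 / 2) x = x + scl V (1 / 2) x" for x
      using scale_left_distrib[of 1 "1 / 2" x] by simp
    ultimately show ?thesis by (simp add: b_def simps)
  qed
  have e3: "mode V e 3 b = 0"
  proof -
    have "mode V e 3 (mode V v (- 2) v) = scl V (7 / 2) e"
      using e_v_commute[of v 3 "-2"] by (simp add: ev v_0_v)
    moreover have "mode V e 3 (mode V e (- 1) e) = scl V (87 / 10) e"
      using e_commute[of e 3 "-1"] by (simp add: simps scale_left_distrib[symmetric])
    moreover have "mode V e 3 (mode V e (- 3) (vac V)) = scl V 6 e"
      using e_commute[of "vac V" 3 "-3"] by (simp add: simps)
    ultimately show ?thesis by (simp add: b_def simps scale_left_distrib[symmetric] scale_left_diff_distrib[symmetric])
  qed
  have b_even: "b \<in> even_part sub_v"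
    unfolding b_def
  proof (intro S.subspace_diff[OF S.subspace_even, unfolded sub_v_simps(1)] S.subspace_add[OF S.subspace_even, unfolded sub_v_simps(1)]
      S.subspace_scale[OF S.subspace_even, unfolded sub_v_simps(1)])
    show "mode V v (- 2) v \<in> even_part sub_v"
      using S.mode_parity[of v True v True] v_sub by (simp add: parity_part_def sub_v_simps(2))
    have e: "e \<in> even_part sub_v" using S.conf_even by (simp add: sub_v_def sub_structure_def)
    show "mode V e (- 1) e \<in> even_part sub_v"
      using S.mode_parity[of e False e False] e by (simp add: parity_part_def sub_v_simps(2))
    show "mode V e (- 3) (vac V) \<in> even_part sub_v"
      using S.mode_parity[of e False "vac V" False] e S.vac_even by (simp add: parity_part_def sub_v_simps(2,3))
  qed
  have b_weight: "b \<in> weight_space V 4"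
    unfolding b_def
    by (intro subspace_diff[OF subspace_weight] subspace_add[OF subspace_weight] subspace_scale[OF subspace_weight]
        weight_mode[OF v_parity v_weight v_weight] weight_mode[OF e_parity e_weight e_weight]
        weight_mode[OF e_parity e_weight vac_weight]) auto
  have b_parity: "b \<in> parity_part V False" using b_even by (simp add: sub_v_simps parity_part_def)
  have e4: "mode V e 4 b = 0"
    by (rule mode_even_eq_0[OF e_parity e_weight b_parity b_weight]) simp
  \<comment> \<open>This product has weight 0, so weights alone do not exclude it; it is half the
    commutator of \<open>e_(4)\<close> and \<open>e_(2)\<close> applied to \<open>b\<close>.\<close>
  have "mode V e 5 b = 0"
    using e_commute[OF bc, of 4 2] by (simp add: e2 e4)
  then have e_ge2: "mode V e k b = 0" if "k \<ge> 2" for k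
  proof -
    have "k = 2 \<or> k = 3 \<or> k = 4 \<or> k = 5 \<or> k > 5" using that by arith
    moreover have "mode V e k b = 0" if "k > 5"
      by (rule mode_even_eq_0[OF e_parity e_weight b_parity b_weight]) (use that in simp)
    ultimately show ?thesis using e2 e3 e4 \<open>mode V e 5 b = 0\<close> by auto
  qed
  have "range (\<lambda>r. scl V r b) \<subseteq> {0}"
  proof (rule S.irreducible_no_singular[OF even_irreducible])
    show "range (\<lambda>r. scl V r b) \<subseteq> even_part sub_v"
      using S.subspace_scale[OF S.subspace_even b_even] by (auto simp: sub_v_simps(1))
    have "b \<in> weight_space sub_v (0 + 1 + of_nat 3)"
      using e1 S.even_carrier[OF b_even] by (simp add: weight_space_def sub_v_simps)
    then have "b \<in> S.upper_weights (0 + 1)" by (rule S.weight_upper_weights)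
    then show "range (\<lambda>r. scl V r b) \<subseteq> S.upper_weights (0 + 1)"
      using S.subspace_scale[OF S.subspace_upper_weights] by (auto simp: sub_v_simps(1))
    fix m :: int and s assume "m \<ge> 0" "s \<in> range (\<lambda>r. scl V r b)"
    then obtain r where "s = scl V r b" by blast
    then have "L sub_v m s = scl V (if m = 0 then r * 4 else 0) b"
      using e1 e_ge2[of "m + 1"] \<open>m \<ge> 0\<close> bc by (cases "m = 0") (auto simp: sub_v_simps mode_scl_right)
    then show "L sub_v m s \<in> range (\<lambda>r. scl V r b)" by (metis rangeI)
  qed
  then have "scl V 1 b = 0" by (blast intro: rangeI)
  then show ?thesis by (simp add: b_def)
qed

end

context griess_svoa
begin

section \<open>Zero modes on the top level\<close>

lemma mode_mode_minus_1:
  assumes "a \<in> even_part V" "b \<in> even_part V" "u \<in> vcarrier V"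
    and "\<And>i. i \<ge> N \<Longrightarrow> mode V b (n + int i) u = 0" "\<And>i. i \<ge> N \<Longrightarrow> mode V a (int i) u = 0"
  shows "mode V (mode V a (- 1) b) n u
    = (\<Sum>i<N. mode V a (- 1 - int i) (mode V b (n + int i) u) + mode V b (n - 1 - int i) (mode V a (int i) u))"
  using associativity[of a False b False u N n "-1"] assms
  by (simp add: parity_part_def gbinomial_minus_1 minus_1_power_twice)

text \<open>\<open>a_(-m)\<close> applied to the vacuum is L(-1)^(m-1) a divided by (m-1)!. The sign
  (-1)^(m-1) of its modes is the reason for taking \<open>m\<close> odd. Only the term
  \<open>i = 1\<close> hits the mode -1 of the vacuum.\<close>

lemma mode_mode_vac:
  assumes a: "a \<in> even_part V" and x: "x \<in> vcarrier V" and m: "odd m"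
  shows "mode V (mode V a (- int m) (vac V)) (int m) x = scl V (of_nat m) (mode V a 1 x)"
proof -
  obtain N0 where N0: "\<forall>i\<ge>N0. mode V a i x = 0" using truncation[OF even_carrier[OF a] x] by blast
  define N where "N = max 2 (nat N0)"
  have "mode V (mode V a (- int m) (vac V)) (int m) x
    = (\<Sum>i<N. scl V ((-1) ^ i * (of_int (- int m) gchoose i))
              (mode V a (- int m - int i) (mode V (vac V) (int m + int i) x)
               - scl V ((-1) powi (- int m) * (if False \<and> False then -1 else 1))
                   (mode V (vac V) (int m + - int m - int i) (mode V a (int i) x))))"
    using a vac_even x N0
    by (intro associativity) (auto simp: parity_part_def vacuum N_def nat_le_iff)
  also have "\<dots> = (\<Sum>i<N. if i = 1 then scl V (of_nat m) (mode V a 1 x) else 0)"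
    using a m x by (intro sum.cong) (auto simp: vacuum even_carrier power_int_minus)
  also have "\<dots> = scl V (of_nat m) (mode V a 1 x)" by (simp add: N_def less_max_iff_disj)
  finally show ?thesis .
qed

lemma weight_minus_1:
  assumes "virasoro_vector V c' a" "b \<in> weight_space V (of_nat n)"
  shows "mode V a (- 1) b \<in> weight_space V (of_nat (n + 2))"
  using assms by (intro weight_mode[OF virasoro_vectorD(2,3)[OF assms(1)] assms(2)]) auto

context
  fixes a :: 'v and c' :: complex and x :: 'v
  assumes a: "virasoro_vector V c' a" and x: "x \<in> top_level V"
begin

lemmas top_commute = virasoro_vector_commute[OF a]
lemmas a_D = virasoro_vectorD[OF a]
lemmas top_vanish = weight_2_top_level(2)[OF a_D(1,3)]

lemma top_T [simp]: "mode V a 1 x \<in> top_level V" "x \<in> vcarrier V" "a \<in> vcarrier V"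
  using weight_2_top_level(1)[OF a_D(1,3) x] top_levelD[OF x] a_D by auto

lemma mode_2_0: "mode V a 2 (mode V a 0 x) = scl V 2 (mode V a 1 x)"
  using top_commute[of x 2 0] top_vanish[OF x] by simp

lemma zero_mode_square:
  "mode V (mode V a (- 1) a) 3 x = mode V a 1 (mode V a 1 x) + scl V 2 (mode V a 1 x)"
proof -
  have "mode V (mode V a (- 1) a) 3 x
    = (\<Sum>i<2. mode V a (- 1 - int i) (mode V a (3 + int i) x) + mode V a (3 - 1 - int i) (mode V a (int i) x))"
    using top_vanish[OF x] by (intro mode_mode_minus_1) (auto simp: a_D)
  then show ?thesis
    using top_vanish[OF x] by (simp add: sum_lessThan_numeral mode_2_0 add.commute)
qed

text \<open>Needed for the cube: \<open>a_(0) x\<close> has weight 5/2, above the top level, so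
  \<open>a_(2)\<close> no longer kills it and three terms contribute instead of two.\<close>

lemma square_4_0:
  "mode V (mode V a (- 1) a) 4 (mode V a 0 x) = scl V 4 (mode V a 1 (mode V a 1 x)) + scl V 8 (mode V a 1 x)"
proof -
  let ?y = "mode V a 0 x"
  have y: "?y \<in> parity_part V True" "?y \<in> weight_space V (5 / 2)"
    using mode_parity[OF a_D(2) top_levelD(1)[OF x], of 0] weight_mode[OF a_D(2,3) top_levelD(2)[OF x], of _ 0]
    by (auto simp: parity_part_def)
  have y0: "mode V a k ?y = 0" if "k \<ge> 3" for k
    by (rule mode_odd_eq_0[OF a_D(2,3) y]) (use that in auto)
  have yc: "?y \<in> vcarrier V" by simp
  have "mode V (mode V a (- 1) a) 4 ?y
    = (\<Sum>i<3. mode V a (- 1 - int i) (mode V a (4 + int i) ?y) + mode V a (4 - 1 - int i) (mode V a (int i) ?y))"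
    using y0 by (intro mode_mode_minus_1) (auto simp: a_D)
  also have "\<dots> = mode V a 3 (mode V a 0 ?y) + mode V a 2 (mode V a 1 ?y) + mode V a 1 (mode V a 2 ?y)"
    using y0 by (simp add: sum_lessThan_numeral)
  also have "mode V a 3 (mode V a 0 ?y) = scl V 6 (mode V a 1 x)"
    using top_commute[OF yc, of 3 0] y0 by (simp add: mode_2_0)
  also have "mode V a 2 (mode V a 1 ?y) = scl V 2 (mode V a 1 (mode V a 1 x)) + scl V 2 (mode V a 1 x)"
    using top_commute[OF yc, of 2 1] by (simp add: mode_2_0 mode_scl_right)
  also have "mode V a 1 (mode V a 2 ?y) = scl V 2 (mode V a 1 (mode V a 1 x))"
    by (simp add: mode_2_0 mode_scl_right)
  finally show ?thesis
    using scale_left_distrib[of 2 2 "mode V a 1 (mode V a 1 x)"] scale_left_distrib[of 6 2 "mode V a 1 x"]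
    by simp
qed

lemma zero_mode_cube:
  "mode V (mode V a (- 1) (mode V a (- 1) a)) 5 x
    = mode V a 1 (mode V a 1 (mode V a 1 x)) + scl V 6 (mode V a 1 (mode V a 1 x)) + scl V 8 (mode V a 1 x)"
proof -
  let ?Q = "mode V a (- 1) a"
  have Q: "?Q \<in> parity_part V False" "?Q \<in> weight_space V 4"
    using mode_parity[OF a_D(2) a_D(2), of "- 1"] weight_minus_1[OF a, of a 2] a_D(3) by auto
  have Q0: "mode V ?Q k x = 0" if "k \<ge> 5" for k
    by (rule mode_odd_eq_0[OF Q top_levelD(1,2)[OF x]]) (use that in auto)
  have "mode V (mode V a (- 1) ?Q) 5 x
    = (\<Sum>i<2. mode V a (- 1 - int i) (mode V ?Q (5 + int i) x) + mode V ?Q (5 - 1 - int i) (mode V a (int i) x))"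
    using top_vanish[OF x] Q Q0 by (intro mode_mode_minus_1) (auto simp: a_D parity_part_def)
  also have "\<dots> = mode V ?Q 4 (mode V a 0 x) + mode V ?Q 3 (mode V a 1 x)"
    using Q0 by (simp add: sum_lessThan_numeral)
  also have "mode V ?Q 3 (mode V a 1 x)
    = mode V a 1 (mode V a 1 (mode V a 1 x)) + scl V 2 (mode V a 1 (mode V a 1 x))"
  proof -
    let ?x = "mode V a 1 x"
    have 2: "mode V a 2 (mode V a 0 ?x) = scl V 2 (mode V a 1 ?x)"
      using top_commute[of ?x 2 0] top_vanish[OF top_T(1)] by simp
    have "mode V ?Q 3 ?x
      = (\<Sum>i<2. mode V a (- 1 - int i) (mode V a (3 + int i) ?x) + mode V a (3 - 1 - int i) (mode V a (int i) ?x))"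
      using top_vanish[OF top_T(1)] by (intro mode_mode_minus_1) (auto simp: a_D)
    then show ?thesis
      using top_vanish[OF top_T(1)] 2 by (simp add: sum_lessThan_numeral add.commute)
  qed
  finally show ?thesis
    using scale_left_distrib[of 4 2 "mode V a 1 (mode V a 1 x)"]
    by (simp add: square_4_0 algebra_simps)
qed

lemma zero_mode_minus_3:
  "mode V (mode V a (- 3) a) 5 x = scl V 3 (mode V a 1 (mode V a 1 x)) + scl V 2 (mode V a 1 x)"
proof -
  have "mode V (mode V a (- 3) a) 5 x
    = (\<Sum>i<2. scl V ((-1) ^ i * (of_int (- 3) gchoose i))
              (mode V a (- 3 - int i) (mode V a (5 + int i) x)
               - scl V ((-1) powi (- 3) * (if False \<and> False then -1 else 1))
                   (mode V a (5 + - 3 - int i) (mode V a (int i) x))))"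
    using top_vanish[OF x] by (intro associativity) (auto simp: a_D)
  also have "\<dots> = scl V 3 (mode V a 1 (mode V a 1 x)) + scl V 2 (mode V a 1 x)"
    using top_vanish[OF x] by (simp add: sum_lessThan_numeral gbinomial_minus_3 mode_2_0 power_int_minus)
  finally show ?thesis .
qed

end

lemma conf_top: "x \<in> top_level V \<Longrightarrow> mode V (conf V) 1 x = scl V (3 / 2) x"
  using top_levelD(2)[of x] by (simp add: weight_space_def L_def)

lemma zero_mode_L_minus_3_square:
  assumes x: "x \<in> top_level V"
  shows "mode V (mode V (conf V) (- 2) (mode V (conf V) (- 2) (vac V))) 5 x = scl V 18 x"
proof -
  note conf = virasoro_vector_conf
  note vanish = weight_2_top_level(2)[OF conf_even conf_weight x]
  note xc = top_levelD(3)[OF x]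
  let ?b = "mode V (conf V) (- 2) (vac V)"
  have b: "mode V ?b k u = scl V (- of_int k) (mode V (conf V) (k - 1) u)" if "u \<in> vcarrier V" for k u
    using translation[OF conf_carrier that, of k] by (simp add: L_minus_1)
  have bp: "?b \<in> parity_part V False"
    using mode_parity[of "conf V" False "vac V" False] conf_even vac_even by (simp add: parity_part_def)
  have "mode V (mode V (conf V) (- 2) ?b) 5 x
    = (\<Sum>i<2. scl V ((-1) ^ i * (of_int (- 2) gchoose i))
              (mode V (conf V) (- 2 - int i) (mode V ?b (5 + int i) x)
               - scl V ((-1) powi (- 2) * (if False \<and> False then -1 else 1))
                   (mode V ?b (5 + - 2 - int i) (mode V (conf V) (int i) x))))"
    using vanish xc by (intro associativity[OF _ bp]) (auto simp: conf_even b parity_part_def)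
  also have "\<dots> = scl V 3 (mode V (conf V) 2 (mode V (conf V) 0 x)) + scl V 4 (mode V (conf V) 1 (mode V (conf V) 1 x))"
    using vanish xc by (simp add: sum_lessThan_numeral gbinomial_minus_2 power_int_minus b)
  also have "\<dots> = scl V 18 x"
    using scale_left_distrib[of 9 9 x] xc by (simp add: mode_2_0[OF conf x] conf_top[OF x] mode_scl_right)
  finally show ?thesis .
qed

end

section \<open>The quadratic relation on the top level\<close>

context extended_svoa
begin

lemma v_v_anticommute:
  assumes u: "u \<in> vcarrier V"
  shows "mode V v 1 (mode V v 0 u) = mode V e 1 u - mode V v 0 (mode V v 1 u)"
proof -
  have "mode V v (int i) v = 0" if "i \<ge> 3" for i using that v_ge_3_v by simp
  note commutator[OF v_parity v_parity u this, of 3 1 0]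
  moreover have "(1 :: complex) gchoose 2 = 0" by (simp add: gbinomial_2)
  ultimately show ?thesis by (simp add: sum_lessThan_numeral v_0_v v_1_v u)
qed

text \<open>Kept for arbitrary \<open>u\<close>, since it serves on the top level and again for
  vectors of minimal weight outside W.\<close>

lemma v_minus_2_v_mode:
  assumes u: "u \<in> vcarrier V" and N: "\<And>i. i \<ge> N \<Longrightarrow> mode V v (int i) u = 0"
  shows "mode V (mode V v (- 2) v) 3 u
    = (\<Sum>i<N. scl V (of_nat (Suc i)) (mode V v (- 2 - int i) (mode V v (3 + int i) u) + mode V v (1 - int i) (mode V v (int i) u)))"
proof -
  have "mode V v (3 + int i) u = 0" if "i \<ge> N" for i
    using N[of "i + 3"] that by (simp add: add.commute)
  then show ?thesis
    using associativity[OF v_parity v_parity u _ N, of N 3 "- 2"]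
    by (simp add: gbinomial_minus_2 power_int_minus minus_1_power_twice)
qed

text \<open>Both sides of \<open>v_minus_2_v\<close> are evaluated on \<open>x\<close>. On the left
  \<open>v_(1) x\<close> vanishes (weight 1), \<open>v_(1) v_(0) x\<close> becomes T x, and the term
  \<open>i = 2\<close> gives 3 \<kappa> v; the right side is (T^2 + 2 T) x / 3 + 3/10 T x.
  Multiplying by 3 produces the 9 and leaves 3 - 2 - 9/10 = 1/10.\<close>

lemma top_relation:
  assumes x: "x \<in> top_level V" and \<kappa>: "mode V v 2 x = scl V \<kappa> (vac V)"
  shows "mode V e 1 (mode V e 1 x) = scl V (1 / 10) (mode V e 1 x) + scl V (9 * \<kappa>) v"
proof -
  note xc = top_levelD(3)[OF x]
  have v1: "mode V v 1 x = 0"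
    by (rule mode_even_eq_0[OF v_parity v_weight top_levelD(1,2)[OF x]]) simp
  have v3: "mode V v k x = 0" if "k \<ge> 3" for k
    by (rule mode_even_eq_0[OF v_parity v_weight top_levelD(1,2)[OF x]]) (use that in simp)
  have "mode V (mode V v (- 2) v) 3 x = mode V v 1 (mode V v 0 x) + scl V (3 * \<kappa>) v"
    using v_minus_2_v_mode[OF xc, of 3] v3 v1
    by (simp add: sum_lessThan_numeral \<kappa> mode_scl_right creation)
  also have "mode V v 1 (mode V v 0 x) = mode V e 1 x"
    using v_v_anticommute[OF xc] v1 by simp
  finally have 1: "mode V (mode V v (- 2) v) 3 x = mode V e 1 x + scl V (3 * \<kappa>) v" .
  have 2: "mode V (mode V v (- 2) v) 3 x = scl V (1 / 3) (mode V e 1 (mode V e 1 x) + scl V 2 (mode V e 1 x))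
      + scl V (3 / 10) (mode V e 1 x)"
    using zero_mode_square[OF virasoro_e x] mode_mode_vac[OF e_even xc, of 3] xc
    by (simp add: v_minus_2_v mode_add_left mode_scl_left)
  let ?T = "mode V e 1 x"
  have "mode V e 1 ?T = scl V 3 (scl V (1 / 3) (mode V e 1 ?T + scl V 2 ?T)
      + scl V (3 / 10) ?T) - (scl V 2 ?T + scl V (9 / 10) ?T)"
    by (simp add: scale_right_distrib)
  also have "\<dots> = scl V 3 (?T + scl V (3 * \<kappa>) v) - (scl V 2 ?T + scl V (9 / 10) ?T)"
    using 1 2 by simp
  also have "\<dots> = scl V (3 - (2 + 9 / 10)) ?T + scl V (9 * \<kappa>) v"
    unfolding scale_left_diff_distrib scale_left_distrib by (simp add: scale_right_distrib)
  finally show ?thesis by simp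
qed

end

section \<open>The invariant form and the splitting off of the vacuum component\<close>

locale design_svoa = griess_svoa V for V :: "('v::ab_group_add) svoa_data" +
  fixes B :: "'v \<Rightarrow> 'v \<Rightarrow> complex"
  assumes invariant: "invariant_form V B" and nondegenerate: "nondegenerate_on B (vcarrier V)"
    and nondegenerate_conf: "nondegenerate_on B (generated_subalgebra V {conf V})"
    and decomposition: "direct_sum_of_highest_weight_modules V"
begin

lemma B_linear:
  assumes "u \<in> vcarrier V" "u' \<in> vcarrier V" "w \<in> vcarrier V"
  shows "B (u + u') w = B u w + B u' w" "B w (u + u') = B w u + B w u'"
    "B (scl V r u) w = r * B u w" "B w (scl V r u) = r * B w u"
proof -
  have "bilinear_form V B" using invariant by (simp only: invariant_form_def)
  note * = this[unfolded bilinear_form_def, rule_format, OF assms]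
  show "B (u + u') w = B u w + B u' w" using * by (rule conjunct1)
  show "B (scl V r u) w = r * B u w" using *[THEN conjunct2] by (rule conjunct1)
  show "B w (u + u') = B w u + B w u'" using *[THEN conjunct2, THEN conjunct2] by (rule conjunct1)
  show "B w (scl V r u) = r * B w u" using *[THEN conjunct2, THEN conjunct2] by (rule conjunct2)
qed

lemma B_zero: "u \<in> vcarrier V \<Longrightarrow> B u 0 = 0" "u \<in> vcarrier V \<Longrightarrow> B 0 u = 0"
  using B_linear(3)[of 0 0 u 0] B_linear(4)[of 0 0 u 0] by simp_all

lemma B_adjoint:
  assumes a: "a \<in> even_part V" "a \<in> weight_space V 2" and u: "u \<in> vcarrier V" "w \<in> vcarrier V"
  shows "B (mode V a n u) w = B u (mode V a (2 - n) w)"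
proof -
  have L1: "(L V 1 ^^ i) a = 0" if "i > 0" for i
  proof -
    obtain j where i: "i = Suc j" using \<open>i > 0\<close> gr0_implies_Suc by blast
    have "(L V 1 ^^ j) 0 = 0" by (induction j) auto
    then show ?thesis using L1_weight_2[OF a] by (simp add: i funpow_Suc_right del: funpow.simps)
  qed
  \<comment> \<open>Weights are passed to \<open>adjoint_mode\<close> doubled, so weight 2 is 4. The
    exponent is 10 pi i, and the factor \<zeta> disappears.\<close>
  have "of_real pi * \<i> * (of_int 4 / 2 + 2 * (of_int 4 / 2)\<^sup>2) = of_nat 5 * (2 * complex_of_real pi * \<i>)"
    by (simp add: power2_eq_square)
  then have \<zeta>: "exp (of_real pi * \<i> * (of_int 4 / 2 + 2 * (of_int 4 / 2)\<^sup>2)) = 1"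
    by (simp only: exp_of_nat_mult exp_two_pi_i power_one)
  have "adjoint_mode V 4 a n w = Sum_any (\<lambda>i::nat. scl V (1 / fact i) (mode V ((L V 1 ^^ i) a) (4 - n - 2 - int i) w))"
    unfolding adjoint_mode_def Let_def \<zeta> ..
  also have "\<dots> = (\<Sum>i<1. scl V (1 / fact i) (mode V ((L V 1 ^^ i) a) (4 - n - 2 - int i) w))"
    using u by (intro Sum_any_lessThan) (simp add: L1)
  also have "\<dots> = mode V a (2 - n) w" by simp
  finally have adj: "adjoint_mode V 4 a n w = mode V a (2 - n) w" .
  have "a \<in> weight_space V (of_int 4 / 2)" using a by simp
  then have "B (mode V a n u) w = B u (adjoint_mode V 4 a n w)"
    by (rule invariant[unfolded invariant_form_def, THEN conjunct2, rule_format, OF _ u])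
  then show ?thesis unfolding adj .
qed

lemma B_L:
  assumes "u \<in> vcarrier V" "w \<in> vcarrier V" shows "B (L V n u) w = B u (L V (- n) w)"
  using B_adjoint[OF conf_even conf_weight assms, of "n + 1"] by (simp add: L_def algebra_simps)

section \<open>The vacuum component\<close>

definition positive_part :: "'v set" where
  "positive_part = vspan V (\<Union>k\<in>{1::nat..}. isotypic V (of_nat k / 2))"

lemma isotypic_submodule: "vir_submodule V (isotypic V h)"
  unfolding isotypic_def by (rule vir_submodule_span_Union) (auto intro: highest_weight_module_submodule)

lemma positive_part_submodule: "vir_submodule V positive_part"
  unfolding positive_part_def by (rule vir_submodule_span_Union) (auto intro: isotypic_submodule)

lemma vir_submoduleD:
  assumes "vir_submodule V M" shows "vsubspace V M" "M \<subseteq> vcarrier V" "w \<in> M \<Longrightarrow> L V n w \<in> M"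
  using assms by (auto simp: vir_submodule_def)

lemma vac_isotypic: "vac V \<in> isotypic V 0"
proof -
  have "highest_weight_vector V 0 (vac V)"
    by (simp add: highest_weight_vector_def vac_weight vac_nonzero L_vac)
  then have "highest_weight_module V 0 (\<Inter>{N. vir_submodule V N \<and> vac V \<in> N})"
    unfolding highest_weight_module_def by blast
  then show ?thesis unfolding isotypic_def by (intro span_base) blast
qed

text \<open>CFT type makes every highest weight vector of weight 0 a multiple of the vacuum, so all
  the modules spanning \<open>isotypic V 0\<close> coincide with the one generated by the
  vacuum.\<close>

lemma isotypic_0_minimal:
  assumes N: "vir_submodule V N" "vac V \<in> N" shows "isotypic V 0 \<subseteq> N"
  unfolding isotypic_def
proof (rule span_minimal[OF _ vir_submoduleD(1)[OF N(1)]])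
  have "M \<subseteq> N" if M: "highest_weight_module V 0 M" for M
  proof -
    obtain u where u: "highest_weight_vector V 0 u" "M = \<Inter>{N. vir_submodule V N \<and> u \<in> N}"
      using M by (auto simp: highest_weight_module_def)
    then obtain r where "u = scl V r (vac V)" using weight_0_vac by (auto simp: highest_weight_vector_def)
    then have "u \<in> N" using subspace_scale[OF vir_submoduleD(1)[OF N(1)] N(2)] by simp
    then show ?thesis using u N by blast
  qed
  then show "\<Union> {M. highest_weight_module V 0 M} \<subseteq> N" by blast
qed

lemma isotypic_0_even: "isotypic V 0 \<subseteq> even_part V"
proof (rule isotypic_0_minimal)
  show "vir_submodule V (even_part V)"
    using L_parity[of _ False] by (auto simp: vir_submodule_def subspace_even even_carrier parity_part_def)
qed (rule vac_even)

text \<open>Links the Virasoro-module description used by \<open>proj0\<close> with the subalgebra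
  on which the form is assumed non-degenerate.\<close>

lemma isotypic_0_generated: "isotypic V 0 = generated_subalgebra V {conf V}"
proof
  have sub: "subalgebra V (generated_subalgebra V {conf V})" by (rule subalgebra_generated) simp
  then have "vir_submodule V (generated_subalgebra V {conf V})"
    using generated_base[of "{conf V}"] by (intro subalgebra_L) auto
  then show "isotypic V 0 \<subseteq> generated_subalgebra V {conf V}"
    using sub by (intro isotypic_0_minimal) (auto simp: subalgebra_def)
  have "subalgebra V (isotypic V 0)"
    by (rule vacuum_module_subalgebra[OF isotypic_submodule vac_isotypic isotypic_0_even isotypic_0_minimal])
  moreover have "conf V \<in> isotypic V 0"
    using vir_submoduleD(3)[OF isotypic_submodule vac_isotypic, of "-2"] by (simp add: L_conf)
  ultimately show "generated_subalgebra V {conf V} \<subseteq> isotypic V 0"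
    by (intro generated_minimal) auto
qed

lemma highest_weight_half_nat:
  assumes "highest_weight_vector V h u" shows "\<exists>k::nat. h = of_nat k / 2"
proof -
  have u: "u \<in> weight_space V h" "u \<noteq> 0" using assms by (auto simp: highest_weight_vector_def)
  have "u \<in> vspan V (\<Union>k::int. weight_space V (of_int k / 2))"
    using weight_carrier[OF u(1)] graded by simp
  then have "u \<in> vspan V (\<Union>\<mu>\<in>range (\<lambda>k::int. of_int k / 2). weight_space V \<mu>)" by (simp add: image_image)
  then have "h \<in> range (\<lambda>k::int. of_int k / 2)" using weight_in_span[OF u(1)] u(2) by blast
  then obtain k :: int where k: "h = of_int k / 2" by blast
  have "k \<ge> 0"
  proof (rule ccontr)
    assume "\<not> k \<ge> 0"
    then have "weight_space V (of_int k / 2) = {0}" using CFT by (auto simp: CFT_type_def)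
    then show False using u unfolding k by blast
  qed
  then show ?thesis using k by (intro exI[of _ "nat k"]) simp
qed

lemma carrier_decomposition:
  assumes "a \<in> vcarrier V"
  obtains b r where "b \<in> isotypic V 0" "r \<in> positive_part" "a = b + r"
proof -
  obtain F where F: "\<forall>M\<in>F. \<exists>h. highest_weight_module V h M" "vcarrier V = vspan V (\<Union>F)"
    using decomposition by (auto simp: direct_sum_of_highest_weight_modules_def)
  let ?S = "{x + y |x y. x \<in> isotypic V 0 \<and> y \<in> positive_part}"
  have sub: "vsubspace V ?S"
    by (intro subspace_sums vir_submoduleD(1) isotypic_submodule positive_part_submodule)
  have zero: "0 \<in> isotypic V 0" "0 \<in> positive_part"
    by (simp_all add: isotypic_def positive_part_def span_zero)
  have "w \<in> ?S" if M: "M \<in> F" and w: "w \<in> M" for M w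
  proof -
    obtain h where h: "highest_weight_module V h M" using F M by blast
    then obtain k :: nat where k: "h = of_nat k / 2"
      using highest_weight_half_nat by (auto simp: highest_weight_module_def)
    have iso: "w \<in> isotypic V h" using h w unfolding isotypic_def by (intro span_base) blast
    show ?thesis
    proof (cases "k = 0")
      case True
      then have "w + 0 \<in> ?S" using iso k zero by (intro CollectI exI conjI refl) auto
      then show ?thesis by simp
    next
      case False
      then have "w \<in> positive_part"
        using iso unfolding positive_part_def k by (intro span_base UN_I[of k]) auto
      then have "0 + w \<in> ?S" using zero by blast
      then show ?thesis by simp
    qed
  qed
  then have "vspan V (\<Union>F) \<subseteq> ?S" by (intro span_minimal[OF _ sub]) blast
  then show thesis using that assms F(2) by blast
qed

lemma positive_part_weights:
  "positive_part \<subseteq> vspan V (\<Union>\<mu>\<in>{of_nat k / 2 |k. k \<ge> 1}. weight_space V \<mu>)"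
  unfolding positive_part_def
proof (intro span_minimal subspace_span UN_least)
  fix k :: nat assume k: "k \<in> {1..}"
  have "(of_nat k / 2 + of_nat n :: complex) \<in> {of_nat k / 2 |k. k \<ge> 1}" for n
    using k by (intro CollectI exI[of _ "k + 2 * n"]) (auto simp: field_simps)
  then have "(\<Union>\<mu>\<in>{of_nat k / 2 + of_nat n |n. True}. weight_space V \<mu>)
      \<subseteq> (\<Union>\<mu>\<in>{of_nat k / 2 |k. k \<ge> 1}. weight_space V \<mu>)" by blast
  then have "upper_weights (of_nat k / 2) \<subseteq> vspan V (\<Union>\<mu>\<in>{of_nat k / 2 |k. k \<ge> 1}. weight_space V \<mu>)"
    unfolding upper_weights_def by (rule span_mono)
  moreover have "isotypic V (of_nat k / 2) \<subseteq> upper_weights (of_nat k / 2)"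
    unfolding isotypic_def
    using highest_weight_module_upper by (intro span_minimal subspace_upper_weights) blast
  ultimately show "isotypic V (of_nat k / 2) \<subseteq> vspan V (\<Union>\<mu>\<in>{of_nat k / 2 |k. k \<ge> 1}. weight_space V \<mu>)"
    by blast
qed

lemma positive_part_weight_0: "u \<in> positive_part \<Longrightarrow> u \<in> weight_space V 0 \<Longrightarrow> u = 0"
  using positive_part_weights by (intro weight_in_span[of u 0 "{of_nat k / 2 |k. k \<ge> 1}"]) auto

lemma B_weight:
  assumes "u \<in> weight_space V h" "w \<in> weight_space V h'" "h \<noteq> h'" shows "B u w = 0"
proof -
  have c: "u \<in> vcarrier V" "w \<in> vcarrier V" using assms weight_carrier by auto
  have "h * B u w = h' * B u w"
    using B_L[OF c, of 0] assms c by (simp add: weight_space_def B_linear(3)[OF c(1) c(1) c(2)] B_linear(4)[OF c(2) c(2) c(1)])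
  then show ?thesis using assms by simp
qed

lemma B_vac_positive: "w \<in> positive_part \<Longrightarrow> B (vac V) w = 0"
proof -
  assume w: "w \<in> positive_part"
  let ?K = "{w \<in> vcarrier V. B (vac V) w = 0}"
  have "vsubspace V ?K" by (rule subspaceI) (auto simp: B_linear B_zero)
  then have "vspan V (\<Union>\<mu>\<in>{of_nat k / 2 |k. k \<ge> 1}. weight_space V \<mu>) \<subseteq> ?K"
  proof (intro span_minimal UN_least subsetI)
    fix \<mu> u assume "\<mu> \<in> {of_nat k / 2 |k. k \<ge> 1}" "u \<in> weight_space V \<mu>"
    moreover from this have "0 \<noteq> \<mu>" by auto
    ultimately show "u \<in> ?K" using B_weight[OF vac_weight] weight_carrier by blast
  qed
  then show ?thesis using w positive_part_weights by blast
qed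

text \<open>By weights the vacuum is orthogonal to \<open>positive_part\<close>; invariance spreads
  this to the whole vacuum component. A common vector thus lies in the radical of the form there.
  Directness of the given decomposition would not settle this, because \<open>isotypic\<close> is
  spanned by all highest weight modules of V.\<close>

lemma isotypic_0_positive:
  assumes "b \<in> isotypic V 0" "b \<in> positive_part" shows "b = 0"
proof -
  note pos = vir_submoduleD[OF positive_part_submodule]
  let ?K = "{z \<in> vcarrier V. \<forall>w\<in>positive_part. B z w = 0}"
  have "vsubspace V ?K" using pos(2) by (intro subspaceI) (auto simp: B_linear B_zero subset_iff)
  moreover have "L V n z \<in> ?K" if "z \<in> ?K" for n z
    using that pos by (auto simp: B_L subset_iff)
  ultimately have "vir_submodule V ?K" by (auto simp: vir_submodule_def)
  then have "isotypic V 0 \<subseteq> ?K" using B_vac_positive by (intro isotypic_0_minimal) auto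
  then have "\<forall>z\<in>generated_subalgebra V {conf V}. B z b = 0"
    using assms(2) isotypic_0_generated by blast
  then show ?thesis
    using nondegenerate_conf assms(1) isotypic_0_generated unfolding nondegenerate_on_def by blast
qed

text \<open>Turns the definite description into a usable projection: existence by
  \<open>carrier_decomposition\<close>, uniqueness by \<open>isotypic_0_positive\<close>.\<close>

lemma proj0:
  assumes "a \<in> vcarrier V" shows "proj0 V a \<in> isotypic V 0" "a - proj0 V a \<in> positive_part"
proof -
  obtain b r where br: "b \<in> isotypic V 0" "r \<in> positive_part" "a = b + r"
    using carrier_decomposition[OF assms] by blast
  have "proj0 V a = b"
    unfolding proj0_def positive_part_def[symmetric]
  proof (rule the_equality)
    fix b' assume b': "b' \<in> isotypic V 0 \<and> a - b' \<in> positive_part"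
    have "b' - b \<in> isotypic V 0"
      using b' br subspace_diff[OF vir_submoduleD(1)[OF isotypic_submodule]] by blast
    moreover have "b' - b = r - (a - b')" using br by (simp add: algebra_simps)
    then have "b' - b \<in> positive_part"
      using b' br subspace_diff[OF vir_submoduleD(1)[OF positive_part_submodule]] by metis
    ultimately show "b' = b" using isotypic_0_positive[of "b' - b"] by simp
  qed (use br in auto)
  then show "proj0 V a \<in> isotypic V 0" "a - proj0 V a \<in> positive_part" using br by auto
qed

lemma proj0_weight:
  assumes a: "a \<in> weight_space V h" shows "proj0 V a \<in> weight_space V h"
proof -
  note ac = weight_carrier[OF a] and p = proj0[OF weight_carrier[OF a]]
  note U = vir_submoduleD[OF isotypic_submodule[of 0]] and P = vir_submoduleD[OF positive_part_submodule]
  have bc: "proj0 V a \<in> vcarrier V" using p U by blast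
  let ?d = "L V 0 (proj0 V a) - scl V h (proj0 V a)"
  have "?d \<in> isotypic V 0" using p U by (intro subspace_diff[OF U(1)] subspace_scale[OF U(1)]) auto
  moreover have "?d = scl V h (a - proj0 V a) - L V 0 (a - proj0 V a)"
    using a ac bc by (simp add: L_diff weight_space_def algebra_simps)
  then have "?d \<in> positive_part"
    using p P(3)[OF p(2), of 0] subspace_diff[OF P(1)] subspace_scale[OF P(1)] by simp
  ultimately have "?d = 0" by (rule isotypic_0_positive)
  then show ?thesis using bc by (simp add: weight_space_def)
qed

text \<open>If nonzero, \<open>b\<close> would generate a highest weight module of positive weight
  and so lie in \<open>positive_part\<close> as well.\<close>

lemma isotypic_0_singular:
  assumes b: "b \<in> isotypic V 0" "b \<in> weight_space V (of_nat n)" "n > 0" and L: "\<And>k. k > 0 \<Longrightarrow> L V k b = 0"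
  shows "b = 0"
proof (rule ccontr)
  assume "b \<noteq> 0"
  then have "highest_weight_vector V (of_nat n) b" using b L by (simp add: highest_weight_vector_def)
  then have "highest_weight_module V (of_nat (2 * n) / 2) (\<Inter>{N. vir_submodule V N \<and> b \<in> N})"
    unfolding highest_weight_module_def by auto
  then have "b \<in> isotypic V (of_nat (2 * n) / 2)" unfolding isotypic_def by (intro span_base) blast
  then have "b \<in> positive_part" unfolding positive_part_def using b(3) by (intro span_base UN_I[of "2 * n"]) auto
  then show False using isotypic_0_positive b \<open>b \<noteq> 0\<close> by blast
qed

end

context griess_svoa
begin

section \<open>Virasoro operators on monomials in a Virasoro vector\<close>

context
  fixes a :: 'v and c' :: complex
  assumes a: "virasoro_vector V c' a"
begin

text \<open>Applying L(2) to \<open>a_(1) a = 2 a\<close> gives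
  \<open>L V 2 a = mode V a 3 a\<close>, so the scalar with respect to the conformal vector is read
  off from the relations of \<open>a\<close> itself.\<close>

lemma L2_virasoro_vector: "L V 2 a = scl V (c' / 2) (vac V)"
proof -
  note D = virasoro_vectorD[OF a]
  obtain \<kappa> where \<kappa>: "L V 2 a = scl V \<kappa> (vac V)"
    using weight_0_vac weight_L[OF D(3), of 2] by auto
  have "scl V 2 (L V 2 a) = scl V 2 (mode V a 3 a)"
    using L_mode_weight_2[OF D(1,3) \<kappa> D(4), of 2 0] D(4)
    by (simp add: virasoro_vector_products[OF a] L_scl \<kappa> mode_scl_right creation_0)
  then have "L V 2 a = mode V a 3 a" by simp
  then show ?thesis by (simp add: virasoro_vector_products[OF a])
qed

lemma L_mode_virasoro_vector:
  assumes "u \<in> vcarrier V"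
  shows "L V m (mode V a n u) = mode V a n (L V m u) + scl V (of_int (m - n + 1)) (mode V a (m + n) u)
    + (if m + n = 1 then scl V (c' / 2 * (of_int (m ^ 3 - m) / 6)) u else 0)"
  using L_mode_weight_2[OF virasoro_vectorD(1,3)[OF a] L2_virasoro_vector assms, of m "n - 1"]
  by (simp add: algebra_simps)

lemma L_ge_3_virasoro_vector: "m \<ge> 3 \<Longrightarrow> L V m a = 0"
  unfolding L_def
  by (rule mode_even_eq_0[OF virasoro_vectorD(2,3)[OF virasoro_vector_conf] virasoro_vectorD(2,3)[OF a]]) simp

lemmas a_carrier [simp] = virasoro_vectorD(4)[OF a]

lemma a_vac [simp]: "mode V a (- 1) (vac V) = a" "n \<ge> 0 \<Longrightarrow> mode V a n (vac V) = 0"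
  by (simp_all add: creation creation_0)

lemmas virasoro_vector_rules = L_mode_virasoro_vector L_vac virasoro_vector_products[OF a] L2_virasoro_vector L_ge_3_virasoro_vector
  mode_scl_right mode_add_right L_scl L_add

text \<open>These and the following values feed the matching of scalars in weights 4 and 6. A
  general Virasoro vector is kept so that monomials in \<open>e\<close> (\<open>c' = 7 / 10\<close>)
  and in \<open>conf V\<close> (\<open>c'\<close> the charge of V) share one computation.\<close>

lemma L_vac_modes:
  "L V 3 (mode V a (- 2) (vac V)) = scl V (2 * c') (vac V)"
  "L V 2 (mode V a (- 2) (vac V)) = 0"
  "L V 2 (mode V a (- 3) (vac V)) = scl V 6 a"
  "L V 4 (mode V a (- 3) (vac V)) = scl V (5 * c') (vac V)"
  "L V 2 (mode V a (- 5) (vac V)) = scl V 8 (mode V a (- 3) (vac V))"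
  "L V 3 (mode V a (- 5) (vac V)) = scl V 9 (mode V a (- 2) (vac V))"
  "L V 6 (mode V a (- 5) (vac V)) = scl V (35 / 2 * c') (vac V)"
  by (simp_all add: virasoro_vector_rules mult.commute)

lemma a_square:
  "mode V a 1 (mode V a (- 1) a) = scl V 4 (mode V a (- 1) a)"
  "mode V a 2 (mode V a (- 1) a) = scl V 3 (mode V a (- 2) (vac V))"
  "mode V a 5 (mode V a (- 1) a) = scl V (3 * c') (vac V)"
proof -
  have 4: "mode V a 4 a = 0" "mode V a 5 a = 0"
    by (rule mode_even_eq_0[OF virasoro_vectorD(2,3)[OF a] virasoro_vectorD(2,3)[OF a]]; simp)+
  note comm = virasoro_vector_commute[OF a a_carrier, of _ "- 1"]
  show "mode V a 1 (mode V a (- 1) a) = scl V 4 (mode V a (- 1) a)"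
    using comm[of 1] scale_left_distrib[of 2 2 "mode V a (- 1) a"] by (simp add: virasoro_vector_rules)
  show "mode V a 2 (mode V a (- 1) a) = scl V 3 (mode V a (- 2) (vac V))"
    using comm[of 2] by (simp add: virasoro_vector_rules)
  show "mode V a 5 (mode V a (- 1) a) = scl V (3 * c') (vac V)"
    using comm[of 5] by (simp add: virasoro_vector_rules 4)
qed

lemma L_square:
  "L V 2 (mode V a (- 1) a) = scl V (8 + c') a"
  "L V 3 (mode V a (- 1) a) = 0"
  "L V 4 (mode V a (- 1) a) = scl V (3 * c') (vac V)"
proof -
  show "L V 2 (mode V a (- 1) a) = scl V (8 + c') a"
    using scale_left_distrib[of 8 "c'" a] scale_left_distrib[of "c' / 2" "c' / 2" a]
    by (simp add: virasoro_vector_rules add_ac)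
qed (simp_all add: virasoro_vector_rules)

lemma L_cube:
  "L V 2 (mode V a (- 1) (mode V a (- 1) a)) = scl V (24 + 3 / 2 * c') (mode V a (- 1) a)"
  "L V 3 (mode V a (- 1) (mode V a (- 1) a)) = scl V 15 (mode V a (- 2) (vac V))"
  "L V 6 (mode V a (- 1) (mode V a (- 1) a)) = scl V (24 * c') (vac V)"
proof -
  let ?Q = "mode V a (- 1) a"
  have "L V 2 (mode V a (- 1) ?Q) = scl V (8 + c') ?Q + scl V 16 ?Q + scl V (c' / 2) ?Q"
    using L_mode_virasoro_vector[of ?Q 2 "- 1"] by (simp add: L_square a_square mode_scl_right)
  also have "\<dots> = scl V (8 + c' + 16 + c' / 2) ?Q" by (simp only: scale_left_distrib)
  finally show "L V 2 (mode V a (- 1) ?Q) = scl V (24 + 3 / 2 * c') ?Q" by (simp add: algebra_simps)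
  show "L V 3 (mode V a (- 1) ?Q) = scl V 15 (mode V a (- 2) (vac V))"
    using L_mode_virasoro_vector[of ?Q 3 "- 1"] by (simp add: L_square a_square)
  have "?Q \<in> parity_part V False" "?Q \<in> weight_space V 4"
    using mode_parity[OF virasoro_vectorD(2)[OF a] virasoro_vectorD(2)[OF a], of "- 1"]
      weight_minus_1[OF a, of a 2] virasoro_vectorD(3)[OF a] by auto
  then have "L V 6 ?Q = 0"
    unfolding L_def by (intro mode_even_eq_0[OF virasoro_vectorD(2,3)[OF virasoro_vector_conf]]) auto
  then show "L V 6 (mode V a (- 1) ?Q) = scl V (24 * c') (vac V)"
    using L_mode_virasoro_vector[of ?Q 6 "- 1"] by (simp add: a_square)
qed

lemma L_minus_3_mode:
  "L V 2 (mode V a (- 3) a) = scl V (c' / 2) (mode V a (- 3) (vac V)) + scl V 6 (mode V a (- 1) a)"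
  "L V 3 (mode V a (- 3) a) = scl V 7 (mode V a (- 2) (vac V))"
  "L V 6 (mode V a (- 3) a) = scl V (5 * c') (vac V)"
  by (simp_all add: virasoro_vector_rules)

lemma L_minus_2_mode:
  "L V 2 (mode V a (- 2) (mode V a (- 2) (vac V))) = scl V 10 (mode V a (- 3) (vac V))"
  "L V 3 (mode V a (- 2) (mode V a (- 2) (vac V))) = scl V (4 * c' + 18) (mode V a (- 2) (vac V))"
  "L V 6 (mode V a (- 2) (mode V a (- 2) (vac V))) = scl V (18 * c') (vac V)"
proof -
  let ?s = "mode V a (- 2) (vac V)"
  note comm = virasoro_vector_commute[OF a vac_carrier, of _ "- 2"]
  have s: "mode V a 0 ?s = scl V 2 (mode V a (- 3) (vac V))" "mode V a 1 ?s = scl V 3 ?s"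
    "mode V a 4 ?s = scl V (2 * c') (vac V)"
    using comm[of 0] comm[of 1] comm[of 4] by simp_all
  have sc: "?s \<in> vcarrier V" by simp
  note Ls = L_mode_virasoro_vector[OF sc, of _ "- 2"]
  show "L V 2 (mode V a (- 2) ?s) = scl V 10 (mode V a (- 3) (vac V))"
    using Ls[of 2] by (simp add: L_vac_modes s)
  have "L V 3 (mode V a (- 2) ?s) = scl V (2 * c') ?s + scl V 18 ?s + scl V (2 * c') ?s"
    using Ls[of 3] by (simp add: L_vac_modes s mode_scl_right mult.commute)
  also have "\<dots> = scl V (2 * c' + 18 + 2 * c') ?s" by (simp only: scale_left_distrib)
  finally show "L V 3 (mode V a (- 2) ?s) = scl V (4 * c' + 18) ?s" by (simp add: algebra_simps)
  have "?s \<in> parity_part V False" "?s \<in> weight_space V 3"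
    using mode_parity[OF virasoro_vectorD(2)[OF a], of "vac V" False "- 2"] vac_even
      weight_mode[OF virasoro_vectorD(2,3)[OF a] vac_weight, of 3 "- 2"] by (auto simp: parity_part_def)
  then have "L V 6 ?s = 0"
    unfolding L_def by (intro mode_even_eq_0[OF virasoro_vectorD(2,3)[OF virasoro_vector_conf]]) auto
  then show "L V 6 (mode V a (- 2) ?s) = scl V (18 * c') (vac V)"
    using Ls[of 6] by (simp add: s)
qed

end

end

context design_svoa
begin

section \<open>The projection to the vacuum component in low weight\<close>

lemma isotypic_0_L:
  assumes "b \<in> isotypic V 0" "b \<in> weight_space V (of_nat n)"
  shows "L V k b \<in> isotypic V 0" "k = of_nat n - of_nat m \<Longrightarrow> L V k b \<in> weight_space V (of_nat m)"
    "int n < k \<or> int n = k + 1 \<Longrightarrow> L V k b = 0"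
proof -
  show U: "L V k b \<in> isotypic V 0" for k by (rule vir_submoduleD(3)[OF isotypic_submodule assms(1)])
  show "L V k b \<in> weight_space V (of_nat m)" if "k = of_nat n - of_nat m"
    using weight_L[OF assms(2), of k] that by simp
  have w: "L V k b \<in> weight_space V (of_int (int n - k))" using weight_L[OF assms(2), of k] by simp
  show "L V k b = 0" if "int n < k \<or> int n = k + 1"
  proof (rule even_weight_eq_0[OF _ w])
    show "L V k b \<in> even_part V" using U isotypic_0_even by blast
    show "Re (of_int (int n - k)) < 0 \<or> of_int (int n - k) = (1 :: complex)"
    proof (cases "int n = k + 1")
      case True
      then have "int n - k = 1" by simp
      then show ?thesis by (simp only: of_int_1) simp
    qed (use that in simp)
  qed
qed

lemma isotypic_0_carrier: "b \<in> isotypic V 0 \<Longrightarrow> b \<in> vcarrier V"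
  using isotypic_0_even even_carrier by blast

text \<open>L(1) and L(2) generate all positive modes through [L(k+1), L(1)] = k L(k+2), which
  reduces the claim to the absence of singular vectors.\<close>

lemma isotypic_0_eq_0:
  assumes b: "b \<in> isotypic V 0" "b \<in> weight_space V (of_nat n)" "n > 0" and L: "L V 1 b = 0" "L V 2 b = 0"
  shows "b = 0"
proof (rule isotypic_0_singular[OF b])
  note bc = isotypic_0_carrier[OF b(1)]
  have "L V (int k + 1) b = 0" for k
  proof (induction k)
    case (Suc k)
    show ?case
    proof (cases "k = 0")
      case False
      have "scl V (of_int (int k + 1 - 1)) (L V (int k + 1 + 1) b) = 0"
        using L_commute[OF bc, of "int k + 1" 1] Suc L(1) False by simp
      then show ?thesis using False by simp
    qed (use L in simp)
  qed (use L in simp)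
  moreover fix k :: int assume "k > 0"
  ultimately have "L V (int (nat (k - 1)) + 1) b = 0" by blast
  then show "L V k b = 0" using \<open>k > 0\<close> by simp
qed

text \<open>This and the next four lemmas separate vectors of the vacuum component by words in L(k),
  k at least 2, that end in weight 0; there is one for each partition of the weight into parts at
  least 2. L(1) is treated by the previous weight: its words on \<open>L V 1 b\<close> reduce to
  those on \<open>b\<close> by commuting L(1) to the left, where it acts on weight 1 or
  lower.\<close>

lemma isotypic_0_weight_2:
  assumes b: "b \<in> isotypic V 0" "b \<in> weight_space V 2" and L: "L V 2 b = 0"
  shows "b = 0"
proof -
  have b': "b \<in> weight_space V (of_nat 2)" using b by simp
  show ?thesis by (rule isotypic_0_eq_0[OF b(1) b']) (use isotypic_0_L(3)[OF b(1) b', of 1] L in auto)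
qed

lemma isotypic_0_weight_3:
  assumes b: "b \<in> isotypic V 0" "b \<in> weight_space V 3" and L: "L V 3 b = 0"
  shows "b = 0"
proof -
  have b': "b \<in> weight_space V (of_nat 3)" using b by simp
  have L2: "L V 2 b = 0" using isotypic_0_L(3)[OF b(1) b', of 2] by simp
  moreover have "L V 2 (L V 1 b) = 0"
    using L_commute[OF isotypic_0_carrier[OF b(1)], of 2 1] L L2 by simp
  then have "L V 1 b = 0"
    using isotypic_0_L(1)[OF b(1) b', of 1] isotypic_0_L(2)[OF b(1) b', of 1 2] isotypic_0_weight_2 by simp
  ultimately show ?thesis using isotypic_0_eq_0[OF b(1) b'] by simp
qed

lemma isotypic_0_weight_4:
  assumes b: "b \<in> isotypic V 0" "b \<in> weight_space V 4" and L: "L V 2 (L V 2 b) = 0" "L V 4 b = 0"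
  shows "b = 0"
proof -
  have b': "b \<in> weight_space V (of_nat 4)" using b by simp
  have "L V 2 b = 0"
    using isotypic_0_L(1)[OF b(1) b', of 2] isotypic_0_L(2)[OF b(1) b', of 2 2] isotypic_0_weight_2 L by simp
  moreover have "L V 3 b = 0" using isotypic_0_L(3)[OF b(1) b', of 3] by simp
  then have "L V 3 (L V 1 b) = 0"
    using L_commute[OF isotypic_0_carrier[OF b(1)], of 3 1] L by simp
  then have "L V 1 b = 0"
    using isotypic_0_L(1)[OF b(1) b', of 1] isotypic_0_L(2)[OF b(1) b', of 1 3] isotypic_0_weight_3 by simp
  ultimately show ?thesis using isotypic_0_eq_0[OF b(1) b'] by simp
qed

lemma isotypic_0_weight_5:
  assumes b: "b \<in> isotypic V 0" "b \<in> weight_space V 5" and L: "L V 3 (L V 2 b) = 0" "L V 5 b = 0"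
  shows "b = 0"
proof -
  have b': "b \<in> weight_space V (of_nat 5)" using b by simp
  note comm = L_commute[OF isotypic_0_carrier[OF b(1)]]
  have L2: "L V 2 b = 0"
    using isotypic_0_L(1)[OF b(1) b', of 2] isotypic_0_L(2)[OF b(1) b', of 2 3] isotypic_0_weight_3 L by simp
  have "L V 2 (L V 3 b) = 0" using comm[of 2 3] L L2 by simp
  then have "L V 2 (L V 2 (L V 1 b)) = 0" using comm[of 2 1] L2 by simp
  moreover have "L V 4 b = 0" using isotypic_0_L(3)[OF b(1) b', of 4] by simp
  then have "L V 4 (L V 1 b) = 0" using comm[of 4 1] L by simp
  ultimately have "L V 1 b = 0"
    using isotypic_0_L(1)[OF b(1) b', of 1] isotypic_0_L(2)[OF b(1) b', of 1 4] isotypic_0_weight_4 by simp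
  with L2 show ?thesis using isotypic_0_eq_0[OF b(1) b'] by simp
qed

lemma isotypic_0_weight_6:
  assumes b: "b \<in> isotypic V 0" "b \<in> weight_space V 6"
    and L: "L V 2 (L V 2 (L V 2 b)) = 0" "L V 4 (L V 2 b) = 0" "L V 3 (L V 3 b) = 0" "L V 6 b = 0"
  shows "b = 0"
proof -
  have b': "b \<in> weight_space V (of_nat 6)" using b by simp
  note comm = L_commute[OF isotypic_0_carrier[OF b(1)]]
  have L2: "L V 2 b = 0"
    using isotypic_0_L(1)[OF b(1) b', of 2] isotypic_0_L(2)[OF b(1) b', of 2 4] isotypic_0_weight_4 L by simp
  \<comment> \<open>As \<open>L V 2 b\<close> is already zero, L(2) L(1) b equals L(3) b, which the
    third functional handles.\<close>
  have "L V 3 (L V 2 (L V 1 b)) = 0" using comm[of 2 1] L L2 by simp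
  moreover have "L V 5 b = 0" using isotypic_0_L(3)[OF b(1) b', of 5] by simp
  then have "L V 5 (L V 1 b) = 0" using comm[of 5 1] L by simp
  ultimately have "L V 1 b = 0"
    using isotypic_0_L(1)[OF b(1) b', of 1] isotypic_0_L(2)[OF b(1) b', of 1 5] isotypic_0_weight_5 by simp
  with L2 show ?thesis using isotypic_0_eq_0[OF b(1) b'] by simp
qed

text \<open>A word of total degree equal to the weight sends the complementary part into
  \<open>positive_part\<close> at weight 0, hence to zero. The list is in order of application, so
  \<open>[2, 4]\<close> means L(4) L(2).\<close>

lemma proj0_functional:
  assumes a: "a \<in> weight_space V (of_int (sum_list ks))"
  shows "foldr (\<lambda>k u. L V k u) (rev ks) a = foldr (\<lambda>k u. L V k u) (rev ks) (proj0 V a)"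
proof -
  have "foldr (\<lambda>k u. L V k u) (rev ks) r \<in> weight_space V 0 \<and> foldr (\<lambda>k u. L V k u) (rev ks) r \<in> positive_part"
    if "r \<in> weight_space V (of_int (sum_list ks))" "r \<in> positive_part" for r
    using that
  proof (induction ks arbitrary: r)
    case (Cons k ks)
    have "L V k r \<in> weight_space V (of_int (sum_list ks))" using weight_L[OF Cons.prems(1), of k] by simp
    moreover have "L V k r \<in> positive_part" by (rule vir_submoduleD(3)[OF positive_part_submodule Cons.prems(2)])
    ultimately show ?case using Cons.IH by simp
  qed simp
  moreover have "a - proj0 V a \<in> weight_space V (of_int (sum_list ks))"
    using a proj0_weight[OF a] by (rule subspace_diff[OF subspace_weight])
  ultimately have 0: "foldr (\<lambda>k u. L V k u) (rev ks) (a - proj0 V a) = 0"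
    using proj0(2)[OF weight_carrier[OF a]] positive_part_weight_0 by blast
  have "foldr (\<lambda>k u. L V k u) (rev ks) (u - w) = foldr (\<lambda>k u. L V k u) (rev ks) u - foldr (\<lambda>k u. L V k u) (rev ks) w"
    if "u \<in> vcarrier V" "w \<in> vcarrier V" for u w
    using that by (induction ks arbitrary: u w) (auto simp: L_diff)
  then show ?thesis
    using 0 weight_carrier[OF a] weight_carrier[OF proj0_weight[OF a]] by simp
qed

lemma proj0_weight_2_eq:
  assumes a: "a \<in> weight_space V 2" and b: "b \<in> isotypic V 0" "b \<in> weight_space V 2"
    and L: "L V 2 a = L V 2 b"
  shows "proj0 V a = b"
proof -
  have U: "proj0 V a - b \<in> isotypic V 0" "proj0 V a - b \<in> weight_space V 2"
    using proj0(1)[OF weight_carrier[OF a]] proj0_weight[OF a] b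
      subspace_diff[OF vir_submoduleD(1)[OF isotypic_submodule]] subspace_diff[OF subspace_weight] by auto
  have "L V 2 (proj0 V a - b) = 0"
    using proj0_functional[of a "[2]"] a L weight_carrier[OF proj0_weight[OF a]] weight_carrier[OF b(2)]
    by (simp add: L_diff)
  then show ?thesis using isotypic_0_weight_2[OF U] by simp
qed

lemma proj0_weight_4_eq:
  assumes a: "a \<in> weight_space V 4" and b: "b \<in> isotypic V 0" "b \<in> weight_space V 4"
    and L: "L V 2 (L V 2 a) = L V 2 (L V 2 b)" "L V 4 a = L V 4 b"
  shows "proj0 V a = b"
proof -
  have U: "proj0 V a - b \<in> isotypic V 0" "proj0 V a - b \<in> weight_space V 4"
    using proj0(1)[OF weight_carrier[OF a]] proj0_weight[OF a] b
      subspace_diff[OF vir_submoduleD(1)[OF isotypic_submodule]] subspace_diff[OF subspace_weight] by auto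
  have "L V 2 (L V 2 (proj0 V a - b)) = 0" "L V 4 (proj0 V a - b) = 0"
    using proj0_functional[of a "[2, 2]"] proj0_functional[of a "[4]"] a L
      weight_carrier[OF proj0_weight[OF a]] weight_carrier[OF b(2)]
    by (simp_all add: L_diff)
  then show ?thesis using isotypic_0_weight_4[OF U] by simp
qed

lemma proj0_weight_6_eq:
  assumes a: "a \<in> weight_space V 6" and b: "b \<in> isotypic V 0" "b \<in> weight_space V 6"
    and L: "L V 2 (L V 2 (L V 2 a)) = L V 2 (L V 2 (L V 2 b))" "L V 4 (L V 2 a) = L V 4 (L V 2 b)"
      "L V 3 (L V 3 a) = L V 3 (L V 3 b)" "L V 6 a = L V 6 b"
  shows "proj0 V a = b"
proof -
  have U: "proj0 V a - b \<in> isotypic V 0" "proj0 V a - b \<in> weight_space V 6"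
    using proj0(1)[OF weight_carrier[OF a]] proj0_weight[OF a] b
      subspace_diff[OF vir_submoduleD(1)[OF isotypic_submodule]] subspace_diff[OF subspace_weight] by auto
  have "L V 2 (L V 2 (L V 2 (proj0 V a - b))) = 0" "L V 4 (L V 2 (proj0 V a - b)) = 0"
      "L V 3 (L V 3 (proj0 V a - b)) = 0" "L V 6 (proj0 V a - b) = 0"
    using proj0_functional[of a "[2, 2, 2]"] proj0_functional[of a "[2, 4]"] proj0_functional[of a "[3, 3]"]
      proj0_functional[of a "[6]"] a L weight_carrier[OF proj0_weight[OF a]] weight_carrier[OF b(2)]
    by (simp_all add: L_diff)
  then show ?thesis using isotypic_0_weight_6[OF U] by simp
qed

end

context svoa
begin

section \<open>Traces on the top level\<close>

lemma weight_component_weight: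
  assumes a: "a \<in> weight_space V (of_int k / 2)"
  shows "weight_component V a = (\<lambda>j. if j = k then a else 0)" (is "_ = ?g")
  unfolding weight_component_def
proof (rule the_equality)
  have "{j. ?g j \<noteq> 0} \<subseteq> {k}" by auto
  then have "finite {j. ?g j \<noteq> 0}" "Sum_any ?g = sum ?g {k}"
    by (auto intro: finite_subset Sum_any.expand_superset)
  then show "(\<forall>j. ?g j \<in> weight_space V (of_int j / 2)) \<and> finite {j. ?g j \<noteq> 0} \<and> a = Sum_any ?g"
    using a subspace_0[OF subspace_weight] by auto
next
  fix f assume f: "(\<forall>j. f j \<in> weight_space V (of_int j / 2)) \<and> finite {j. f j \<noteq> 0} \<and> a = Sum_any f"
  define F where "F = insert k {j. f j \<noteq> 0}"
  have F: "finite F" "k \<in> F" using f by (auto simp: F_def)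
  have "a = sum f F" using f F Sum_any.expand_superset[of F f] by (auto simp: F_def)
  then have "(\<Sum>j\<in>F. f j - ?g j) = 0" using F by (simp add: sum_subtractf)
  \<comment> \<open>Components are indexed by twice the weight, whereas
    \<open>weight_independent\<close> indexes by weight; the floor recovers the index.\<close>
  define h where "h \<mu> = (let j = \<lfloor>Re (2 * \<mu>)\<rfloor> in f j - ?g j)" for \<mu>
  have inj: "inj_on (\<lambda>j. of_int j / 2 :: complex) F" by (auto intro: inj_onI)
  have h: "h (of_int j / 2) = f j - ?g j" for j by (simp add: h_def)
  have "sum h ((\<lambda>j. of_int j / 2) ` F) = 0"
    using \<open>(\<Sum>j\<in>F. f j - ?g j) = 0\<close> by (simp only: sum.reindex[OF inj] o_def h)
  moreover have "h \<mu> \<in> weight_space V \<mu>" if \<mu>: "\<mu> \<in> (\<lambda>j. of_int j / 2) ` F" for \<mu>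
  proof -
    obtain j where j: "\<mu> = of_int j / 2" using \<mu> by blast
    have "?g j \<in> weight_space V (of_int j / 2)" using a subspace_0[OF subspace_weight] by auto
    then show ?thesis using f unfolding j h by (intro subspace_diff[OF subspace_weight]) auto
  qed
  ultimately have "\<forall>\<mu>\<in>(\<lambda>j. of_int j / 2) ` F. h \<mu> = 0"
    using F by (intro weight_independent) auto
  then have "f j = ?g j" if "j \<in> F" for j using that h[of j] by simp
  moreover have "f j = ?g j" if "j \<notin> F" for j using that by (auto simp: F_def)
  ultimately show "f = ?g" by blast
qed

lemma zero_mode_weight:
  assumes a: "a \<in> weight_space V (of_nat n)" and x: "x \<in> vcarrier V"
  shows "zero_mode V a x = mode V a (int n - 1) x"
proof -
  have "a \<in> weight_space V (of_int (2 * int n) / 2)" using a by simp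
  then have wc: "weight_component V a = (\<lambda>j. if j = 2 * int n then a else 0)"
    by (rule weight_component_weight)
  let ?f = "\<lambda>k. mode V (weight_component V a (2 * k)) (k - 1) x"
  have "{k. ?f k \<noteq> 0} \<subseteq> {int n}" using x by (auto simp: wc split: if_splits)
  then have "Sum_any ?f = sum ?f {int n}" by (intro Sum_any.expand_superset) auto
  then show ?thesis by (simp add: zero_mode_def wc)
qed

lemma subspace_top_level: "vsubspace V (top_level V)"
  unfolding top_level_def by (rule subspace_inter[OF subspace_odd subspace_weight])

text \<open>Exposes the basis chosen inside \<open>trace_on\<close> and shows that it is finite, by
  finite-dimensionality of the weight space 3/2.\<close>

lemma top_level_basis:
  obtains Bs where "finite Bs" "\<not> dependent Bs" "vspan V Bs = top_level V" "card Bs = vdim V (top_level V)"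
    "\<And>f. trace_on V (top_level V) f = (\<Sum>b\<in>Bs. representation Bs (f b) b)"
proof -
  define Bs where "Bs = (SOME B. \<not> dependent B \<and> vspan V B = top_level V)"
  obtain B0 where "B0 \<subseteq> top_level V" "\<not> dependent B0" "top_level V \<subseteq> vspan V B0"
    using maximal_independent_subset[of "top_level V"] by blast
  then have "\<not> dependent B0 \<and> vspan V B0 = top_level V"
    using span_minimal[OF _ subspace_top_level] by blast
  then have Bs: "\<not> dependent Bs" "vspan V Bs = top_level V"
    unfolding Bs_def by (metis (mono_tags, lifting) someI_ex)+
  obtain C where C: "finite C" "vspan V C = weight_space V (of_int 3 / 2)" using finite_dim by blast
  have "Bs \<subseteq> vspan V C"
    using Bs C span_superset[of Bs] by (auto simp: top_level_def)
  then have fin: "finite Bs" using independent_span_bound[OF C(1) Bs(1)] by blast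
  have "card Bs = vdim V (top_level V)"
    using dim_eq_card[of Bs "top_level V"] Bs span_span[of Bs] by metis
  then show thesis
    by (rule that[OF fin Bs]) (simp add: trace_on_def Bs_def Let_def)
qed

lemma trace_cong:
  assumes "\<And>x. x \<in> top_level V \<Longrightarrow> f x = g x"
  shows "trace_on V (top_level V) f = trace_on V (top_level V) g"
proof -
  obtain Bs where Bs: "vspan V Bs = top_level V"
    "\<And>f. trace_on V (top_level V) f = (\<Sum>b\<in>Bs. representation Bs (f b) b)"
    using top_level_basis by metis
  have "b \<in> top_level V" if "b \<in> Bs" for b using Bs(1) span_base[OF that] by simp
  then show ?thesis unfolding Bs(2) using assms by (intro sum.cong) auto
qed

lemma trace_add:
  assumes "\<And>x. x \<in> top_level V \<Longrightarrow> f x \<in> top_level V" "\<And>x. x \<in> top_level V \<Longrightarrow> g x \<in> top_level V"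
  shows "trace_on V (top_level V) (\<lambda>x. f x + g x) = trace_on V (top_level V) f + trace_on V (top_level V) g"
proof -
  obtain Bs where Bs: "\<not> dependent Bs" "vspan V Bs = top_level V"
    "\<And>f. trace_on V (top_level V) f = (\<Sum>b\<in>Bs. representation Bs (f b) b)"
    using top_level_basis by metis
  have "b \<in> top_level V" if "b \<in> Bs" for b using Bs(2) span_base[OF that] by simp
  then have "representation Bs (f b + g b) b = representation Bs (f b) b + representation Bs (g b) b" if "b \<in> Bs" for b
    using representation_add[OF Bs(1), of "g b" "f b"] assms that Bs(2) by auto
  then show ?thesis unfolding Bs(3) by (simp add: sum.distrib)
qed

lemma trace_scl:
  assumes "\<And>x. x \<in> top_level V \<Longrightarrow> f x \<in> top_level V"
  shows "trace_on V (top_level V) (\<lambda>x. scl V r (f x)) = r * trace_on V (top_level V) f"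
proof -
  obtain Bs where Bs: "\<not> dependent Bs" "vspan V Bs = top_level V"
    "\<And>f. trace_on V (top_level V) f = (\<Sum>b\<in>Bs. representation Bs (f b) b)"
    using top_level_basis by metis
  have "b \<in> top_level V" if "b \<in> Bs" for b using Bs(2) span_base[OF that] by simp
  then have "representation Bs (scl V r (f b)) b = r * representation Bs (f b) b" if "b \<in> Bs" for b
    using representation_scale[OF Bs(1), of "f b"] assms that Bs(2) by auto
  then show ?thesis unfolding Bs(3) by (simp add: sum_distrib_left)
qed

lemma trace_const: "trace_on V (top_level V) (\<lambda>x. scl V r x) = r * of_nat (vdim V (top_level V))"
proof -
  obtain Bs where Bs: "finite Bs" "\<not> dependent Bs" "vspan V Bs = top_level V" "card Bs = vdim V (top_level V)"
    "\<And>f. trace_on V (top_level V) f = (\<Sum>b\<in>Bs. representation Bs (f b) b)"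
    using top_level_basis by metis
  have "representation Bs b b = 1" if "b \<in> Bs" for b
    using representation_basis[OF Bs(2) that] by simp
  then have "trace_on V (top_level V) (\<lambda>x. x) = of_nat (vdim V (top_level V))"
    unfolding Bs(5) by (simp add: Bs(4))
  then show ?thesis using trace_scl[of "\<lambda>x. x" r] by simp
qed

lemma trace_rank_1:
  assumes add: "\<And>x y. x \<in> top_level V \<Longrightarrow> y \<in> top_level V \<Longrightarrow> \<kappa> (x + y) = \<kappa> x + \<kappa> y"
    and scl: "\<And>r x. x \<in> top_level V \<Longrightarrow> \<kappa> (scl V r x) = r * \<kappa> x"
    and w: "w \<in> top_level V"
  shows "trace_on V (top_level V) (\<lambda>x. scl V (\<kappa> x) w) = \<kappa> w"
proof -
  obtain Bs where Bs: "finite Bs" "\<not> dependent Bs" "vspan V Bs = top_level V"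
    "\<And>f. trace_on V (top_level V) f = (\<Sum>b\<in>Bs. representation Bs (f b) b)"
    using top_level_basis by metis
  have b: "b \<in> top_level V" if "b \<in> Bs" for b using Bs(3) span_base[OF that] by simp
  have \<kappa>0: "\<kappa> 0 = 0" using scl[of 0 0] subspace_0[OF subspace_top_level] by simp
  have sum: "\<kappa> (\<Sum>b\<in>T. scl V (r b) b) = (\<Sum>b\<in>T. r b * \<kappa> b)" if "finite T" "T \<subseteq> Bs" for T r
    using that
  proof (induction T rule: finite_induct)
    case (insert b' T)
    have "(\<Sum>b\<in>T. scl V (r b) b) \<in> top_level V"
      using insert b by (intro subspace_sum[OF subspace_top_level] subspace_scale[OF subspace_top_level]) auto
    then show ?case
      using insert b subspace_scale[OF subspace_top_level] by (simp add: add scl)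
  qed (simp add: \<kappa>0)
  have "representation Bs (scl V (\<kappa> b) w) b = representation Bs w b * \<kappa> b" for b
    using representation_scale[OF Bs(2), of w] w Bs(3) by simp
  then have "trace_on V (top_level V) (\<lambda>x. scl V (\<kappa> x) w) = \<kappa> (\<Sum>b\<in>Bs. scl V (representation Bs w b) b)"
    unfolding Bs(4) using sum[OF Bs(1) subset_refl] by simp
  also have "(\<Sum>b\<in>Bs. scl V (representation Bs w b) b) = w"
    using sum_representation_eq[OF Bs(2) _ Bs(1) subset_refl, of w] w Bs(3) by simp
  finally show ?thesis .
qed

end

text \<open>Both hypotheses are linear in \<open>d\<close>. The second is the cube identity after
  the reduction of tr T^3 and tr T^2 to tr T: then tr T^3 + 6 tr T^2 + 8 tr T = 861/100 tr T +
  399/25, and 21/20 d stands for c tr T.\<close>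

lemma charge_polynomial:
  fixes c d :: complex
  assumes dim: "3 * (49 - 2 * c) * d = 8 * c * (5 * c + 22)"
    and eq: "(2 * c - 1) * (5 * c + 22) * (7 * c + 68) * (861 / 100 * (21 / 20 * d) + 399 / 25 * c)
      = (504 * c ^ 3 + 2044413 / 200 * c ^ 2 + 249154983 / 4000 * c - 270033561 / 8000) * d"
    and nz: "c \<noteq> 0" "5 * c + 22 \<noteq> 0"
  shows "(2 * c - 47) * (10 * c - 7) * (82 * c - 37) = 0"
proof -
  define N where "N = 504 * c ^ 3 + 2044413 / 200 * c ^ 2 + 249154983 / 4000 * c - 270033561 / 8000"
  define p q r where "p = 2 * c - 1" and "q = 7 * c + 68" and "r = 49 - 2 * c"
  define y where "y = 5 * c + 22"
  \<comment> \<open>\<open>A\<close> is the net coefficient of \<open>d\<close> in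
    \<open>eq\<close>. Keeping the factors opaque allows \<open>c * y\<close> to be cancelled before
    anything is expanded.\<close>
  define A where "A = N - 861 / 100 * (21 / 20) * (p * y * q)"
  have eq': "p * y * q * (861 / 100 * (21 / 20 * d) + 399 / 25 * c) = N * d"
    using eq by (simp only: N_def p_def q_def y_def)
  have "c * y * (8 * A - 3 * (399 / 25) * (p * q * r)) = A * (8 * c * y) - 399 / 25 * c * (p * y * q) * (3 * r)"
    by (simp add: algebra_simps)
  also have "\<dots> = A * (3 * r * d) - 399 / 25 * c * (p * y * q) * (3 * r)"
    using dim by (simp only: y_def r_def)
  also have "\<dots> = 3 * r * (N * d - p * y * q * (861 / 100 * (21 / 20 * d) + 399 / 25 * c))"
    unfolding A_def by (simp add: algebra_simps)
  also have "\<dots> = 0" unfolding eq' by simp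
  finally have "8 * A - 3 * (399 / 25) * (p * q * r) = 0" using nz by (simp only: mult_eq_0_iff y_def) simp
  moreover have "8 * A - 3 * (399 / 25) * (p * q * r) = 189 / 1000 * ((2 * c - 47) * (10 * c - 7) * (82 * c - 37))"
    unfolding A_def N_def p_def q_def r_def y_def
    by (simp add: algebra_simps power2_eq_square power3_eq_cube)
  ultimately have "189 / 1000 * ((2 * c - 47) * (10 * c - 7) * (82 * c - 37)) = 0" by (simp only:)
  then show ?thesis unfolding mult_eq_0_iff[of "189 / 1000"] by simp
qed

section \<open>Trace identities from the 6-design property\<close>

locale extended_design_svoa = design_svoa V B + extended_svoa V e v
  for V :: "('v::ab_group_add) svoa_data" and B e v +
  assumes design: "conformal_design V 6 (top_level V)" and D6: "D6 (charge V) \<noteq> 0"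
begin

abbreviation "tr \<equiv> trace_on V (top_level V)"
abbreviation "d \<equiv> of_nat (vdim V (top_level V)) :: complex"
abbreviation "c \<equiv> charge V"

lemma charge_nonzero: "c \<noteq> 0" "5 * c + 22 \<noteq> 0" "2 * c - 1 \<noteq> 0" "7 * c + 68 \<noteq> 0"
  using D6 by (auto simp: D6_def D4_def)

lemma trace_proj0:
  assumes a: "a \<in> even_part V" "a \<in> weight_space V (of_nat n)" "n \<le> 6"
  shows "tr (mode V a (int n - 1)) = tr (mode V (proj0 V a) (int n - 1))"
proof -
  have "a \<in> vspan V (\<Union>n\<in>{0..6}. even_part V \<inter> weight_space V (of_nat n))"
    using a by (intro span_base) auto
  then have "tr (zero_mode V a) = tr (zero_mode V (proj0 V a))"
    using design by (simp add: conformal_design_def)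
  moreover have "tr (zero_mode V a') = tr (mode V a' (int n - 1))" if "a' \<in> weight_space V (of_nat n)" for a'
    using zero_mode_weight[OF that] top_levelD(3) by (intro trace_cong) auto
  ultimately show ?thesis using a proj0_weight[OF a(2)] by simp
qed

lemma trace_weight_2:
  assumes a: "a \<in> even_part V" "a \<in> weight_space V 2" and \<kappa>: "L V 2 a = scl V \<kappa> (vac V)"
  shows "tr (mode V a 1) = 3 * \<kappa> / c * d"
proof -
  let ?b = "scl V (2 * \<kappa> / c) (conf V)"
  have conf: "conf V \<in> isotypic V 0"
    using generated_base[of "{conf V}"] by (simp add: isotypic_0_generated)
  have "proj0 V a = ?b"
  proof (rule proj0_weight_2_eq[OF a(2)])
    show "?b \<in> isotypic V 0" using conf by (rule subspace_scale[OF vir_submoduleD(1)[OF isotypic_submodule]])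
    show "?b \<in> weight_space V 2" using conf_weight by (rule subspace_scale[OF subspace_weight])
    show "L V 2 a = L V 2 ?b" using charge_nonzero by (simp add: \<kappa> L_scl L_conf)
  qed
  then have "tr (mode V a 1) = tr (mode V ?b 1)" using trace_proj0[of a 2] a by simp
  also have "\<dots> = tr (\<lambda>x. scl V (3 * \<kappa> / c) x)"
    by (rule trace_cong) (simp add: mode_scl_left top_levelD conf_top)
  finally show ?thesis by (simp add: trace_const)
qed

definition T :: "'v \<Rightarrow> 'v" where "T x = mode V e 1 x"

lemma T_top: "x \<in> top_level V \<Longrightarrow> T x \<in> top_level V"
  unfolding T_def by (rule weight_2_top_level(1)[OF e_even e_weight])

lemma trace_T: "tr T = 21 / (20 * c) * d"
proof -
  have "tr T = tr (mode V e 1)" by (simp add: T_def[abs_def])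
  also have "\<dots> = 3 * (7 / 20) / c * d"
    using trace_weight_2[OF e_even e_weight, of "7 / 20"] L2_virasoro_vector[OF virasoro_e] by simp
  finally show ?thesis by simp
qed

lemma conf_monomials:
  "conf V \<in> isotypic V 0" "w \<in> isotypic V 0 \<Longrightarrow> mode V (conf V) n w \<in> isotypic V 0"
proof -
  show "conf V \<in> isotypic V 0"
    using generated_base[of "{conf V}"] by (simp add: isotypic_0_generated)
  show "mode V (conf V) n w \<in> isotypic V 0" if "w \<in> isotypic V 0"
    using vir_submoduleD(3)[OF isotypic_submodule that, of "n - 1"] by (simp add: L_def)
qed

lemma conf_mode_weight:
  "w \<in> weight_space V h \<Longrightarrow> mode V (conf V) n w \<in> weight_space V (h - of_int (n - 1))"
  using weight_L[of w h "n - 1"] by (simp add: L_def)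

lemma trace_square:
  defines "K \<equiv> c * (5 * c + 22)"
  shows "K * (tr (\<lambda>x. T (T x)) + 2 * tr T) = (7497 / 80 + 189 / 20 * (c - 7 / 10)) * d"
proof -
  let ?Q = "mode V e (- 1) e" and ?m1 = "mode V (conf V) (- 1) (conf V)" and ?m2 = "mode V (conf V) (- 3) (vac V)"
  have K: "K \<noteq> 0" using charge_nonzero by (simp add: K_def)
  \<comment> \<open>Cramer's rule for the two equations \<open>eqs\<close> below, which match L(2)
    L(2) and L(4) on \<open>?Q\<close> and on its projection; a common factor c/2 is cancelled,
    leaving the denominator \<open>K\<close>, that is D4 at c.\<close>
  define n1 where "n1 = (357 / 20 :: complex)"
  define n2 where "n2 = 21 / 10 * (c - 7 / 10)"
  define x1 where "x1 = n1 / K"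
  define x2 where "x2 = n2 / K"
  let ?b = "scl V x1 ?m1 + scl V x2 ?m2"
  have Q: "?Q \<in> even_part V" "?Q \<in> weight_space V 4"
    using mode_parity[OF e_parity e_parity, of "-1"] weight_minus_1[OF virasoro_e, of e 2] e_weight
    by (auto simp: parity_part_def)
  note LE = L_square[OF virasoro_e] L2_virasoro_vector[OF virasoro_e]
  note LC = L_square[OF virasoro_vector_conf] L_vac_modes[OF virasoro_vector_conf] L_conf
  have bU: "?b \<in> isotypic V 0"
    by (intro subspace_add[OF vir_submoduleD(1)[OF isotypic_submodule]] subspace_scale[OF vir_submoduleD(1)[OF isotypic_submodule]]
        conf_monomials vac_isotypic)
  have bW: "?b \<in> weight_space V 4"
    using conf_mode_weight[OF conf_weight, of "-1"] conf_mode_weight[OF vac_weight, of "-3"]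
    by (intro subspace_add[OF subspace_weight] subspace_scale[OF subspace_weight]) auto
  have eqs: "(8 + 7 / 10) * (7 / 20) = x1 * ((8 + c) * (c / 2)) + x2 * (6 * (c / 2))" "3 * (7 / 10) = x1 * (3 * c) + x2 * (5 * c)"
    using K unfolding x1_def x2_def n1_def n2_def by (simp_all add: field_simps, simp_all add: K_def field_simps)
  have "proj0 V ?Q = ?b"
  proof (rule proj0_weight_4_eq[OF Q(2) bU bW])
    have "L V 2 (L V 2 ?Q) = scl V ((8 + 7 / 10) * (7 / 20)) (vac V)"
      by (simp add: LE L_scl)
    also have "\<dots> = L V 2 (L V 2 ?b)"
      unfolding eqs by (simp only: LC L_scl L_add scale_left_distrib scale_right_distrib scale_scale
          add_carrier scl_carrier mode_carrier conf_carrier vac_carrier add_ac mult.assoc distrib_left distrib_right)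
    finally show "L V 2 (L V 2 ?Q) = L V 2 (L V 2 ?b)" .
    have "L V 4 ?Q = scl V (3 * (7 / 10)) (vac V)" by (simp add: LE)
    also have "\<dots> = L V 4 ?b" unfolding eqs by (simp add: LC L_scl L_add scale_left_distrib)
    finally show "L V 4 ?Q = L V 4 ?b" .
  qed
  then have "tr (mode V ?Q 3) = tr (mode V ?b 3)" using trace_proj0[OF Q(1), of 4] Q(2) by simp
  \<comment> \<open>The monomials act on the top level by scalars: 21/4 = (3/2)^2 + 2 (3/2) and 9/2
    = 3 (3/2).\<close>
  also have "\<dots> = tr (\<lambda>x. scl V (x1 * (21 / 4) + x2 * (9 / 2)) x)"
  proof (rule trace_cong)
    fix x assume x: "x \<in> top_level V"
    note xc = top_levelD(3)[OF x]
    have "mode V ?m1 3 x = scl V (21 / 4) x"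
      using zero_mode_square[OF virasoro_vector_conf x] scale_left_distrib[of "9 / 4" 3 x] xc
      by (simp add: conf_top[OF x] mode_scl_right)
    moreover have "mode V ?m2 3 x = scl V (9 / 2) x"
      using mode_mode_vac[OF conf_even xc, of 3] by (simp add: conf_top[OF x])
    ultimately show "mode V ?b 3 x = scl V (x1 * (21 / 4) + x2 * (9 / 2)) x"
      using xc by (simp add: mode_add_left mode_scl_left scale_left_distrib)
  qed
  also have "tr (mode V ?Q 3) = tr (\<lambda>x. T (T x) + scl V 2 (T x))"
    by (rule trace_cong) (simp add: zero_mode_square[OF virasoro_e] T_def)
  also have "\<dots> = tr (\<lambda>x. T (T x)) + 2 * tr T"
    using T_top by (simp add: trace_add trace_scl subspace_scale[OF subspace_top_level])
  finally show ?thesis using K by (simp add: trace_const x1_def x2_def n1_def n2_def field_simps)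
qed

text \<open>The cubic on the right is the sum of the four Cramer numerators, weighted by the scalars
  with which the zero modes of the four monomials act on the top level.\<close>

lemma trace_cube:
  defines "K \<equiv> c * (2 * c - 1) * (5 * c + 22) * (7 * c + 68)"
  shows "K * (tr (\<lambda>x. T (T (T x))) + 6 * tr (\<lambda>x. T (T x)) + 8 * tr T)
    = (504 * c ^ 3 + 2044413 / 200 * c ^ 2 + 249154983 / 4000 * c - 270033561 / 8000) * d"
proof -
  let ?P = "mode V e (- 1) (mode V e (- 1) e)"
  let ?m1 = "mode V (conf V) (- 1) (mode V (conf V) (- 1) (conf V))" and ?m2 = "mode V (conf V) (- 3) (conf V)"
    and ?m3 = "mode V (conf V) (- 2) (mode V (conf V) (- 2) (vac V))" and ?m4 = "mode V (conf V) (- 5) (vac V)"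
  have K: "K \<noteq> 0" using charge_nonzero by (simp add: K_def)
  \<comment> \<open>The Gram system of the four monomials of weight 6, solved by Cramer's rule;
    the common denominator \<open>K\<close> is \<open>D6 c\<close>.\<close>
  define n1 where "n1 = 258237 / 100 * c - 1287153 / 1000"
  define n2 where "n2 = 19887 / 50 * c ^ 2 - 49266 / 125 * c + 80997 / 1000"
  define n3 where "n3 = 651 / 20 * c ^ 2 - 13671 / 200 * c + 31899 / 1000"
  define n4 where "n4 = 336 / 5 * c ^ 3 + 19194 / 25 * c ^ 2 - 48027 / 50 * c + 136563 / 500"
  let ?b = "scl V (n1 / K) ?m1 + scl V (n2 / K) ?m2 + scl V (n3 / K) ?m3 + scl V (n4 / K) ?m4"
  have P: "?P \<in> even_part V" "?P \<in> weight_space V 6"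
    using mode_parity[OF e_parity mode_parity[OF e_parity e_parity, of "-1"], of "-1"]
      weight_minus_1[OF virasoro_e, of "mode V e (- 1) e" 4] weight_minus_1[OF virasoro_e, of e 2] e_weight
    by (auto simp: parity_part_def)
  note LE = L_cube[OF virasoro_e] L_square[OF virasoro_e] L2_virasoro_vector[OF virasoro_e] L_vac_modes[OF virasoro_e]
  note vc = virasoro_vector_conf
  note LC = L_cube[OF vc] L_square[OF vc] L_vac_modes[OF vc] L_conf L_minus_3_mode[OF vc] L_minus_2_mode[OF vc]
  have bU: "?b \<in> isotypic V 0"
    by (intro subspace_add[OF vir_submoduleD(1)[OF isotypic_submodule]] subspace_scale[OF vir_submoduleD(1)[OF isotypic_submodule]]
        conf_monomials vac_isotypic)
  have bW: "?b \<in> weight_space V 6"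
    using conf_mode_weight[OF conf_mode_weight[OF conf_weight, of "-1"], of "-1"] conf_mode_weight[OF conf_weight, of "-3"]
      conf_mode_weight[OF conf_mode_weight[OF vac_weight, of "-2"], of "-2"] conf_mode_weight[OF vac_weight, of "-5"]
    by (intro subspace_add[OF subspace_weight] subspace_scale[OF subspace_weight]) auto
  have bc: "?m1 \<in> vcarrier V" "?m2 \<in> vcarrier V" "?m3 \<in> vcarrier V" "?m4 \<in> vcarrier V" by simp_all
  \<comment> \<open>The four rows are the values of L(2)^3, L(4) L(2), L(3)^2 and L(6), on
    \<open>?P\<close> to the left and on \<open>?b\<close> to the right.\<close>
  have eqs: "(24 + 3 / 2 * (7 / 10)) * ((8 + 7 / 10) * (7 / 20)) = n1 / K * ((24 + 3 / 2 * c) * ((8 + c) * (c / 2)))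
        + n2 / K * (c / 2 * (6 * (c / 2)) + 6 * ((8 + c) * (c / 2))) + n3 / K * (10 * (6 * (c / 2))) + n4 / K * (8 * (6 * (c / 2)))"
    "(24 + 3 / 2 * (7 / 10)) * (3 * (7 / 10)) = n1 / K * ((24 + 3 / 2 * c) * (3 * c))
        + n2 / K * (c / 2 * (5 * c) + 6 * (3 * c)) + n3 / K * (10 * (5 * c)) + n4 / K * (8 * (5 * c))"
    "15 * (2 * (7 / 10)) = n1 / K * (15 * (2 * c)) + n2 / K * (7 * (2 * c)) + n3 / K * ((4 * c + 18) * (2 * c)) + n4 / K * (9 * (2 * c))"
    "24 * (7 / 10) = n1 / K * (24 * c) + n2 / K * (5 * c) + n3 / K * (18 * c) + n4 / K * (35 / 2 * c)"
    using K unfolding n1_def n2_def n3_def n4_def by (simp_all add: field_simps, simp_all add: K_def field_simps power2_eq_square power3_eq_cube)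
  have "proj0 V ?P = ?b"
  proof (rule proj0_weight_6_eq[OF P(2) bU bW])
    have "L V 2 (L V 2 (L V 2 ?P)) = scl V ((24 + 3 / 2 * (7 / 10)) * ((8 + 7 / 10) * (7 / 20))) (vac V)"
      by (simp add: LE L_scl)
    also have "\<dots> = L V 2 (L V 2 (L V 2 ?b))"
      unfolding eqs by (simp only: LC L_scl L_add scale_left_distrib scale_right_distrib scale_scale
          bc add_carrier scl_carrier mode_carrier conf_carrier vac_carrier add_ac mult.assoc distrib_left distrib_right)
    finally show "L V 2 (L V 2 (L V 2 ?P)) = L V 2 (L V 2 (L V 2 ?b))" .
    have "L V 4 (L V 2 ?P) = scl V ((24 + 3 / 2 * (7 / 10)) * (3 * (7 / 10))) (vac V)"
      by (simp add: LE L_scl)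
    also have "\<dots> = L V 4 (L V 2 ?b)"
      unfolding eqs by (simp only: LC L_scl L_add scale_left_distrib scale_right_distrib scale_scale
          bc add_carrier scl_carrier mode_carrier conf_carrier vac_carrier add_ac mult.assoc distrib_left distrib_right)
    finally show "L V 4 (L V 2 ?P) = L V 4 (L V 2 ?b)" .
    have "L V 3 (L V 3 ?P) = scl V (15 * (2 * (7 / 10))) (vac V)"
      by (simp add: LE L_scl)
    also have "\<dots> = L V 3 (L V 3 ?b)"
      unfolding eqs by (simp only: LC L_scl L_add scale_left_distrib scale_right_distrib scale_scale
          bc add_carrier scl_carrier mode_carrier conf_carrier vac_carrier add_ac mult.assoc distrib_left distrib_right)
    finally show "L V 3 (L V 3 ?P) = L V 3 (L V 3 ?b)" .
    have "L V 6 ?P = scl V (24 * (7 / 10)) (vac V)" by (simp add: LE)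
    also have "\<dots> = L V 6 ?b"
      unfolding eqs by (simp only: LC L_scl L_add scale_left_distrib scale_right_distrib scale_scale
          bc add_carrier scl_carrier mode_carrier conf_carrier vac_carrier add_ac mult.assoc distrib_left distrib_right)
    finally show "L V 6 ?P = L V 6 ?b" .
  qed
  then have "tr (mode V ?P 5) = tr (mode V ?b 5)" using trace_proj0[OF P(1), of 6] P(2) by simp
  \<comment> \<open>With s = 3/2 the action of \<open>conf_(1)\<close>: 231/8 = s^3 + 6 s^2 + 8 s,
    39/4 = 3 s^2 + 2 s, 15/2 = 5 s, and 18 is \<open>zero_mode_L_minus_3_square\<close>.\<close>
  also have "\<dots> = tr (\<lambda>x. scl V (n1 / K * (231 / 8) + n2 / K * (39 / 4) + n3 / K * 18 + n4 / K * (15 / 2)) x)"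
  proof (rule trace_cong)
    fix x assume x: "x \<in> top_level V"
    note xc = top_levelD(3)[OF x]
    have "mode V ?m1 5 x = scl V (27 / 8) x + scl V (27 / 2) x + scl V 12 x"
      using zero_mode_cube[OF vc x] xc by (simp add: conf_top[OF x] mode_scl_right)
    also have "\<dots> = scl V (27 / 8 + 27 / 2 + 12) x" by (simp only: scale_left_distrib)
    finally have m1: "mode V ?m1 5 x = scl V (231 / 8) x" by simp
    have m2: "mode V ?m2 5 x = scl V (39 / 4) x"
      using zero_mode_minus_3[OF vc x] scale_left_distrib[of "27 / 4" 3 x] xc
      by (simp add: conf_top[OF x] mode_scl_right)
    have m4: "mode V ?m4 5 x = scl V (15 / 2) x"
      using mode_mode_vac[OF conf_even xc, of 5] by (simp add: conf_top[OF x])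
    show "mode V ?b 5 x = scl V (n1 / K * (231 / 8) + n2 / K * (39 / 4) + n3 / K * 18 + n4 / K * (15 / 2)) x"
      using xc bc m1 m2 m4 zero_mode_L_minus_3_square[OF x] by (simp add: mode_add_left mode_scl_left scale_left_distrib)
  qed
  also have "\<dots> = (n1 / K * (231 / 8) + n2 / K * (39 / 4) + n3 / K * 18 + n4 / K * (15 / 2)) * d" by (rule trace_const)
  also have "tr (mode V ?P 5) = tr (\<lambda>x. T (T (T x)) + scl V 6 (T (T x)) + scl V 8 (T x))"
    by (rule trace_cong) (simp add: zero_mode_cube[OF virasoro_e] T_def)
  also have "\<dots> = tr (\<lambda>x. T (T (T x))) + 6 * tr (\<lambda>x. T (T x)) + 8 * tr T"
    using T_top by (simp add: trace_add trace_scl subspace_scale[OF subspace_top_level] subspace_add[OF subspace_top_level])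
  finally have "K * (tr (\<lambda>x. T (T (T x))) + 6 * tr (\<lambda>x. T (T x)) + 8 * tr T)
     = (n1 * (231 / 8) + n2 * (39 / 4) + n3 * 18 + n4 * (15 / 2)) * d"
    using K by (simp add: field_simps)
  also have "n1 * (231 / 8) + n2 * (39 / 4) + n3 * 18 + n4 * (15 / 2)
      = 504 * c ^ 3 + 2044413 / 200 * c ^ 2 + 249154983 / 4000 * c - 270033561 / 8000"
    unfolding n1_def n2_def n3_def n4_def by (simp add: algebra_simps)
  finally show ?thesis .
qed

section \<open>Traces from the quadratic relation, and elimination\<close>

lemma carrier_cases:
  assumes "w \<in> vcarrier V" obtains a b where "w = a + b" "a \<in> even_part V" "b \<in> odd_part V"
  using assms unfolding vcarrier_def by blast

definition \<kappa> :: "'v \<Rightarrow> complex" where "\<kappa> x = (THE r. mode V v 2 x = scl V r (vac V))"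

lemma \<kappa>: "x \<in> top_level V \<Longrightarrow> mode V v 2 x = scl V (\<kappa> x) (vac V)"
proof -
  assume x: "x \<in> top_level V"
  have "mode V v 2 x \<in> weight_space V 0"
    by (rule weight_mode[OF v_parity v_weight top_levelD(2)[OF x]]) simp
  then obtain r where r: "mode V v 2 x = scl V r (vac V)" using weight_0_vac by blast
  then show ?thesis unfolding \<kappa>_def by (simp add: r)
qed

lemma \<kappa>_linear:
  assumes "x \<in> top_level V" "y \<in> top_level V"
  shows "\<kappa> (x + y) = \<kappa> x + \<kappa> y" "\<kappa> (scl V r x) = r * \<kappa> x"
proof -
  note xc = top_levelD(3)[OF assms(1)] top_levelD(3)[OF assms(2)]
  have "scl V (\<kappa> (x + y)) (vac V) = scl V (\<kappa> x + \<kappa> y) (vac V)"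
    using \<kappa>[OF subspace_add[OF subspace_top_level assms]] \<kappa>[OF assms(1)] \<kappa>[OF assms(2)] xc
    by (simp add: mode_add_right scale_left_distrib)
  then show "\<kappa> (x + y) = \<kappa> x + \<kappa> y" by simp
  have "scl V (\<kappa> (scl V r x)) (vac V) = scl V (r * \<kappa> x) (vac V)"
    using \<kappa>[OF subspace_scale[OF subspace_top_level assms(1)], of r] \<kappa>[OF assms(1)] xc
    by (simp add: mode_scl_right)
  then show "\<kappa> (scl V r x) = r * \<kappa> x" by simp
qed

lemma \<kappa>_v: "\<kappa> v = 7 / 30"
  using \<kappa>[OF v_top] v_2_v by simp

lemma T_linear:
  assumes "x \<in> top_level V" "y \<in> top_level V"
  shows "T (scl V r x + scl V s y) = scl V r (T x) + scl V s (T y)"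
  using assms by (simp add: T_def mode_add_right mode_scl_right top_levelD)

text \<open>The constant is the trace 9 \<kappa>(v) = 9 (7/30) of the rank one correction.\<close>

lemma trace_T2: "tr (\<lambda>x. T (T x)) = tr T / 10 + 21 / 10"
proof -
  have "tr (\<lambda>x. T (T x)) = tr (\<lambda>x. scl V (1 / 10) (T x) + scl V (9 * \<kappa> x) v)"
    using top_relation[OF _ \<kappa>] by (intro trace_cong) (simp add: T_def)
  also have "\<dots> = tr (\<lambda>x. scl V (1 / 10) (T x)) + tr (\<lambda>x. scl V (9 * \<kappa> x) v)"
    by (intro trace_add subspace_scale[OF subspace_top_level] T_top v_top)
  also have "tr (\<lambda>x. scl V (9 * \<kappa> x) v) = 9 * \<kappa> v"
    using v_top by (intro trace_rank_1) (simp_all add: \<kappa>_linear algebra_simps)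
  also have "tr (\<lambda>x. scl V (1 / 10) (T x)) = 1 / 10 * tr T"
    using T_top by (rule trace_scl)
  finally show ?thesis by (simp add: \<kappa>_v)
qed

text \<open>One more \<open>T\<close> multiplies the rank one correction by the eigenvalue 3/2 of
  \<open>v\<close>, so the constant becomes 3/2 times 21/10.\<close>

lemma trace_T3: "tr (\<lambda>x. T (T (T x))) = tr (\<lambda>x. T (T x)) / 10 + 63 / 20"
proof -
  have "T (T (T x)) = scl V (1 / 10) (T (T x)) + scl V (27 / 2 * \<kappa> x) v" if x: "x \<in> top_level V" for x
  proof -
    have "T (T x) = scl V (1 / 10) (T x) + scl V (9 * \<kappa> x) v"
      using top_relation[OF x \<kappa>[OF x]] by (simp add: T_def)
    then have "T (T (T x)) = scl V (1 / 10) (T (T x)) + scl V (9 * \<kappa> x) (T v)"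
      using T_linear[OF T_top[OF x] v_top] by simp
    then show ?thesis by (simp add: T_def e_1_v)
  qed
  then have "tr (\<lambda>x. T (T (T x))) = tr (\<lambda>x. scl V (1 / 10) (T (T x)) + scl V (27 / 2 * \<kappa> x) v)"
    by (intro trace_cong)
  also have "\<dots> = tr (\<lambda>x. scl V (1 / 10) (T (T x))) + tr (\<lambda>x. scl V (27 / 2 * \<kappa> x) v)"
    by (intro trace_add subspace_scale[OF subspace_top_level] T_top v_top)
  also have "tr (\<lambda>x. scl V (27 / 2 * \<kappa> x) v) = 27 / 2 * \<kappa> v"
    using v_top by (intro trace_rank_1) (simp_all add: \<kappa>_linear algebra_simps)
  also have "tr (\<lambda>x. scl V (1 / 10) (T (T x))) = 1 / 10 * tr (\<lambda>x. T (T x))"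
    by (intro trace_scl T_top)
  finally show ?thesis by (simp add: \<kappa>_v)
qed

text \<open>Substitutes \<open>trace_T2\<close> and then \<open>trace_T\<close> into
  \<open>trace_square\<close>, after multiplying by c so that tr T enters only as c tr T = 21/20
  d.\<close>

lemma dimension_equation: "3 * (49 - 2 * c) * d = 8 * c * (5 * c + 22)"
proof -
  have t1: "c * tr T = 21 / 20 * d" using charge_nonzero by (simp add: trace_T)
  have "(5 * c + 22) * (21 / 10 * (c * tr T) + 21 / 10 * c) = c * (5 * c + 22) * (tr T / 10 + 21 / 10 + 2 * tr T)"
    by (simp add: field_simps)
  then have eq: "(5 * c + 22) * (21 / 10 * (21 / 20 * d) + 21 / 10 * c) = (7497 / 80 + 189 / 20 * (c - 7 / 10)) * d"
    using trace_square unfolding trace_T2 t1 by (simp only:)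
  have "21 / 80 * (8 * c * (5 * c + 22) - 3 * (49 - 2 * c) * d)
      = (5 * c + 22) * (21 / 10 * (21 / 20 * d) + 21 / 10 * c) - (7497 / 80 + 189 / 20 * (c - 7 / 10)) * d"
    by (simp add: field_simps)
  also have "\<dots> = 0" unfolding right_minus_eq by (rule eq)
  finally have "21 / 80 * (8 * c * (5 * c + 22) - 3 * (49 - 2 * c) * d) = 0" .
  then have "8 * c * (5 * c + 22) - 3 * (49 - 2 * c) * d = 0"
    unfolding mult_eq_0_iff[of "21 / 80"] by simp
  then show ?thesis by (simp only: right_minus_eq)
qed

lemma charge_equation: "(2 * c - 47) * (10 * c - 7) * (82 * c - 37) = 0"
proof -
  have t1: "c * tr T = 21 / 20 * d" using charge_nonzero by (simp add: trace_T)
  have expand: "K * (861 / 100 * (x * t) + 399 / 25 * x)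
      = x * K * ((t / 10 + 21 / 10) / 10 + 63 / 20 + 6 * (t / 10 + 21 / 10) + 8 * t)" for K x t :: complex
    by (simp add: field_simps)
  have "(2 * c - 1) * (5 * c + 22) * (7 * c + 68) * (861 / 100 * (c * tr T) + 399 / 25 * c)
      = c * (2 * c - 1) * (5 * c + 22) * (7 * c + 68)
        * ((tr T / 10 + 21 / 10) / 10 + 63 / 20 + 6 * (tr T / 10 + 21 / 10) + 8 * tr T)"
    unfolding expand by (simp only: mult.assoc)
  also have "\<dots> = (504 * c ^ 3 + 2044413 / 200 * c ^ 2 + 249154983 / 4000 * c - 270033561 / 8000) * d"
    using trace_cube unfolding trace_T3 trace_T2 .
  finally show ?thesis
    unfolding t1 by (rule charge_polynomial[OF dimension_equation _ charge_nonzero(1,2)])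
qed

lemma charge_and_dimension: "(c, vdim V (top_level V)) = (7 / 10, 1) \<or> (c, vdim V (top_level V)) = (47 / 2, 4371)"
proof -
  have "2 * c - 47 = 0 \<or> 10 * c - 7 = 0 \<or> 82 * c - 37 = 0"
    using charge_equation unfolding mult_eq_0_iff by blast
  then consider "c = 47 / 2" | "c = 7 / 10" | "c = 37 / 82"
    by (elim disjE) (simp_all add: field_simps)
  then show ?thesis
  proof cases
    case 1
    have "d = of_nat 4371" using dimension_equation unfolding 1 by simp
    then show ?thesis using 1 by (simp only: of_nat_eq_iff) simp
  next
    case 2
    have "d = of_nat 1" using dimension_equation unfolding 2 by simp
    then show ?thesis using 2 by (simp only: of_nat_eq_iff) simp
  next
    case 3
    \<comment> \<open>The third root is excluded by parity: an even multiple of the dimension would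
      be odd.\<close>
    have "of_nat (40426 * vdim V (top_level V)) = (of_nat 24531 :: complex)"
      using dimension_equation unfolding 3 by simp
    then have eq: "40426 * vdim V (top_level V) = 24531" by (simp only: of_nat_eq_iff)
    have "even (40426 * vdim V (top_level V))" by simp
    then have False unfolding eq by simp
    then show ?thesis ..
  qed
qed

section \<open>The case of charge 7/10\<close>

text \<open>An instance of invariance, (v_(0) v | a) = (v | a_(1) v), obtained from commutators with
  L(1) instead of the form. It makes \<open>e_(3) a\<close> depend only on the action of
  \<open>a\<close> on \<open>v\<close>.\<close>

lemma e_3:
  assumes a: "a \<in> even_part V" "a \<in> weight_space V 2"
  shows "mode V e 3 a = mode V v 2 (mode V a 1 v)"
proof -
  have ap: "a \<in> parity_part V False" and ac: "a \<in> vcarrier V"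
    using a by (auto simp: parity_part_def even_carrier)
  have v0: "mode V v k a = 0" if "k \<ge> 2" for k
    by (rule mode_odd_eq_0[OF v_parity v_weight ap a(2)]) (use that in auto)
  have a0: "mode V a k v = 0" if "k \<ge> 2" for k
    using weight_2_top_level(2)[OF a v_top that] .
  let ?y = "mode V v 0 a"
  have y: "?y \<in> parity_part V True" "?y \<in> weight_space V (5 / 2)"
    using mode_parity[OF v_parity ap, of 0] weight_mode[OF v_parity v_weight a(2), of _ 0] by auto
  have "mode V (mode V v 0 v) 3 a = mode V v 3 ?y"
  proof -
    have "mode V (mode V v 0 v) 3 a = (\<Sum>i<2. scl V ((-1) ^ i * (of_int 0 gchoose i))
              (mode V v (0 - int i) (mode V v (3 + int i) a)
               - scl V ((-1) powi 0 * (if True \<and> True then -1 else 1))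
                   (mode V v (3 + 0 - int i) (mode V v (int i) a))))"
      by (rule associativity[OF v_parity v_parity ac]) (simp_all add: v0)
    then show ?thesis by (simp add: sum_lessThan_numeral v0)
  qed
  moreover have "mode V v 3 ?y = mode V v 2 (mode V (conf V) 2 ?y)"
  proof -
    have conf: "mode V (conf V) 0 v = mode V v (- 2) (vac V)" "mode V (conf V) 1 v = scl V (3 / 2) v"
      using L_minus_1[OF v_carrier] conf_top[OF v_top] by (simp_all add: L_def)
    note comm = primary_commute[OF conf_even conf_weight v_top conf]
    have yc: "?y \<in> vcarrier V" using ac by simp
    \<comment> \<open>This product has weight 1. Hence only one term of the commutator of L(1) with
      \<open>v_(2)\<close> remains, and it trades \<open>v_(3)\<close> for \<open>v_(2)\<close>
      L(1).\<close>
    have "mode V v 2 ?y = 0"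
      by (rule mode_even_eq_0[OF v_parity v_weight y]) simp
    then show ?thesis using comm[OF yc, of 2 2] ac by simp
  qed
  moreover have "mode V (conf V) 2 ?y = mode V v 1 a"
  proof -
    have conf: "mode V (conf V) 0 v = mode V v (- 2) (vac V)" "mode V (conf V) 1 v = scl V (3 / 2) v"
      using L_minus_1[OF v_carrier] conf_top[OF v_top] by (simp_all add: L_def)
    show ?thesis
      using primary_commute[OF conf_even conf_weight v_top conf ac, of 2 0] L1_weight_2[OF a]
      by (simp add: L_def)
  qed
  moreover have "mode V v 1 a = mode V a 1 v"
    using skew_symmetry_top[OF ap v_parity, of 1] a0 by simp
  ultimately show ?thesis by (simp add: v_0_v)
qed

text \<open>With the top level spanned by \<open>v\<close>, an even \<open>a\<close> of weight 2
  acts on it by a scalar l, and the design property gives l = 30/7 k where \<open>L V 2 a\<close> is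
  k times the vacuum. By \<open>e_3\<close> and \<open>v_2_v\<close> also \<open>e_(3) a\<close> is
  7/30 l = k times the vacuum, so \<open>e\<close> and \<open>conf V\<close> pair equally with all
  such \<open>a\<close>.\<close>

lemma conf_eq_e:
  assumes c: "c = 7 / 10" and dim: "vdim V (top_level V) = 1"
  shows "conf V = e"
proof -
  let ?f = "conf V - e"
  have f: "?f \<in> even_part V" "?f \<in> weight_space V 2"
    using subspace_diff[OF subspace_even conf_even e_even] subspace_diff[OF subspace_weight conf_weight e_weight] by auto
  have fc: "?f \<in> vcarrier V" by simp
  obtain Bs where Bs: "vspan V Bs = top_level V" "card Bs = vdim V (top_level V)"
    using top_level_basis by metis
  obtain b where b: "Bs = {b}" using Bs(2) dim by (auto simp: card_1_singleton_iff)
  have span: "\<exists>r. x = scl V r b" if "x \<in> top_level V" for x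
    using that unfolding Bs(1)[symmetric] b span_singleton by blast
  have "v \<noteq> 0" using v_2_v by auto
  then obtain s where s: "v = scl V s b" "s \<noteq> 0" using span[OF v_top] by fastforce
  have top: "\<exists>r. x = scl V r v" if x: "x \<in> top_level V" for x
  proof -
    obtain r where "x = scl V r b" using span[OF x] by blast
    then have "x = scl V (r / s) v" using s by simp
    then show ?thesis by blast
  qed
  have f3: "mode V ?f 3 a = 0" if a: "a \<in> even_part V" "a \<in> weight_space V 2" for a
  proof -
    have ac: "a \<in> vcarrier V" using a even_carrier by blast
    obtain k where k: "L V 2 a = scl V k (vac V)" using weight_0_vac weight_L[OF a(2), of 2] by auto
    obtain l where l: "mode V a 1 v = scl V l v" using top weight_2_top_level(1)[OF a v_top] by blast
    have "tr (mode V a 1) = tr (\<lambda>x. scl V l x)"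
    proof (rule trace_cong)
      fix x assume "x \<in> top_level V"
      then obtain r where "x = scl V r v" using top by blast
      then show "mode V a 1 x = scl V l x" using ac by (simp add: mode_scl_right l mult.commute)
    qed
    then have "l = 30 / 7 * k"
      using trace_weight_2[OF a k] c dim by (simp add: trace_const)
    then have "mode V e 3 a = L V 2 a"
      using e_3[OF a] by (simp add: l mode_scl_right v_2_v k)
    then show ?thesis using ac by (simp add: mode_diff_left L_def)
  qed
  let ?K = "{w \<in> vcarrier V. B ?f w = 0}"
  have K: "vsubspace V ?K" using fc by (intro subspaceI) (auto simp: B_linear B_zero)
  \<comment> \<open>Distinct weights are orthogonal, so only weight 2 matters; there
    \<open>?f\<close>, written as its mode -1 on the vacuum, moves across the form as its mode
    3.\<close>
  have weight: "w \<in> ?K" if "w \<in> weight_space V h" "h = 2 \<Longrightarrow> w \<in> even_part V" for w h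
  proof (cases "h = 2")
    case True
    have wc: "w \<in> vcarrier V" using that(1) by (rule weight_carrier)
    have "B (mode V ?f (- 1) (vac V)) w = B (vac V) (mode V ?f 3 w)"
      using B_adjoint[OF f vac_carrier wc, of "- 1"] by simp
    then show ?thesis using f3 that True wc by (simp add: creation[OF fc] B_zero)
  next
    case False
    then show ?thesis using B_weight[OF f(2) that(1)] weight_carrier[OF that(1)] by auto
  qed
  have "even_part V \<subseteq> ?K"
  proof -
    have "vspan V (\<Union>n::nat. even_part V \<inter> weight_space V (of_nat n)) \<subseteq> ?K"
    proof (intro span_minimal[OF _ K] UN_least subsetI)
      fix n w assume "w \<in> even_part V \<inter> weight_space V (of_nat n)"
      then show "w \<in> ?K" using weight[of w "of_nat n"] by blast
    qed
    then show ?thesis using graded_top by (simp add: graded_with_top_weight_3_2_def)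
  qed
  moreover have "odd_part V \<subseteq> ?K"
  proof -
    have "weight_space V (3 / 2 + of_nat n) \<subseteq> ?K" for n
    proof
      fix w assume w: "w \<in> weight_space V (3 / 2 + of_nat n)"
      have "(3 / 2 + of_nat n :: complex) \<noteq> 2"
      proof
        assume "(3 / 2 + of_nat n :: complex) = 2"
        then have "(of_nat (2 * n) :: complex) = of_nat 1" by (simp add: field_simps)
        then have "2 * n = 1" by (simp only: of_nat_eq_iff)
        then show False by arith
      qed
      then show "w \<in> ?K" using weight[OF w] by blast
    qed
    then have "vspan V (\<Union>n::nat. weight_space V (3 / 2 + of_nat n)) \<subseteq> ?K"
      by (intro span_minimal[OF _ K]) blast
    then show ?thesis using graded_top by (simp add: graded_with_top_weight_3_2_def)
  qed
  ultimately have "vcarrier V \<subseteq> ?K"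
    using subspace_add[OF K] by (blast elim!: carrier_cases)
  then have "?f = 0" using nondegenerate fc unfolding nondegenerate_on_def by blast
  then show ?thesis by simp
qed

text \<open>Modulo \<open>W\<close> a vector of minimal weight \<open>h\<close> outside \<open>W\<close> is a highest weight vector for the
  \<open>N = 1\<close> algebra, so \<open>h\<close> satisfies the same quadratic equation as on the top level.\<close>

lemma subalgebra_eq_carrier:
  assumes e: "conf V = e" and W: "subalgebra V W" "v \<in> W"
  shows "W = vcarrier V"
proof -
  have Wsub: "vsubspace V W" and Wc: "W \<subseteq> vcarrier V" and Wvac: "vac V \<in> W"
    and Wmode: "\<And>a b n. a \<in> W \<Longrightarrow> b \<in> W \<Longrightarrow> mode V a n b \<in> W"
    using W by (auto simp: subalgebra_def)
  have We: "e \<in> W" using Wmode[OF W(2) W(2), of 0] by (simp add: v_0_v)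
  note add = subspace_add[OF Wsub] and scale = subspace_scale[OF Wsub] and diff = subspace_diff[OF Wsub]
    and sum = subspace_sum[OF Wsub] and zero = subspace_0[OF Wsub]
  \<comment> \<open>Strong induction on twice the weight: everything of smaller weight already lies
    in \<open>W\<close>, which plays the part of calculating modulo \<open>W\<close>.\<close>
  have main: "\<forall>p u. u \<in> parity_part V p \<longrightarrow> u \<in> weight_space V (of_nat k / 2) \<longrightarrow> u \<in> W" for k
  proof (induction k rule: less_induct)
    case (less k)
    show ?case
    proof (intro allI impI)
      fix p u assume p: "u \<in> parity_part V p" and u: "u \<in> weight_space V (of_nat k / 2)"
      note uc = weight_carrier[OF u]
      show "u \<in> W"
      proof (cases "k = 0")
        case True
        then show ?thesis using u weight_0_vac[of u] scale[OF Wvac] by auto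
      next
        case False
        have low: "w \<in> W" if w: "w \<in> parity_part V q" "w \<in> weight_space V (of_int j / 2)" "j < int k" for w q j
        proof (cases "j \<ge> 0")
          case True
          then show ?thesis using less.IH[of "nat j"] w by simp
        next
          case False
          then have "w = 0"
            using w even_weight_eq_0[of w "of_int j / 2"] odd_weight_eq_0[of w "of_int j / 2"]
            by (cases q) (auto simp: parity_part_def)
          then show ?thesis using zero by simp
        qed
        \<comment> \<open>\<open>v_(j)\<close> lowers the weight by j - 1/2 and \<open>e_(j)\<close>
          by j - 1, so these modes send \<open>u\<close> into smaller weight and hence into
          \<open>W\<close>.\<close>
        have vu: "mode V v j u \<in> W" if "j \<ge> 1" for j
        proof (rule low[OF mode_parity[OF v_parity p]])
          show "mode V v j u \<in> weight_space V (of_int (int k + 1 - 2 * j) / 2)"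
            by (rule weight_mode[OF v_parity v_weight u]) (simp add: field_simps)
        qed (use that in simp)
        have eu: "mode V e j u \<in> W" if "j \<ge> 2" for j
        proof (rule low[OF mode_parity[OF e_parity p]])
          show "mode V e j u \<in> weight_space V (of_int (int k + 2 - 2 * j) / 2)"
            by (rule weight_mode[OF e_parity e_weight u]) (simp add: field_simps)
        qed (use that in simp)
        define h where "h = (of_nat k / 2 :: complex)"
        have e1: "mode V e 1 u = scl V h u" using u e by (simp add: weight_space_def L_def h_def)
        obtain N1 where N1: "\<forall>i\<ge>N1. mode V v i u = 0" using truncation[OF v_carrier uc] by blast
        obtain N2 where N2: "\<forall>i\<ge>N2. mode V e i u = 0" using truncation[OF e_carrier uc] by blast
        define N where "N = nat (max N1 N2)"
        have vN: "mode V v (int i) u = 0" if "i \<ge> Suc (Suc N)" for i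
          using N1 that by (auto simp: N_def)
        have eN: "mode V e (int i) u = 0" if "i \<ge> Suc (Suc N)" for i
          using N2 that by (auto simp: N_def)
        have eN3: "mode V e (3 + int i) u = 0" if "i \<ge> Suc (Suc N)" for i
          using eN[of "i + 3"] that by (simp add: add.commute)
        \<comment> \<open>Modulo \<open>W\<close> only \<open>v_(1) v_(0) u\<close> survives, and
          the anticommutator turns it into \<open>e_(1) u\<close>, that is h times
          \<open>u\<close>.\<close>
        have A: "mode V (mode V v (- 2) v) 3 u - scl V h u \<in> W"
        proof -
          let ?t = "\<lambda>i. scl V (of_nat (Suc i)) (mode V v (- 2 - int i) (mode V v (3 + int i) u) + mode V v (1 - int i) (mode V v (int i) u))"
          have "?t (Suc i) \<in> W" for i
            by (intro scale add Wmode W vu) auto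
          then have S: "(\<Sum>i<Suc N. ?t (Suc i)) \<in> W" by (intro sum)
          have t0: "?t 0 - scl V h u = mode V v (- 2) (mode V v 3 u) - mode V v 0 (mode V v 1 u)"
            by (simp add: v_v_anticommute[OF uc] e1)
          have t0: "?t 0 - scl V h u \<in> W" unfolding t0 by (intro diff Wmode W vu) auto
          have "mode V (mode V v (- 2) v) 3 u = (\<Sum>i<Suc (Suc N). ?t i)"
            by (rule v_minus_2_v_mode[OF uc vN])
          then have eq: "mode V (mode V v (- 2) v) 3 u - scl V h u = (?t 0 - scl V h u) + (\<Sum>i<Suc N. ?t (Suc i))"
            unfolding sum.lessThan_Suc_shift[of _ "Suc N"] by (simp only: algebra_simps)
          show ?thesis unfolding eq by (rule add[OF t0 S])
        qed
        \<comment> \<open>The same scalar as T^2 + 2 T on the top level: 2 h comes from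
          \<open>e_(2) e_(0) u\<close> and h^2 from \<open>e_(1) e_(1) u\<close>.\<close>
        have Bsq: "mode V (mode V e (- 1) e) 3 u - scl V (h ^ 2 + 2 * h) u \<in> W"
        proof -
          let ?t = "\<lambda>i. mode V e (- 1 - int i) (mode V e (3 + int i) u) + mode V e (3 - 1 - int i) (mode V e (int i) u)"
          have "?t (Suc (Suc i)) \<in> W" for i
            by (intro add Wmode We eu) auto
          then have S: "(\<Sum>i<N. ?t (Suc (Suc i))) \<in> W" by (intro sum)
          have "mode V e 2 (mode V e 0 u) = mode V e 0 (mode V e 2 u) + scl V (2 * h) u"
            using e_commute[OF uc, of 2 0] by (simp add: e1)
          then have t0: "?t 0 - scl V (2 * h) u = mode V e (- 1) (mode V e 3 u) + mode V e 0 (mode V e 2 u)" by simp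
          have t0: "?t 0 - scl V (2 * h) u \<in> W" unfolding t0 by (intro add Wmode We eu) auto
          have "mode V e 1 (mode V e 1 u) = scl V (h ^ 2) u"
            using uc by (simp add: e1 mode_scl_right power2_eq_square)
          then have t1: "?t 1 - scl V (h ^ 2) u = mode V e (- 2) (mode V e 4 u)" by simp
          have t1: "?t 1 - scl V (h ^ 2) u \<in> W" unfolding t1 by (intro Wmode We eu) auto
          have "mode V (mode V e (- 1) e) 3 u = (\<Sum>i<Suc (Suc N). ?t i)"
            by (rule mode_mode_minus_1[OF e_even e_even uc eN3 eN])
          also have "\<dots> = ?t 0 + (?t 1 + (\<Sum>i<N. ?t (Suc (Suc i))))"
            by (simp only: sum.lessThan_Suc_shift One_nat_def)
          finally have "mode V (mode V e (- 1) e) 3 u - scl V (h ^ 2 + 2 * h) u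
            = (?t 0 - scl V (2 * h) u) + ((?t 1 - scl V (h ^ 2) u) + (\<Sum>i<N. ?t (Suc (Suc i))))"
            by (simp only: scale_left_distrib) (simp only: algebra_simps)
          then show ?thesis using add[OF t0 add[OF t1 S]] by simp
        qed
        have C: "mode V (mode V e (- 3) (vac V)) 3 u = scl V (3 * h) u"
          using mode_mode_vac[OF e_even uc, of 3] by (simp add: e1)
        have R: "mode V (mode V v (- 2) v) 3 u = scl V (1 / 3) (mode V (mode V e (- 1) e) 3 u) + scl V (3 / 10 * h) u"
          using uc by (simp add: v_minus_2_v mode_add_left mode_scl_left C)
        let ?Q = "mode V (mode V e (- 1) e) 3 u"
        have "scl V (1 / 3) (?Q - scl V (h ^ 2 + 2 * h) u) - (mode V (mode V v (- 2) v) 3 u - scl V h u) \<in> W"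
          by (rule diff[OF scale[OF Bsq] A])
        also have "scl V (1 / 3) (?Q - scl V (h ^ 2 + 2 * h) u) - (mode V (mode V v (- 2) v) 3 u - scl V h u)
          = scl V h u - scl V (1 / 3 * (h ^ 2 + 2 * h)) u - scl V (3 / 10 * h) u"
          unfolding R by (simp add: scale_right_diff_distrib)
        also have "\<dots> = scl V (h - 1 / 3 * (h ^ 2 + 2 * h) - 3 / 10 * h) u"
          by (simp only: scale_left_diff_distrib)
        finally have "scl V (h - 1 / 3 * (h ^ 2 + 2 * h) - 3 / 10 * h) u \<in> W" .
        moreover have "h - 1 / 3 * (h ^ 2 + 2 * h) - 3 / 10 * h = - (h * (10 * h - 1) / 30)"
          by (simp add: field_simps power2_eq_square)
        \<comment> \<open>The root 1/10 is not a half-integer: with \<open>h = k / 2\<close> it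
          would require 5 k = 1. The root 0 is the vacuum case, already treated.\<close>
        moreover have "h * (10 * h - 1) \<noteq> 0"
        proof -
          have "(of_nat (5 * k) :: complex) \<noteq> of_nat 1" by (simp only: of_nat_eq_iff) presburger
          then show ?thesis using False by (simp add: h_def)
        qed
        ultimately have "scl V r u \<in> W" "r \<noteq> 0" if "r = - (h * (10 * h - 1) / 30)" for r
          using that by simp_all
        then obtain r where "scl V r u \<in> W" "r \<noteq> 0" by blast
        then show ?thesis using scale[of "scl V r u" "1 / r"] by simp
      qed
    qed
  qed
  have "even_part V \<subseteq> W"
  proof -
    have "even_part V \<inter> weight_space V (of_nat n) \<subseteq> W" for n
      using main[of "2 * n", rule_format, of _ False] by (simp add: parity_part_def subset_iff)
    then have "vspan V (\<Union>n::nat. even_part V \<inter> weight_space V (of_nat n)) \<subseteq> W"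
      by (intro span_minimal[OF _ Wsub]) blast
    then show ?thesis using graded_top by (simp add: graded_with_top_weight_3_2_def)
  qed
  moreover have "odd_part V \<subseteq> W"
  proof -
    have odd: "odd_part V = vspan V (\<Union>n::nat. weight_space V (3 / 2 + of_nat n))"
      using graded_top by (simp add: graded_with_top_weight_3_2_def)
    have "weight_space V (3 / 2 + of_nat n) \<subseteq> W" for n
    proof
      fix w assume w: "w \<in> weight_space V (3 / 2 + of_nat n)"
      then have "w \<in> parity_part V True"
        unfolding parity_part_def odd by (auto intro: span_base)
      moreover have "w \<in> weight_space V (of_nat (3 + 2 * n) / 2)"
        using w by (simp add: add_divide_distrib)
      ultimately show "w \<in> W" by (rule main[rule_format])
    qed
    then show ?thesis unfolding odd by (intro span_minimal[OF _ Wsub]) blast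
  qed
  ultimately have "vcarrier V \<subseteq> W" using add by (auto elim!: carrier_cases)
  then show ?thesis using Wc by blast
qed

end

theorem mainTheorem3:
  fixes V :: "('v::ab_group_add) svoa_data"
    and B :: "'v \<Rightarrow> 'v \<Rightarrow> complex"
    and e v :: 'v
    and W :: "'v set"
  assumes "svoa V"
    and "CFT_type V" and "self_dual V"
    and "graded_with_top_weight_3_2 V"
    and "invariant_form V B" and "nondegenerate_on B (vcarrier V)"
    and "nondegenerate_on B (generated_subalgebra V {conf V})"
    and "direct_sum_of_highest_weight_modules V"
    and "design_nondegeneracy V"
    and "conformal_design V 6 (top_level V)"
    and "simple_virasoro_vector V (7 / 10) e"
    and "extending_square_root V e v"
    and "W = generated_subalgebra V {e, v}"
  shows "((charge V, vdim V (top_level V)) = (7 / 10, 1)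
          \<or> (charge V, vdim V (top_level V)) = (47 / 2, 4371))
         \<and> (W \<subset> vcarrier V \<longrightarrow> (charge V, vdim V (top_level V)) = (47 / 2, 4371))"
proof -
  interpret svoa V by (rule assms(1))
  interpret extended_design_svoa V B e v
  proof
    show "D6 (charge V) \<noteq> 0" using assms(9,10) by (simp add: design_nondegeneracy_def)
    show "virasoro_vector V (7 / 10) e" using assms(11) by (simp add: simple_virasoro_vector_def)
  qed (fact assms)+
  have W: "subalgebra V W" "v \<in> W"
    using subalgebra_generated[of "{e, v}"] generated_base[of "{e, v}"] assms(13) by auto
  have "W = vcarrier V" if "(charge V, vdim V (top_level V)) = (7 / 10, 1)"
    using subalgebra_eq_carrier[OF conf_eq_e W] that by simp
  then show ?thesis using charge_and_dimension by blast
qed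

end
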